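(* Let $d\ge 1$ be a constant integer and let $\mathtt{op}:\mathbb{N}^r\to\mathbb{N}$ be an operation of arity $r\ge 1$ which is computable in linear time on a cellular automaton. There is a RAM with addition such that, for any input integer $N>0$: (1) (pre-computation) the RAM computes some tables in time $O(N)$; (2) (operation) from these pre-computed tables and after reading $r$ integers $X_1,\dots,X_r<N^d$, the RAM computes in constant time the integer $\mathtt{op}(X_1,\dots,X_r)$.
   Context: A cellular automaton (CA) $\mathcal A=(Q,\delta)$ has a finite state set $Q$ and a transition function $\delta:Q^3\to Q$; a configuration is a bi-infinite word $(c_i)_{i\in\mathbb Z}\in Q^{\mathbb Z}$, and its successor is $\delta(C)=(c'_i)$ with $c'_i=\delta(c_{i-1},c_i,c_{i+1})$; $\delta^j$ denotes $j$ iterations. For a finite nonempty word $w$ over an alphabet $\Sigma\subset Q$, the word configuration $\sharp w\sharp$ is $\cdots\sharp\sharp w\sharp\sharp\cdots$ for a special state $\sharp\in Q\setminus\Sigma$. A state $\sharp$ is permanent on the right if $\delta(q,\sharp,\sharp)=\sharp$ for all $q\in Q$ and $\delta(q_{-1},q,q_1)\ne\sharp$ for all $q\ne\sharp$ and all $q_{-1},q_1$. A CA computes $f:\Sigma^+\to\Sigma'^+$ in linear time if $\Sigma\subset Q$, there are a nonempty set of output states $Q_{out}\subset Q\setminus\Sigma$, a state $q_\sharp\in Q_{out}$, a state $\sharp\in Q\setminus(Q_{out}\cup\Sigma\cup\Sigma')$ permanent on the right, an integer $c\ge1$ and a map $\pi:Q_{out}\cup\{\sharp\}\to\Sigma'\cup\{\sharp\}$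 with $\pi(q_\sharp)=\pi(\sharp)=\sharp$ and $\pi(q)\in\Sigma'$ for $q\in Q_{out}\setminus\{q_\sharp\}$, such that for every $n>0$ and $w\in\Sigma^n$ there is $T\le cn$ with $\delta^T(\sharp w\sharp)=\sharp (q_\sharp)^k v\sharp$ for some $k\ge0$ and $v=v_m\cdots v_1\in(Q_{out}\setminus\{q_\sharp\})^+$, no cell of $\delta^t(\sharp w\sharp)$ is in a state of $Q_{out}$ for $t<T$, and $f(w)=\pi(v_m)\cdots\pi(v_1)$. An operation $\mathtt{op}:\mathbb N^r\to\mathbb N$ is computable in linear time on a CA if some CA computes in linear time the function $X_1;\cdots;X_r\mapsto Y$ from $\{0,1,;\}^+$ to $\{0,1\}^+$, where the $X_i$ are binary representations and $Y$ is a binary representation of $\mathtt{op}(X_1,\dots,X_r)$, possibly with leading zeros. RAM model: registers holding natural numbers (accumulator $A$, buffer $B$, work registers $R[0],R[1],\dots$ initialized to $0$, size register $N$); instructions $\mathtt{CST}\ j$, $B\gets A$, $R[A]\gets B$, $A\gets R[A]$, conditional jump on $A=0$, $A\gets N$, output, and $A\gets A+B$ (addition is the only operation); unit cost per instruction; register contents and addresses $O(N)$. Integers less than $N^d$ are handled as a constant number of registers holding their digits in a base of order $N^{1/2}$. *)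

theory Defs
  imports Complex_Main
begin

section \<open>Cellular automata\<close>

record 'q ca =
  states :: "'q set"
  delta :: "'q \<Rightarrow> 'q \<Rightarrow> 'q \<Rightarrow> 'q"

definition is_ca :: "'q ca \<Rightarrow> bool" where
  "is_ca M \<longleftrightarrow> finite (states M) \<and>
     (\<forall>a\<in>states M. \<forall>b\<in>states M. \<forall>c\<in>states M. delta M a b c \<in> states M)"

type_synonym 'q config = "int \<Rightarrow> 'q"

definition ca_succ :: "'q ca \<Rightarrow> 'q config \<Rightarrow> 'q config" where
  "ca_succ M C = (\<lambda>i. delta M (C (i - 1)) (C i) (C (i + 1)))"

text \<open>The word \<open>w\<close> occupies the cells from \<open>p\<close> on; all other cells carry the symbol \<open>s\<close>.\<close>

definition word_config :: "'q \<Rightarrow> int \<Rightarrow> 'q list \<Rightarrow> 'q config" where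
  "word_config s p w =
     (\<lambda>i. if p \<le> i \<and> i < p + int (length w) then w ! nat (i - p) else s)"

definition permanent_right :: "'q ca \<Rightarrow> 'q \<Rightarrow> bool" where
  "permanent_right M s \<longleftrightarrow>
     (\<forall>q\<in>states M. delta M q s s = s) \<and>
     (\<forall>q\<in>states M - {s}. \<forall>q1\<in>states M. \<forall>q2\<in>states M. delta M q1 q q2 \<noteq> s)"

text \<open>
  The computed function may be partial: a function defined on all nonempty words over \<open>\<Sigma>\<close>
  is one with domain \<open>{w \<in> lists \<Sigma>. w \<noteq> []}\<close>.  Bi-infinite words are taken up to translation,
  so the input starts at cell 0 and the output word at some cell \<open>p\<close>.
\<close>

definition ca_computes_linear_time ::
  "'q ca \<Rightarrow> 'q set \<Rightarrow> 'q set \<Rightarrow> ('q list \<rightharpoonup> 'q list) \<Rightarrow> bool" where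
  "ca_computes_linear_time M \<Sigma> \<Sigma>' f \<longleftrightarrow>
     is_ca M \<and> \<Sigma> \<subseteq> states M \<and> dom f \<subseteq> {w \<in> lists \<Sigma>. w \<noteq> []} \<and>
     (\<exists>Qout qs sharp (c::nat) \<pi>.
        Qout \<subseteq> states M - \<Sigma> \<and> qs \<in> Qout \<and>
        sharp \<in> states M - (Qout \<union> \<Sigma> \<union> \<Sigma>') \<and> permanent_right M sharp \<and> 1 \<le> c \<and>
        \<pi> qs = sharp \<and> \<pi> sharp = sharp \<and> (\<forall>q\<in>Qout - {qs}. \<pi> q \<in> \<Sigma>') \<and>
        (\<forall>w\<in>dom f. \<exists>T k v p.
           T \<le> c * length w \<and>
           v \<noteq> [] \<and> set v \<subseteq> Qout - {qs} \<and>
           (ca_succ M ^^ T) (word_config sharp 0 w) = word_config sharp p (replicate k qs @ v) \<and>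
           (\<forall>t<T. \<forall>i. (ca_succ M ^^ t) (word_config sharp 0 w) i \<notin> Qout) \<and>
           f w = Some (map \<pi> v)))"

text \<open>
  A countable universe of states.  A finite state set containing the three
  letters \<open>0\<close>, \<open>1\<close>, \<open>;\<close> is, up to renaming of its other states, a finite subset of this type.
\<close>

datatype symbol = Bit bool | Semicolon | State nat

text \<open>Most significant bit first, without leading zeros; zero is written \<open>0\<close>.\<close>

fun binary :: "nat \<Rightarrow> bool list" where
  "binary n = (if n < 2 then [n = 1] else binary (n div 2) @ [odd n])"

declare binary.simps [simp del]

definition binary_value :: "bool list \<Rightarrow> nat" where
  "binary_value bs = horner_sum of_bool 2 (rev bs)"

fun operands_word :: "nat list \<Rightarrow> symbol list" where
  "operands_word [] = []"
| "operands_word [x] = map Bit (binary x)"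
| "operands_word (x # y # xs) = map Bit (binary x) @ Semicolon # operands_word (y # xs)"

text \<open>
  An operation of arity \<open>r\<close> is applied to lists of length \<open>r\<close>.  The operands are given by their
  ordinary binary notation; only the result may have leading zeros.
\<close>

definition ca_linear_time_operation :: "nat \<Rightarrow> (nat list \<Rightarrow> nat) \<Rightarrow> bool" where
  "ca_linear_time_operation r opr \<longleftrightarrow>
     (\<exists>(M :: symbol ca) f.
        ca_computes_linear_time M (insert Semicolon (range Bit)) (range Bit) f \<and>
        dom f = operands_word ` {Xs. length Xs = r} \<and>
        (\<forall>Xs. length Xs = r \<longrightarrow>
           (\<exists>Y. f (operands_word Xs) = Some (map Bit Y) \<and> binary_value Y = opr Xs)))"


section \<open>RAM with addition\<close>

datatype instr =
    Cst nat         \<comment> \<open>\<open>A \<leftarrow> j\<close>\<close>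
  | Buffer          \<comment> \<open>\<open>B \<leftarrow> A\<close>\<close>
  | Store           \<comment> \<open>\<open>R[A] \<leftarrow> B\<close>\<close>
  | Load            \<comment> \<open>\<open>A \<leftarrow> R[A]\<close>\<close>
  | Jzero nat nat   \<comment> \<open>if \<open>A = 0\<close> go to the first label, else to the second\<close>
  | GetN            \<comment> \<open>\<open>A \<leftarrow> N\<close>\<close>
  | Output          \<comment> \<open>emit the content of \<open>A\<close>\<close>
  | Add             \<comment> \<open>\<open>A \<leftarrow> A + B\<close>\<close>

type_synonym program = "instr list"

record ram_state =
  pc :: nat
  acc :: nat
  buf :: nat
  reg :: "nat \<Rightarrow> nat"
  outputs :: "nat list"

primrec exec :: "nat \<Rightarrow> instr \<Rightarrow> ram_state \<Rightarrow> ram_state" where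
  "exec N (Cst j) s = s\<lparr>pc := Suc (pc s), acc := j\<rparr>"
| "exec N Buffer s = s\<lparr>pc := Suc (pc s), buf := acc s\<rparr>"
| "exec N Store s = s\<lparr>pc := Suc (pc s), reg := (reg s)(acc s := buf s)\<rparr>"
| "exec N Load s = s\<lparr>pc := Suc (pc s), acc := reg s (acc s)\<rparr>"
| "exec N (Jzero l0 l1) s = s\<lparr>pc := (if acc s = 0 then l0 else l1)\<rparr>"
| "exec N GetN s = s\<lparr>pc := Suc (pc s), acc := N\<rparr>"
| "exec N Output s = s\<lparr>pc := Suc (pc s), outputs := outputs s @ [acc s]\<rparr>"
| "exec N Add s = s\<lparr>pc := Suc (pc s), acc := acc s + buf s\<rparr>"

text \<open>The machine halts when the program counter leaves the program.\<close>

definition halted :: "program \<Rightarrow> ram_state \<Rightarrow> bool" where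
  "halted P s \<longleftrightarrow> length P \<le> pc s"

definition ram_step :: "program \<Rightarrow> nat \<Rightarrow> ram_state \<Rightarrow> ram_state" where
  "ram_step P N s = (if halted P s then s else exec N (P ! pc s) s)"

definition ram_init :: ram_state where
  "ram_init = \<lparr>pc = 0, acc = 0, buf = 0, reg = (\<lambda>_. 0), outputs = []\<rparr>"

text \<open>
  Addresses used by \<open>Store\<close> and \<open>Load\<close> are contents of the accumulator, so this bounds them too.
\<close>

definition contents_bounded :: "nat \<Rightarrow> ram_state \<Rightarrow> bool" where
  "contents_bounded L s \<longleftrightarrow> acc s \<le> L \<and> buf s \<le> L \<and> (\<forall>a. reg s a \<le> L)"

text \<open>
  Started in \<open>s\<close>, the program \<open>P\<close> halts in state \<open>s'\<close> after at most \<open>T\<close> steps, and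
  register contents and addresses never exceed \<open>L\<close>.
\<close>

definition ram_computes ::
  "program \<Rightarrow> nat \<Rightarrow> nat \<Rightarrow> nat \<Rightarrow> ram_state \<Rightarrow> ram_state \<Rightarrow> bool" where
  "ram_computes P N L T s s' \<longleftrightarrow>
     (\<exists>t\<le>T. (ram_step P N ^^ t) s = s' \<and> halted P s' \<and>
        (\<forall>u\<le>t. contents_bounded L ((ram_step P N ^^ u) s)))"

text \<open>
  The maximum only matters for \<open>N = 1\<close>, where \<open>\<lceil>sqrt N\<rceil>\<close> is not a base.  Since
  \<open>N \<le> (base N)\<^sup>2\<close>, an integer below \<open>N ^ d\<close> has at most \<open>2 * d\<close> digits.
\<close>

definition base :: "nat \<Rightarrow> nat" where
  "base N = max 2 (nat \<lceil>sqrt (real N)\<rceil>)"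

text \<open>The \<open>m\<close> lowest digits of \<open>x\<close> in base \<open>b\<close>, least significant first.\<close>

definition digits :: "nat \<Rightarrow> nat \<Rightarrow> nat \<Rightarrow> nat list" where
  "digits b m x = map (\<lambda>j. x div b ^ j mod b) [0..<m]"

text \<open>
  Reading the operands puts their digits, \<open>2 * d\<close> for each operand, into the work registers
  \<open>R[0], R[1], \<dots>\<close>; all other registers keep the contents left by the pre-computation.
\<close>

definition read_operands :: "nat \<Rightarrow> nat \<Rightarrow> nat list \<Rightarrow> ram_state \<Rightarrow> ram_state" where
  "read_operands N d Xs s =
     (let ds = concat (map (digits (base N) (2 * d)) Xs)
      in s\<lparr>pc := 0, outputs := [],
           reg := (\<lambda>a. if a < length ds then ds ! a else reg s a)\<rparr>)"

end

theory Submission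
  imports Defs
begin

text \<open>
  Put \<open>l\<close> of order \<open>log N\<close> so small that the triples of words of length \<open>l\<close> over the
  \<open>q\<close> states number \<open>O(N)\<close>.  One step of the automaton, with the cells shifted right, is a Mealy
  machine reading the configuration from left to right, and \<open>l\<close> steps are a cascade of \<open>l\<close> such
  machines with \<open>q ^ (2 * l)\<close> states.  A table of size \<open>O(N)\<close> gives its effect on
  every word of length at most \<open>l\<close>.  A configuration of length \<open>O(log N)\<close> is a bounded number of such
  words, whose lengths may vary, so no realignment is ever needed, and a bounded number of passes
  performs the \<open>O(log N)\<close> steps of the automaton.  Outputs are frozen, hence the exact stopping time
  does not matter.

  Operands pass from base \<open>base N\<close> to base \<open>2 ^ l\<close> through tables of the multiples
  \<open>x * base N ^ j\<close> of the powers of the base, which are filled by repeated addition; the result returns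
  through a table of \<open>v * 2 ^ e\<close> for the value \<open>v\<close> of each word and each position \<open>e\<close>.
\<close>

section \<open>An imperative language and its compilation\<close>

text \<open>The shift to the right does two things. A new cell then depends only on cells already
  read, so a machine need remember just the last two of them; and the left end of the configuration,
  which may advance by one cell per step, stays at place 0. On the other side permanence of
  \<open>sharp\<close> forbids any growth, so the input followed by \<open>t\<close> blanks is a
  window wide enough for \<open>t\<close> steps. Of the three words in a triple two make up the
  state of the cascade, a word over pairs, and one is the input; so \<open>l\<close> is chosen with
  \<open>N <= q ^ (3 * l) <= q ^ 3 * N\<close>. The obstacle is the weakness of the machine: it
  adds, but cannot compare, subtract, or multiply two variables. So loops run up to a marked cell,
  one table decides \<open>y >= N\<close>, products arise only as running sums, and the start of
  each table row is itself tabulated. Words of varying length need codes without gaps: in bijective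
  numeration a table over all words of length at most \<open>l\<close> is an initial segment of the
  numbers. The operation contains no loop; it is unrolled, and its number of instructions does not
  depend on \<open>N\<close>.\<close>

type_synonym nm = "nat \<times> nat"
type_synonym store = "nm \<Rightarrow> nat \<Rightarrow> nat"

text \<open>
  A name \<open>(h, i)\<close> denotes an infinite array; a variable is an array of which only cell 0 is used.
  The second summand of \<open>AddV\<close> is a variable because it can then be loaded without disturbing
  the buffer.
\<close>

datatype exp =
    Const nat
  | Size
  | Idx nm exp
  | AddC exp nat
  | AddV exp nm

abbreviation Var :: "nm \<Rightarrow> exp" where
  "Var k \<equiv> Idx k (Const 0)"

text \<open>\<open>Until\<close> stops at a nonzero test because the machine can only test for 0 and
  the loops look for a cell marked 1.\<close>

datatype com =
    Skip
  | Put nm exp exp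
  | Seq com com (infixr ";;" 60)
  | If0 exp com com
  | Until exp com

abbreviation Set :: "nm \<Rightarrow> exp \<Rightarrow> com" (infix "::=" 61) where
  "k ::= e \<equiv> Put k (Const 0) e"

definition upd :: "store \<Rightarrow> nm \<Rightarrow> nat \<Rightarrow> nat \<Rightarrow> store" where
  "upd s k x v = s(k := (s k)(x := v))"

lemma upd_apply [simp]: "upd s k x v k' y = (if k' = k \<and> y = x then v else s k' y)"
  by (simp add: upd_def)

primrec eval :: "nat \<Rightarrow> store \<Rightarrow> exp \<Rightarrow> nat" where
  "eval N s (Const j) = j"
| "eval N s Size = N"
| "eval N s (Idx k e) = s k (eval N s e)"
| "eval N s (AddC e j) = eval N s e + j"
| "eval N s (AddV e k) = eval N s e + s k 0"

text \<open>Every intermediate value is bounded, not only the result, because each passes through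
  the accumulator and \<open>contents_bounded\<close> is demanded at all times. Values fetched from
  arrays are covered by \<open>bounded_store\<close>.\<close>

primrec fits :: "nat \<Rightarrow> nat \<Rightarrow> store \<Rightarrow> exp \<Rightarrow> bool" where
  "fits N X s (Const j) \<longleftrightarrow> j \<le> X"
| "fits N X s Size \<longleftrightarrow> N \<le> X"
| "fits N X s (Idx k e) \<longleftrightarrow> fits N X s e"
| "fits N X s (AddC e j) \<longleftrightarrow> fits N X s e \<and> eval N s e + j \<le> X"
| "fits N X s (AddV e k) \<longleftrightarrow> fits N X s e \<and> eval N s e + s k 0 \<le> X"

text \<open>Time counts assignments and tests only. Each expression compiles to code of fixed
  length, so this agrees with machine time up to a constant factor.\<close>

inductive big :: "nat \<Rightarrow> nat \<Rightarrow> com \<Rightarrow> store \<Rightarrow> nat \<Rightarrow> store \<Rightarrow> bool" for N X where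
  Skip: "big N X Skip s 0 s"
| Put: "fits N X s e \<Longrightarrow> fits N X s e' \<Longrightarrow>
    big N X (Put k e e') s 1 (upd s k (eval N s e) (eval N s e'))"
| Seq: "big N X c s t s' \<Longrightarrow> big N X c' s' t' s'' \<Longrightarrow> big N X (c ;; c') s (t + t') s''"
| If0: "fits N X s e \<Longrightarrow> eval N s e = 0 \<Longrightarrow> big N X c s t s' \<Longrightarrow> big N X (If0 e c c') s (Suc t) s'"
| If1: "fits N X s e \<Longrightarrow> eval N s e \<noteq> 0 \<Longrightarrow> big N X c' s t s' \<Longrightarrow> big N X (If0 e c c') s (Suc t) s'"
| Stop: "fits N X s e \<Longrightarrow> eval N s e \<noteq> 0 \<Longrightarrow> big N X (Until e c) s 1 s"
| Loop: "fits N X s e \<Longrightarrow> eval N s e = 0 \<Longrightarrow> big N X c s t s' \<Longrightarrow> big N X (Until e c) s' t' s'' \<Longrightarrow>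
    big N X (Until e c) s (Suc (t + t')) s''"

definition bounded_store :: "nat \<Rightarrow> store \<Rightarrow> bool" where
  "bounded_store X s \<longleftrightarrow> (\<forall>k x. s k x \<le> X)"

lemma eval_le: "fits N X s e \<Longrightarrow> bounded_store X s \<Longrightarrow> eval N s e \<le> X"
  by (cases e) (auto simp: bounded_store_def)

lemma big_bounded: "big N X c s t s' \<Longrightarrow> bounded_store X s \<Longrightarrow> bounded_store X s'"
proof (induction rule: big.induct)
  case (Put s e e' k)
  then show ?case using eval_le[of N X s e'] by (auto simp: bounded_store_def)
qed auto


text \<open>
  Cells of one name lie at stride \<open>stride\<close> so that every array is unbounded; the last
  residue class is left for the scratch register at address \<open>stride - 1\<close>.
\<close>

locale layout =
  fixes H D :: nat
begin

definition code :: "nm \<Rightarrow> nat" where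
  "code k = fst k * D + snd k"

definition stride :: nat where
  "stride = Suc (H * D)"

definition valid :: "nm \<Rightarrow> bool" where
  "valid k \<longleftrightarrow> fst k < H \<and> snd k < D"

primrec exp_wf :: "exp \<Rightarrow> bool" where
  "exp_wf (Const j) \<longleftrightarrow> True"
| "exp_wf Size \<longleftrightarrow> True"
| "exp_wf (Idx k e) \<longleftrightarrow> valid k \<and> exp_wf e"
| "exp_wf (AddC e j) \<longleftrightarrow> exp_wf e"
| "exp_wf (AddV e k) \<longleftrightarrow> valid k \<and> exp_wf e"

primrec com_wf :: "com \<Rightarrow> bool" where
  "com_wf Skip \<longleftrightarrow> True"
| "com_wf (Put k e e') \<longleftrightarrow> valid k \<and> exp_wf e \<and> exp_wf e'"
| "com_wf (c ;; c') \<longleftrightarrow> com_wf c \<and> com_wf c'"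
| "com_wf (If0 e c c') \<longleftrightarrow> exp_wf e \<and> com_wf c \<and> com_wf c'"
| "com_wf (Until e c) \<longleftrightarrow> exp_wf e \<and> com_wf c"

text \<open>Turns an index \<open>x\<close> in the accumulator into the address
  \<open>x * stride + code k\<close>: with \<open>x\<close> in the buffer, \<open>H * D\<close>
  additions produce \<open>x * Suc (H * D)\<close>.\<close>

definition addressing :: "nm \<Rightarrow> program" where
  "addressing k = Buffer # replicate (H * D) Add @ [Buffer, Cst (code k), Add]"

primrec comp_exp :: "exp \<Rightarrow> program" where
  "comp_exp (Const j) = [Cst j]"
| "comp_exp Size = [GetN]"
| "comp_exp (Idx k e) = comp_exp e @ addressing k @ [Load]"
| "comp_exp (AddC e j) = comp_exp e @ [Buffer, Cst j, Add]"
| "comp_exp (AddV e k) = comp_exp e @ [Buffer, Cst (code k), Load, Add]"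

text \<open>Kept apart from \<open>comp\<close> because jump targets need the lengths of the pieces
  before these are placed.\<close>

primrec comp_len :: "com \<Rightarrow> nat" where
  "comp_len Skip = 0"
| "comp_len (Put k e e') =
     length (comp_exp e) + length (addressing k) + 3 + length (comp_exp e') + 4"
| "comp_len (c ;; c') = comp_len c + comp_len c'"
| "comp_len (If0 e c c') = length (comp_exp e) + 1 + comp_len c + 1 + comp_len c'"
| "comp_len (Until e c) = length (comp_exp e) + 1 + comp_len c + 1"

text \<open>In a \<open>Put\<close> the target address waits in the scratch register
  \<open>H * D\<close>, since computing the value takes both accumulator and buffer.\<close>

primrec comp :: "com \<Rightarrow> nat \<Rightarrow> program" where
  "comp Skip p = []"
| "comp (Put k e e') p =
     comp_exp e @ addressing k @ [Buffer, Cst (H * D), Store] @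
     comp_exp e' @ [Buffer, Cst (H * D), Load, Store]"
| "comp (c ;; c') p = comp c p @ comp c' (p + comp_len c)"
| "comp (If0 e c c') p =
     (let p0 = p + length (comp_exp e) + 1; p1 = p0 + comp_len c + 1; p2 = p1 + comp_len c'
      in comp_exp e @ Jzero p0 p1 # comp c p0 @ Jzero p2 p2 # comp c' p1)"
| "comp (Until e c) p =
     (let p0 = p + length (comp_exp e) + 1; p1 = p0 + comp_len c + 1
      in comp_exp e @ Jzero p0 p1 # comp c p0 @ [Jzero p p])"

lemma length_comp [simp]: "length (comp c p) = comp_len c"
  by (induction c arbitrary: p) (auto simp: Let_def)

end

section \<open>Runs of code placed inside a larger program\<close>

definition code_at :: "program \<Rightarrow> nat \<Rightarrow> program \<Rightarrow> bool" where
  "code_at P p is \<longleftrightarrow> (\<exists>xs ys. P = xs @ is @ ys \<and> length xs = p)"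

lemma code_at_append: "code_at P p (is @ js) \<longleftrightarrow> code_at P p is \<and> code_at P (p + length is) js"
proof
  assume "code_at P p is \<and> code_at P (p + length is) js"
  then obtain xs ys where "P = xs @ is @ ys" "length xs = p"
    by (auto simp: code_at_def)
  moreover obtain xs' ys' where "P = xs' @ js @ ys'" "length xs' = p + length is"
    using \<open>code_at P p is \<and> code_at P (p + length is) js\<close> by (auto simp: code_at_def)
  ultimately have P: "P = xs @ is @ ys" "length xs = p" "P = xs' @ js @ ys'"
    "length xs' = p + length is" by auto
  then have "xs' = xs @ is"
    using P by (metis append.assoc append_eq_append_conv length_append)
  then have "P = xs @ (is @ js) @ ys'" "length xs = p"
    using P by simp_all
  then show "code_at P p (is @ js)" by (auto simp: code_at_def)
next
  assume "code_at P p (is @ js)"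
  then obtain xs ys where "P = xs @ is @ js @ ys" "length xs = p"
    by (auto simp: code_at_def)
  then show "code_at P p is \<and> code_at P (p + length is) js"
    unfolding code_at_def
    by (intro conjI exI[of _ xs] exI[of _ "js @ ys"] exI[of _ "xs @ is"] exI[of _ ys]) auto
qed

lemma code_at_Cons: "code_at P p (i # is) \<longleftrightarrow> p < length P \<and> P ! p = i \<and> code_at P (Suc p) is"
proof -
  have "code_at P p [i] \<longleftrightarrow> p < length P \<and> P ! p = i"
  proof
    assume "p < length P \<and> P ! p = i"
    then have "P = take p P @ [i] @ drop (Suc p) P" "length (take p P) = p"
      using id_take_nth_drop[of p P] by auto
    then show "code_at P p [i]" unfolding code_at_def by blast
  qed (auto simp: code_at_def)
  then show ?thesis using code_at_append[of P p "[i]" "is"] by simp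
qed

lemma code_at_Nil: "code_at P p is \<Longrightarrow> code_at P p []"
  using code_at_append[of P p "[]" "is"] by simp

text \<open>Unlike \<open>ram_computes\<close> it does not ask for a halted state, so runs can be
  joined by \<open>reach_trans\<close>.\<close>

definition reach :: "program \<Rightarrow> nat \<Rightarrow> nat \<Rightarrow> nat \<Rightarrow> ram_state \<Rightarrow> ram_state \<Rightarrow> bool" where
  "reach P N L t s s' \<longleftrightarrow> (ram_step P N ^^ t) s = s' \<and>
     (\<forall>u\<le>t. contents_bounded L ((ram_step P N ^^ u) s))"

lemma reach_refl: "contents_bounded L s \<Longrightarrow> reach P N L 0 s s"
  by (simp add: reach_def)

lemma reach_bounded: "reach P N L t s s' \<Longrightarrow> contents_bounded L s'"
  by (auto simp: reach_def)

lemma reach_trans: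
  assumes "reach P N L t s s'" "reach P N L t' s' s''"
  shows "reach P N L (t + t') s s''"
proof -
  have e: "(ram_step P N ^^ (t + u)) s = (ram_step P N ^^ u) s'" for u
    using assms(1) by (simp add: add.commute[of t] funpow_add reach_def)
  have "contents_bounded L ((ram_step P N ^^ u) s)" if "u \<le> t + t'" for u
  proof (cases "u \<le> t")
    case True
    then show ?thesis using assms(1) by (simp add: reach_def)
  next
    case False
    then obtain v where "u = t + v" by (metis le_add_diff_inverse nat_le_linear)
    then show ?thesis using that assms(2) e[of v] by (simp add: reach_def)
  qed
  then show ?thesis using assms(2) e[of t'] by (simp add: reach_def)
qed

lemma reach_step:
  assumes "contents_bounded L s" "pc s < length P" "P ! pc s = i"
    and "contents_bounded L (exec N i s)" and "reach P N L t (exec N i s) s'"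
  shows "reach P N L (Suc t) s s'"
proof -
  have "reach P N L 1 s (exec N i s)"
    using assms by (auto simp: reach_def ram_step_def halted_def le_Suc_eq)
  from reach_trans[OF this assms(5)] show ?thesis by simp
qed

text \<open>For a concrete list of instructions this unfolds to conditions on the contents alone;
  jumps are excluded by the condition on the program counter.\<close>

primrec straight :: "nat \<Rightarrow> nat \<Rightarrow> program \<Rightarrow> ram_state \<Rightarrow> bool" where
  "straight N L [] s \<longleftrightarrow> contents_bounded L s"
| "straight N L (i # is) s \<longleftrightarrow> contents_bounded L s \<and> pc (exec N i s) = Suc (pc s) \<and>
     straight N L is (exec N i s)"

lemma straight_bounded: "straight N L is s \<Longrightarrow> contents_bounded L s"
  by (cases "is") auto

lemma straight_reach:
  "code_at P (pc s) is \<Longrightarrow> straight N L is s \<Longrightarrow> reach P N L (length is) s (fold (exec N) is s)"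
proof (induction "is" arbitrary: s)
  case (Cons i "is")
  then show ?case
    using straight_bounded[of N L "is" "exec N i s"]
    by (auto simp: code_at_Cons intro!: reach_step[where i = i])
qed (simp add: reach_refl)

section \<open>Correctness of the compiler\<close>

context layout
begin

definition represents :: "store \<Rightarrow> (nat \<Rightarrow> nat) \<Rightarrow> bool" where
  "represents \<sigma> \<rho> \<longleftrightarrow> (\<forall>k x. valid k \<longrightarrow> \<rho> (x * stride + code k) = \<sigma> k x)"

lemma code_less: "valid k \<Longrightarrow> code k < H * D"
proof -
  assume "valid k"
  then have "fst k < H" "snd k < D" by (auto simp: valid_def)
  then have "fst k * D + snd k < Suc (fst k) * D" by simp
  also have "\<dots> \<le> H * D" using \<open>fst k < H\<close> by (meson Suc_leI mult_le_mono1)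
  finally show ?thesis by (simp add: code_def)
qed

lemma code_inj: "valid k \<Longrightarrow> valid k' \<Longrightarrow> code k = code k' \<Longrightarrow> k = k'"
proof (cases k; cases k')
  fix h i h' i'
  assume "valid k" "valid k'" "code k = code k'" and [simp]: "k = (h, i)" "k' = (h', i')"
  then have e: "h * D + i = h' * D + i'" and i: "i < D" "i' < D"
    by (auto simp: code_def valid_def)
  have "h = (h * D + i) div D" using i by simp
  also have "\<dots> = h'" using e i by simp
  finally show "k = k'" using e by simp
qed

text \<open>Codes are below \<open>stride\<close>, so division with remainder recovers index and
  name.\<close>

lemma address_inj:
  assumes "valid k" "valid k'" "x * stride + code k = y * stride + code k'"
  shows "k = k' \<and> x = y"
proof -
  have *: "code k < stride" "code k' < stride"
    using code_less assms by (auto simp: stride_def less_Suc_eq)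
  have "x = (x * stride + code k) div stride" using * by simp
  also have "\<dots> = y" using assms(3) * by simp
  finally show ?thesis using assms code_inj by simp
qed

lemma address_neq_scratch: "valid k \<Longrightarrow> x * stride + code k \<noteq> H * D"
  using code_less[of k] by (cases x) (auto simp: stride_def)

lemma represents_upd:
  assumes "represents \<sigma> \<rho>" "valid k"
  shows "represents (upd \<sigma> k x v) (\<rho>(x * stride + code k := v))"
  unfolding represents_def
proof (intro allI impI)
  fix k' y
  assume "valid k'"
  then show "(\<rho>(x * stride + code k := v)) (y * stride + code k') = upd \<sigma> k x v k' y"
    using address_inj[OF assms(2), of k' x y] assms(1)
    by (auto simp: represents_def simp del: split_paired_All)
qed

lemma represents_scratch: "represents \<sigma> \<rho> \<Longrightarrow> represents \<sigma> (\<rho>(H * D := v))"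
  by (simp add: represents_def address_neq_scratch)


lemma reach_Adds:
  assumes "code_at P (pc s) (replicate n Add)" "contents_bounded L s" "acc s + n * buf s \<le> L"
  shows "reach P N L n s (s\<lparr>pc := pc s + n, acc := acc s + n * buf s\<rparr>)"
  using assms
proof (induction n arbitrary: s)
  case 0
  then show ?case by (simp add: reach_refl)
next
  case (Suc n)
  let ?s = "exec N Add s"
  have "reach P N L n ?s (?s\<lparr>pc := pc ?s + n, acc := acc ?s + n * buf ?s\<rparr>)"
    using Suc.prems by (intro Suc.IH) (auto simp: code_at_Cons contents_bounded_def)
  then have "reach P N L (Suc n) s (?s\<lparr>pc := pc ?s + n, acc := acc ?s + n * buf ?s\<rparr>)"
    using Suc.prems by (intro reach_step) (auto simp: code_at_Cons contents_bounded_def)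
  then show ?case by (simp add: algebra_simps)
qed

lemma reach_addressing:
  assumes "code_at P (pc s) (addressing k)" "contents_bounded L s" "valid k"
    and "acc s \<le> X" "(X + 1) * stride \<le> L"
  shows "\<exists>s'. reach P N L (length (addressing k)) s s' \<and>
    pc s' = pc s + length (addressing k) \<and> acc s' = acc s * stride + code k \<and>
    reg s' = reg s \<and> outputs s' = outputs s"
proof -
  define s1 where "s1 = exec N Buffer s"
  define s2 where "s2 = s1\<lparr>pc := pc s1 + H * D, acc := acc s1 + H * D * buf s1\<rparr>"
  let ?is = "[Buffer, Cst (code k), Add]"
  note defs = s1_def s2_def
  have "acc s * stride + code k \<le> X * stride + stride"
    using assms(4) code_less[OF assms(3)]
    by (intro add_mono mult_le_mono) (auto simp: stride_def)
  also have "\<dots> \<le> L" using assms(5) by simp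
  finally have b: "acc s * stride + code k \<le> L" .
  then have b': "acc s + H * D * acc s \<le> L" by (simp add: stride_def algebra_simps)
  note fields = code_at_append code_at_Cons addressing_def contents_bounded_def stride_def
  have "reach P N L (length ?is) s2 (fold (exec N) ?is s2)"
  proof (rule straight_reach)
    show "code_at P (pc s2) ?is"
      using assms(1) by (simp add: addressing_def code_at_append code_at_Cons defs)
    show "straight N L ?is s2"
      using assms(2) b b' by (auto simp: contents_bounded_def defs stride_def algebra_simps)
  qed
  moreover have "reach P N L (H * D) s1 s2"
    unfolding s2_def using assms(1,2)
    by (intro reach_Adds) (auto simp: fields defs b')
  ultimately have "reach P N L (H * D + length ?is) s1 (fold (exec N) ?is s2)" using reach_trans by blast
  then have "reach P N L (Suc (H * D + length ?is)) s (fold (exec N) ?is s2)"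
    using assms(1,2) b by (intro reach_step[where i = Buffer]) (auto simp: fields defs)
  moreover have "Suc (H * D + length ?is) = length (addressing k)" by (simp add: addressing_def)
  ultimately show ?thesis
    by (intro exI[of _ "fold (exec N) ?is s2"])
       (auto simp: defs addressing_def stride_def algebra_simps)
qed

lemma reach_exp:
  assumes "fits N X \<sigma> e" "exp_wf e" "code_at P (pc s) (comp_exp e)"
    and "contents_bounded L s" "represents \<sigma> (reg s)"
    and "bounded_store X \<sigma>" "(X + 1) * stride \<le> L"
  shows "\<exists>s'. reach P N L (length (comp_exp e)) s s' \<and>
    pc s' = pc s + length (comp_exp e) \<and> acc s' = eval N \<sigma> e \<and>
    reg s' = reg s \<and> outputs s' = outputs s"
  using assms(1-3)
proof (induction e)
  have XL: "X \<le> L"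
    using assms(7) by (auto simp: stride_def)
  {
    case (Const j)
    then show ?case
      using straight_reach[of P s "[Cst j]" N L] assms(4) XL
      by (intro exI[of _ "exec N (Cst j) s"]) (auto simp: contents_bounded_def)
  next
    case Size
    then show ?case
      using straight_reach[of P s "[GetN]" N L] assms(4) XL
      by (intro exI[of _ "exec N GetN s"]) (auto simp: contents_bounded_def)
  next
    case (Idx k e)
    then obtain s1 where 1: "reach P N L (length (comp_exp e)) s s1"
      "pc s1 = pc s + length (comp_exp e)" "acc s1 = eval N \<sigma> e" "reg s1 = reg s"
      "outputs s1 = outputs s"
      by (auto simp: code_at_append)
    have "\<exists>s'. reach P N L (length (addressing k)) s1 s' \<and>
        pc s' = pc s1 + length (addressing k) \<and> acc s' = acc s1 * stride + code k \<and>
        reg s' = reg s1 \<and> outputs s' = outputs s1"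
      using Idx.prems 1 eval_le[OF _ assms(6), of N e] assms(7)
      by (intro reach_addressing) (auto simp: code_at_append reach_bounded)
    then obtain s2 where 2: "reach P N L (length (addressing k)) s1 s2"
      "pc s2 = pc s1 + length (addressing k)" "acc s2 = acc s1 * stride + code k"
      "reg s2 = reg s1" "outputs s2 = outputs s1"
      by blast
    let ?s3 = "exec N Load s2"
    have "reach P N L 1 s2 ?s3"
      using straight_reach[of P s2 "[Load]" N L] Idx.prems 1 2 reach_bounded[OF 2(1)]
      by (auto simp: code_at_append contents_bounded_def add.assoc)
    with 1(1) 2(1) have "reach P N L (length (comp_exp e) + (length (addressing k) + 1)) s ?s3"
      using reach_trans by blast
    then show ?case
      using 1 2 Idx.prems assms(5) by (intro exI[of _ ?s3])
        (auto simp: represents_def simp del: split_paired_All)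
  next
    case (AddC e j)
    then obtain s1 where 1: "reach P N L (length (comp_exp e)) s s1"
      "pc s1 = pc s + length (comp_exp e)" "acc s1 = eval N \<sigma> e" "reg s1 = reg s"
      "outputs s1 = outputs s"
      by (auto simp: code_at_append)
    let ?is = "[Buffer, Cst j, Add]"
    have "reach P N L (length ?is) s1 (fold (exec N) ?is s1)"
      using straight_reach[of P s1 ?is N L] AddC.prems 1 reach_bounded[OF 1(1)] XL
      by (auto simp: code_at_append contents_bounded_def add.commute)
    with 1(1) have "reach P N L (length (comp_exp e) + length ?is) s (fold (exec N) ?is s1)"
      using reach_trans by blast
    then show ?case
      using 1 by (intro exI[of _ "fold (exec N) ?is s1"]) auto
  next
    case (AddV e k)
    then obtain s1 where 1: "reach P N L (length (comp_exp e)) s s1"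
      "pc s1 = pc s + length (comp_exp e)" "acc s1 = eval N \<sigma> e" "reg s1 = reg s"
      "outputs s1 = outputs s"
      by (auto simp: code_at_append)
    let ?is = "[Buffer, Cst (code k), Load, Add]"
    have k: "reg s (code k) = \<sigma> k 0"
      using assms(5) AddV.prems unfolding represents_def
      by (metis add_0 exp_wf.simps(5) mult_0)
    have "code k \<le> L"
      using code_less[of k] AddV.prems assms(7) by (auto simp: stride_def)
    then have "reach P N L (length ?is) s1 (fold (exec N) ?is s1)"
      using straight_reach[of P s1 ?is N L] AddV.prems 1 reach_bounded[OF 1(1)] XL k
      by (auto simp: code_at_append contents_bounded_def add.commute)
    with 1(1) have "reach P N L (length (comp_exp e) + length ?is) s (fold (exec N) ?is s1)"
      using reach_trans by blast
    then show ?case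
      using 1 k by (intro exI[of _ "fold (exec N) ?is s1"]) auto
  }
qed

text \<open>\<open>W\<close> bounds the code length of all subprograms, so an assignment, or a test
  together with its jumps, takes at most \<open>W\<close> instructions; one factor thus converts
  \<open>big\<close> time into machine time.\<close>

lemma reach_com:
  assumes "big N X c \<sigma> t \<sigma>'" "com_wf c" "code_at P (pc s) (comp c (pc s))"
    and "contents_bounded L s" "represents \<sigma> (reg s)"
    and "bounded_store X \<sigma>" "(X + 1) * stride \<le> L" "comp_len c \<le> W"
  shows "\<exists>t'\<le>W * t. \<exists>s'. reach P N L t' s s' \<and> pc s' = pc s + comp_len c \<and>
    represents \<sigma>' (reg s') \<and> outputs s' = outputs s"
  using assms(1-6,8)
proof (induction arbitrary: s rule: big.induct)
  case (Skip \<sigma>)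
  then show ?case by (auto intro: reach_refl)
next
  case (Put \<sigma> e e' k)
  have XL: "X \<le> L" and HL: "H * D \<le> L"
    using assms(7) by (auto simp: stride_def)
  have wf: "valid k" "exp_wf e" "exp_wf e'" using Put.prems by auto
  note at = Put.prems(2)[simplified, unfolded code_at_append]
  obtain s1 where 1: "reach P N L (length (comp_exp e)) s s1"
    "pc s1 = pc s + length (comp_exp e)" "acc s1 = eval N \<sigma> e" "reg s1 = reg s"
    "outputs s1 = outputs s"
    using reach_exp[OF Put.hyps(1) wf(2) _ Put.prems(3-5) assms(7)] at by blast
  have "\<exists>s'. reach P N L (length (addressing k)) s1 s' \<and>
      pc s' = pc s1 + length (addressing k) \<and> acc s' = acc s1 * stride + code k \<and>
      reg s' = reg s1 \<and> outputs s' = outputs s1"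
    using at 1 wf eval_le[OF Put.hyps(1) Put.prems(5)] assms(7)
    by (intro reach_addressing) (auto simp: reach_bounded)
  then obtain s2 where 2: "reach P N L (length (addressing k)) s1 s2"
    "pc s2 = pc s1 + length (addressing k)" "acc s2 = acc s1 * stride + code k"
    "reg s2 = reg s1" "outputs s2 = outputs s1"
    by blast
  let ?a = "eval N \<sigma> e * stride + code k"
  have aL: "?a \<le> L" using reach_bounded[OF 2(1)] 1 2 by (auto simp: contents_bounded_def)
  let ?is = "[Buffer, Cst (H * D), Store]"
  define s3 where "s3 = fold (exec N) ?is s2"
  have 3: "reach P N L (length ?is) s2 s3" unfolding s3_def
  proof (rule straight_reach)
    show "code_at P (pc s2) ?is"
      using at 1 2 by (auto simp: code_at_Cons add.assoc intro: code_at_Nil)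
    show "straight N L ?is s2"
      using 1 2 reach_bounded[OF 2(1)] HL by (auto simp: contents_bounded_def)
  qed
  have s3: "pc s3 = pc s2 + 3" "reg s3 = (reg s)(H * D := ?a)" "outputs s3 = outputs s"
    using 1 2 by (auto simp: s3_def)
  have "\<exists>s'. reach P N L (length (comp_exp e')) s3 s' \<and>
      pc s' = pc s3 + length (comp_exp e') \<and> acc s' = eval N \<sigma> e' \<and>
      reg s' = reg s3 \<and> outputs s' = outputs s3"
    using at 1 2 s3 wf Put reach_bounded[OF 3] assms(7) represents_scratch
    by (intro reach_exp) (auto simp: code_at_Cons code_at_append add.assoc numeral_3_eq_3)
  then obtain s4 where 4: "reach P N L (length (comp_exp e')) s3 s4"
    "pc s4 = pc s3 + length (comp_exp e')" "acc s4 = eval N \<sigma> e'"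
    "reg s4 = reg s3" "outputs s4 = outputs s3"
    by blast
  let ?js = "[Buffer, Cst (H * D), Load, Store]"
  define s5 where "s5 = fold (exec N) ?js s4"
  have 5: "reach P N L (length ?js) s4 s5" unfolding s5_def
  proof (rule straight_reach)
    show "code_at P (pc s4) ?js"
      using at 1 2 s3 4
      by (auto simp: code_at_Cons code_at_append add.assoc numeral_3_eq_3 intro: code_at_Nil)
    show "straight N L ?js s4"
      using 1 2 s3 4 reach_bounded[OF 4(1)] HL aL by (auto simp: contents_bounded_def)
  qed
  have s5: "pc s5 = pc s4 + 4" "outputs s5 = outputs s"
    "reg s5 = (reg s3)(?a := eval N \<sigma> e')"
    using 1 2 s3 4 by (auto simp: s5_def)
  have "reach P N L (length (comp_exp e) + (length (addressing k) + (length ?is +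
      (length (comp_exp e') + length ?js)))) s s5"
    by (rule reach_trans[OF 1(1) reach_trans[OF 2(1) reach_trans[OF 3 reach_trans[OF 4(1) 5]]]])
  moreover have "represents (upd \<sigma> k (eval N \<sigma> e) (eval N \<sigma> e')) (reg s5)"
    unfolding s5 s3 using Put.prems wf by (intro represents_upd represents_scratch)
  moreover have "length (comp_exp e) + (length (addressing k) + (length ?is +
      (length (comp_exp e') + length ?js))) \<le> W * 1"
    using Put.prems(6) by simp
  moreover have "pc s5 = pc s + comp_len (Put k e e')"
    using 1 2 s3 4 s5 by simp
  ultimately show ?case using s5(2) by blast
next
  case (Seq c \<sigma> t \<sigma>1 c' t' \<sigma>2)
  obtain t1 s1 where 1: "t1 \<le> W * t" "reach P N L t1 s s1" "pc s1 = pc s + comp_len c"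
    "represents \<sigma>1 (reg s1)" "outputs s1 = outputs s"
    using Seq.IH(1)[of s] Seq.prems by (auto simp: code_at_append)
  obtain t2 s2 where 2: "t2 \<le> W * t'" "reach P N L t2 s1 s2" "pc s2 = pc s1 + comp_len c'"
    "represents \<sigma>2 (reg s2)" "outputs s2 = outputs s1"
    using Seq.IH(2)[of s1] Seq.prems 1 big_bounded[OF Seq.hyps(1)] reach_bounded[OF 1(2)]
    by (auto simp: code_at_append)
  have "reach P N L (t1 + t2) s s2" using 1 2 reach_trans by blast
  then show ?case
    using 1 2 by (intro exI[of _ "t1 + t2"] exI[of _ s2] conjI) (auto simp: algebra_simps)
next
  case (If0 \<sigma> e c t \<sigma>' c')
  note at = If0.prems(2)[simplified, unfolded code_at_append Let_def code_at_Cons, simplified]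
  obtain s1 where 1: "reach P N L (length (comp_exp e)) s s1"
    "pc s1 = pc s + length (comp_exp e)" "acc s1 = eval N \<sigma> e" "reg s1 = reg s"
    "outputs s1 = outputs s"
    using reach_exp[OF If0.hyps(1) _ _ If0.prems(3-5) assms(7)] If0.prems(1) at by auto
  have b1: "contents_bounded L s1" using reach_bounded[OF 1(1)] .
  let ?s2 = "exec N (P ! pc s1) s1"
  have 2: "reach P N L (Suc 0) s1 ?s2" "pc ?s2 = pc s + length (comp_exp e) + 1"
    "contents_bounded L ?s2" "reg ?s2 = reg s" "outputs ?s2 = outputs s"
    using at 1 b1 If0.hyps(2)
    by (auto intro!: reach_step[OF b1] reach_refl simp: contents_bounded_def)
  obtain t3 s3 where 3: "t3 \<le> W * t" "reach P N L t3 ?s2 s3" "pc s3 = pc ?s2 + comp_len c"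
    "represents \<sigma>' (reg s3)" "outputs s3 = outputs ?s2"
    using If0.IH[of ?s2] If0.prems 2 at by auto
  have b3: "contents_bounded L s3" using reach_bounded[OF 3(2)] .
  let ?s4 = "exec N (P ! pc s3) s3"
  have 4: "reach P N L (Suc 0) s3 ?s4" "pc ?s4 = pc s + comp_len (If0 e c c')"
    "reg ?s4 = reg s3" "outputs ?s4 = outputs s"
    using at 2 3 b3
    by (auto intro!: reach_step[OF b3] reach_refl simp: contents_bounded_def)
  have "reach P N L (length (comp_exp e) + (Suc 0 + (t3 + Suc 0))) s ?s4"
    by (rule reach_trans[OF 1(1) reach_trans[OF 2(1) reach_trans[OF 3(2) 4(1)]]])
  then show ?case
    using 3 4 If0.prems(6)
    by (intro exI[of _ "length (comp_exp e) + (Suc 0 + (t3 + Suc 0))"] exI[of _ ?s4] conjI) auto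
next
  case (If1 \<sigma> e c' t \<sigma>' c)
  note at = If1.prems(2)[simplified, unfolded code_at_append Let_def code_at_Cons, simplified]
  obtain s1 where 1: "reach P N L (length (comp_exp e)) s s1"
    "pc s1 = pc s + length (comp_exp e)" "acc s1 = eval N \<sigma> e" "reg s1 = reg s"
    "outputs s1 = outputs s"
    using reach_exp[OF If1.hyps(1) _ _ If1.prems(3-5) assms(7)] If1.prems(1) at by auto
  have b1: "contents_bounded L s1" using reach_bounded[OF 1(1)] .
  let ?s2 = "exec N (P ! pc s1) s1"
  have 2: "reach P N L (Suc 0) s1 ?s2" "pc ?s2 = pc s + length (comp_exp e) + 1 + comp_len c + 1"
    "contents_bounded L ?s2" "reg ?s2 = reg s" "outputs ?s2 = outputs s"
    using at 1 b1 If1.hyps(2)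
    by (auto intro!: reach_step[OF b1] reach_refl simp: contents_bounded_def)
  obtain t3 s3 where 3: "t3 \<le> W * t" "reach P N L t3 ?s2 s3" "pc s3 = pc ?s2 + comp_len c'"
    "represents \<sigma>' (reg s3)" "outputs s3 = outputs ?s2"
    using If1.IH[of ?s2] If1.prems 2 at by (auto simp: add.assoc)
  have "reach P N L (length (comp_exp e) + (Suc 0 + t3)) s s3"
    by (rule reach_trans[OF 1(1) reach_trans[OF 2(1) 3(2)]])
  then show ?case
    using 2 3 If1.prems(6)
    by (intro exI[of _ "length (comp_exp e) + (Suc 0 + t3)"] exI[of _ s3] conjI) auto
next
  case (Stop \<sigma> e c)
  note at = Stop.prems(2)[simplified, unfolded code_at_append Let_def code_at_Cons, simplified]
  obtain s1 where 1: "reach P N L (length (comp_exp e)) s s1"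
    "pc s1 = pc s + length (comp_exp e)" "acc s1 = eval N \<sigma> e" "reg s1 = reg s"
    "outputs s1 = outputs s"
    using reach_exp[OF Stop.hyps(1) _ _ Stop.prems(3-5) assms(7)] Stop.prems(1) at by auto
  have b1: "contents_bounded L s1" using reach_bounded[OF 1(1)] .
  let ?s2 = "exec N (P ! pc s1) s1"
  have 2: "reach P N L (Suc 0) s1 ?s2" "pc ?s2 = pc s + comp_len (Until e c)"
    "reg ?s2 = reg s" "outputs ?s2 = outputs s"
    using at 1 b1 Stop.hyps(2)
    by (auto intro!: reach_step[OF b1] reach_refl simp: contents_bounded_def)
  have "reach P N L (length (comp_exp e) + Suc 0) s ?s2"
    using 1 2 reach_trans by blast
  then show ?case
    using 2 Stop.prems
    by (intro exI[of _ "length (comp_exp e) + Suc 0"] exI[of _ ?s2] conjI) auto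
next
  case (Loop \<sigma> e c t \<sigma>1 t' \<sigma>2)
  note at = Loop.prems(2)[simplified, unfolded code_at_append Let_def code_at_Cons, simplified]
  obtain s1 where 1: "reach P N L (length (comp_exp e)) s s1"
    "pc s1 = pc s + length (comp_exp e)" "acc s1 = eval N \<sigma> e" "reg s1 = reg s"
    "outputs s1 = outputs s"
    using reach_exp[OF Loop.hyps(1) _ _ Loop.prems(3-5) assms(7)] Loop.prems(1) at by auto
  have b1: "contents_bounded L s1" using reach_bounded[OF 1(1)] .
  let ?s2 = "exec N (P ! pc s1) s1"
  have 2: "reach P N L (Suc 0) s1 ?s2" "pc ?s2 = pc s + length (comp_exp e) + 1"
    "contents_bounded L ?s2" "reg ?s2 = reg s" "outputs ?s2 = outputs s"
    using at 1 b1 Loop.hyps(2)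
    by (auto intro!: reach_step[OF b1] reach_refl simp: contents_bounded_def)
  obtain t3 s3 where 3: "t3 \<le> W * t" "reach P N L t3 ?s2 s3" "pc s3 = pc ?s2 + comp_len c"
    "represents \<sigma>1 (reg s3)" "outputs s3 = outputs ?s2"
    using Loop.IH(1)[of ?s2] Loop.prems 2 at by auto
  have b3: "contents_bounded L s3" using reach_bounded[OF 3(2)] .
  let ?s4 = "exec N (P ! pc s3) s3"
  have 4: "reach P N L (Suc 0) s3 ?s4" "pc ?s4 = pc s" "contents_bounded L ?s4"
    "reg ?s4 = reg s3" "outputs ?s4 = outputs s"
    using at 2 3 b3
    by (auto intro!: reach_step[OF b3] reach_refl simp: contents_bounded_def)
  obtain t5 s5 where 5: "t5 \<le> W * t'" "reach P N L t5 ?s4 s5"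
    "pc s5 = pc ?s4 + comp_len (Until e c)"
    "represents \<sigma>2 (reg s5)" "outputs s5 = outputs ?s4"
    using Loop.IH(2)[of ?s4] Loop.prems 3 4 big_bounded[OF Loop.hyps(3)] by auto
  have "reach P N L (length (comp_exp e) + (Suc 0 + (t3 + (Suc 0 + t5)))) s s5"
    by (rule reach_trans[OF 1(1) reach_trans[OF 2(1) reach_trans[OF 3(2) reach_trans[OF 4(1) 5(2)]]]])
  then show ?case
    using 3 4 5 Loop.prems(6)
    by (intro exI[of _ "length (comp_exp e) + (Suc 0 + (t3 + (Suc 0 + t5)))"] exI[of _ s5] conjI)
       (auto simp: algebra_simps)
qed

end

section \<open>Program logic\<close>

primrec seqs :: "com list \<Rightarrow> com" where
  "seqs [] = Skip"
| "seqs (c # cs) = c ;; seqs cs"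

primrec mods :: "com \<Rightarrow> nat set" where
  "mods Skip = {}"
| "mods (Put k e e') = {fst k}"
| "mods (c ;; c') = mods c \<union> mods c'"
| "mods (If0 e c c') = mods c \<union> mods c'"
| "mods (Until e c) = mods c"

lemma mods_seqs [simp]: "mods (seqs cs) = \<Union> (mods ` set cs)"
  by (induction cs) auto

definition same :: "nat set \<Rightarrow> store \<Rightarrow> store \<Rightarrow> bool" where
  "same M s s' \<longleftrightarrow> (\<forall>h i. h \<notin> M \<longrightarrow> s' (h, i) = s (h, i))"

lemma sameD: "same M s s' \<Longrightarrow> h \<notin> M \<Longrightarrow> s' (h, i) = s (h, i)"
  by (simp add: same_def)

lemma same_refl [simp]: "same M s s"
  by (simp add: same_def)

lemma same_trans: "same M s s' \<Longrightarrow> same M s' s'' \<Longrightarrow> same M s s''"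
  by (simp add: same_def)

lemma same_mono: "same M s s' \<Longrightarrow> M \<subseteq> M' \<Longrightarrow> same M' s s'"
  by (auto simp: same_def)

lemma same_upd [simp]: "fst k \<in> M \<Longrightarrow> same M s (upd s k x v)"
  by (auto simp: same_def upd_def)

lemma big_same: "big N X c s t s' \<Longrightarrow> mods c \<subseteq> M \<Longrightarrow> same M s s'"
  by (induction rule: big.induct) (auto intro: same_trans)

definition run :: "nat \<Rightarrow> nat \<Rightarrow> com \<Rightarrow> nat \<Rightarrow> store \<Rightarrow> (store \<Rightarrow> bool) \<Rightarrow> bool" where
  "run N X c T s Q \<longleftrightarrow> (\<exists>t\<le>T. \<exists>s'. big N X c s t s' \<and> Q s')"

lemma run_mono: "run N X c T s Q \<Longrightarrow> T \<le> T' \<Longrightarrow> (\<And>s'. Q s' \<Longrightarrow> Q' s') \<Longrightarrow> run N X c T' s Q'"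
  unfolding run_def using le_trans by blast

lemma run_same:
  assumes "run N X c T s Q" "mods c \<subseteq> M"
  shows "run N X c T s (\<lambda>s'. Q s' \<and> same M s s')"
  using assms big_same unfolding run_def by blast

lemma run_Seq:
  assumes "run N X c T s (\<lambda>s'. run N X c' T' s' Q)"
  shows "run N X (c ;; c') (T + T') s Q"
  using assms unfolding run_def by (meson add_mono big.Seq)

lemma run_SeqI:
  assumes "run N X c T s P" "\<And>s'. P s' \<Longrightarrow> run N X c' T' s' Q"
  shows "run N X (c ;; c') (T + T') s Q"
  using assms by (auto intro: run_Seq run_mono)

lemma run_Skip: "Q s \<Longrightarrow> run N X Skip T s Q"
  unfolding run_def using big.Skip by blast

inductive_cases big_SeqE: "big N X (c ;; c') s t s''"

lemma run_seqs_append: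
  assumes "run N X (seqs cs) T s (\<lambda>s'. run N X (seqs cs') T' s' Q)"
  shows "run N X (seqs (cs @ cs')) (T + T') s Q"
  using assms
proof (induction cs arbitrary: s T)
  case Nil
  then obtain t where "t \<le> T" "run N X (seqs cs') T' s Q"
    by (auto simp: run_def elim: big.cases)
  then show ?case by (auto intro: run_mono)
next
  case (Cons c cs)
  then obtain t s2 where "t \<le> T" "big N X (c ;; seqs cs) s t s2" "run N X (seqs cs') T' s2 Q"
    unfolding run_def[of _ _ "seqs (c # cs)"] by auto
  then obtain t1 t2 s1 where "t1 + t2 \<le> T" "big N X c s t1 s1" "big N X (seqs cs) s1 t2 s2"
    "run N X (seqs cs') T' s2 Q"
    by (auto elim: big_SeqE)
  moreover from this have "run N X (seqs (cs @ cs')) (t2 + T') s1 Q"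
    using Cons.IH[of t2 s1] unfolding run_def by blast
  ultimately obtain t s' where "t \<le> t2 + T'" "big N X (seqs (cs @ cs')) s1 t s'" "Q s'"
    by (auto simp: run_def)
  with \<open>big N X c s t1 s1\<close> have "big N X (seqs ((c # cs) @ cs')) s (t1 + t) s'"
    by (auto intro: big.Seq)
  then show ?case
    using \<open>t \<le> t2 + T'\<close> \<open>t1 + t2 \<le> T\<close> \<open>Q s'\<close> unfolding run_def by (intro exI[of _ "t1 + t"]) auto
qed

text \<open>Each step is handed the frame \<open>same M s s'\<close> from the very start, so that
  facts about arrays outside \<open>M\<close> can stay out of the invariant.\<close>

lemma run_seqs:
  assumes "I 0 s"
    and step: "\<And>j s'. j < m \<Longrightarrow> I j s' \<Longrightarrow> same M s s' \<Longrightarrow> run N X (f j) T s' (I (Suc j))"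
    and "\<And>j. j < m \<Longrightarrow> mods (f j) \<subseteq> M"
  shows "run N X (seqs (map f [0..<m])) (m * T) s (I m)"
  using step assms(3)
proof (induction m)
  case 0
  then show ?case using assms(1) by (simp add: run_Skip)
next
  case (Suc m)
  let ?cs = "map f [0..<m]"
  have "run N X (seqs ?cs) (m * T) s (\<lambda>s'. I m s' \<and> same M s s')"
  proof (rule run_same)
    show "run N X (seqs ?cs) (m * T) s (I m)" using Suc by simp
    show "mods (seqs ?cs) \<subseteq> M" 
    proof -
      have "mods (f j) \<subseteq> M" if "j < m" for j using that by (intro Suc.prems(2)) simp
      then show ?thesis by (simp add: UN_subset_iff)
    qed
  qed
  then have "run N X (seqs ?cs) (m * T) s (\<lambda>s'. run N X (seqs [f m]) (T + 0) s' (I (Suc m)))"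
  proof (rule run_mono)
    fix s'
    assume "I m s' \<and> same M s s'"
    then have "run N X (f m) T s' (\<lambda>s'. run N X Skip 0 s' (I (Suc m)))"
      using Suc.prems(1)[of m s'] by (auto intro: run_Skip run_mono)
    then show "run N X (seqs [f m]) (T + 0) s' (I (Suc m))"
      using run_Seq by fastforce
  qed simp
  from run_seqs_append[OF this] show ?case by (simp add: add.commute)
qed

text \<open>Loops have no precondition here: they are treated through \<open>run\<close> only.\<close>

primrec wp :: "nat \<Rightarrow> nat \<Rightarrow> com \<Rightarrow> (store \<Rightarrow> bool) \<Rightarrow> store \<Rightarrow> bool" where
  "wp N X Skip Q s \<longleftrightarrow> Q s"
| "wp N X (Put k e e') Q s \<longleftrightarrow>
     fits N X s e \<and> fits N X s e' \<and> Q (upd s k (eval N s e) (eval N s e'))"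
| "wp N X (c ;; c') Q s \<longleftrightarrow> wp N X c (wp N X c' Q) s"
| "wp N X (If0 e c c') Q s \<longleftrightarrow>
     fits N X s e \<and> (if eval N s e = 0 then wp N X c Q s else wp N X c' Q s)"
| "wp N X (Until e c) Q s \<longleftrightarrow> False"

text \<open>Adding up both branches of \<open>If0\<close> gives an upper bound that does not depend
  on the store.\<close>

primrec units :: "com \<Rightarrow> nat" where
  "units Skip = 0"
| "units (Put k e e') = 1"
| "units (c ;; c') = units c + units c'"
| "units (If0 e c c') = Suc (units c + units c')"
| "units (Until e c) = 0"

lemma wp_run: "wp N X c Q s \<Longrightarrow> run N X c (units c) s Q"
proof (induction c arbitrary: Q s)
  case Skip
  then show ?case by (simp add: run_Skip)
next
  case (Put k e e')
  then show ?case using big.Put[of N X s e e' k] unfolding run_def by (intro exI[of _ 1]) auto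
next
  case (Seq c c')
  then have "run N X c (units c) s (wp N X c' Q)" by simp
  then have "run N X c (units c) s (\<lambda>s'. run N X c' (units c') s' Q)"
    by (rule run_mono) (use Seq.IH(2) in auto)
  then show ?case using run_Seq by fastforce
next
  case (If0 e c c')
  show ?case
  proof (cases "eval N s e = 0")
    case True
    then have "run N X c (units c) s Q" using If0 by simp
    then obtain t s' where "t \<le> units c" "big N X c s t s'" "Q s'" by (auto simp: run_def)
    then show ?thesis
      using True If0.prems unfolding run_def
      by (intro exI[of _ "Suc t"]) (auto intro!: big.If0)
  next
    case False
    then have "run N X c' (units c') s Q" using If0 by simp
    then obtain t s' where "t \<le> units c'" "big N X c' s t s'" "Q s'" by (auto simp: run_def)
    then show ?thesis
      using False If0.prems unfolding run_def
      by (intro exI[of _ "Suc t"]) (auto intro!: big.If1)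
  qed
qed simp

lemma wp_mono: "wp N X c Q s \<Longrightarrow> (\<And>s'. Q s' \<Longrightarrow> Q' s') \<Longrightarrow> wp N X c Q' s"
proof (induction c arbitrary: Q Q' s)
  case (Seq c c')
  from Seq.prems(1) have "wp N X c (wp N X c' Q) s" by simp
  then have "wp N X c (wp N X c' Q') s"
    by (rule Seq.IH(1)) (rule Seq.IH(2)[OF _ Seq.prems(2)])
  then show ?case by simp
next
  case (If0 e c c')
  then show ?case by (auto split: if_splits)
qed auto

lemma wp_same:
  "wp N X c Q s \<Longrightarrow> mods c \<subseteq> M \<Longrightarrow> wp N X c (\<lambda>s'. Q s' \<and> same M s s') s"
proof (induction c arbitrary: Q s)
  case (Seq c c')
  then have "wp N X c (\<lambda>s'. wp N X c' Q s' \<and> same M s s') s" by simp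
  then have "wp N X c (wp N X c' (\<lambda>s''. Q s'' \<and> same M s s'')) s"
  proof (rule wp_mono)
    fix s'
    assume "wp N X c' Q s' \<and> same M s s'"
    then have "wp N X c' (\<lambda>s''. Q s'' \<and> same M s' s'') s'" "same M s s'"
      using Seq by auto
    then show "wp N X c' (\<lambda>s''. Q s'' \<and> same M s s'') s'"
      by (auto intro: wp_mono same_trans)
  qed
  then show ?case by simp
qed auto

lemma wp_Skip: "wp N X Skip Q = Q"
  by (simp add: fun_eq_iff)

lemma wp_Seq: "wp N X (c ;; c') Q = wp N X c (wp N X c' Q)"
  by (simp add: fun_eq_iff)

lemma wp_seqs_append: "wp N X (seqs (cs @ cs')) Q s = wp N X (seqs cs) (wp N X (seqs cs') Q) s"
proof -
  have "wp N X (seqs (cs @ cs')) Q = wp N X (seqs cs) (wp N X (seqs cs') Q)"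
    by (induction cs) (simp_all add: wp_Skip wp_Seq)
  then show ?thesis by simp
qed

lemma wp_seqs:
  assumes "I 0 s"
    and step: "\<And>j s'. j < m \<Longrightarrow> I j s' \<Longrightarrow> same M s s' \<Longrightarrow> wp N X (f j) (I (Suc j)) s'"
    and "\<And>j. j < m \<Longrightarrow> mods (f j) \<subseteq> M"
    and "\<And>s'. I m s' \<Longrightarrow> same M s s' \<Longrightarrow> Q s'"
  shows "wp N X (seqs (map f [0..<m])) Q s"
proof -
  have "wp N X (seqs (map f [0..<m])) (\<lambda>s'. I m s' \<and> same M s s') s"
    using step assms(3)
  proof (induction m)
    case 0
    then show ?case using assms(1) by simp
  next
    case (Suc m)
    have "wp N X (seqs (map f [0..<m])) (\<lambda>s'. I m s' \<and> same M s s') s"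
      by (rule Suc.IH) (use Suc.prems in auto)
    then have "wp N X (seqs (map f [0..<m])) (wp N X (f m) (I (Suc m))) s"
      by (rule wp_mono) (use Suc.prems in auto)
    then have "wp N X (seqs (map f [0..<Suc m])) (I (Suc m)) s"
      by (simp add: wp_seqs_append wp_Seq wp_Skip del: wp.simps)
    then show ?case
    proof (rule wp_same)
      have "mods (f j) \<subseteq> M" if "j < Suc m" for j using that by (rule Suc.prems(2))
      then show "mods (seqs (map f [0..<Suc m])) \<subseteq> M"
        by (simp add: UN_subset_iff)
    qed
  qed
  then show ?thesis by (rule wp_mono) (use assms(4) in auto)
qed

text \<open>The variant \<mu> bounds the number of rounds; each pays at most \<open>T\<close> and
  one test, and the 1 at the end is the test that stops the loop.\<close>

lemma run_Until:
  assumes "I s"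
    and fits: "\<And>s. I s \<Longrightarrow> fits N X s e"
    and step: "\<And>s. I s \<Longrightarrow> eval N s e = 0 \<Longrightarrow> run N X c T s (\<lambda>s'. I s' \<and> \<mu> s' < \<mu> s)"
  shows "run N X (Until e c) (\<mu> s * Suc T + 1) s (\<lambda>s'. I s' \<and> eval N s' e \<noteq> 0)"
  using assms(1)
proof (induction "\<mu> s" arbitrary: s rule: less_induct)
  case less
  show ?case
  proof (cases "eval N s e = 0")
    case True
    then obtain t s' where 1: "t \<le> T" "big N X c s t s'" "I s'" "\<mu> s' < \<mu> s"
      using step[OF less.prems] by (auto simp: run_def)
    then obtain t' s'' where 2: "t' \<le> \<mu> s' * Suc T + 1" "big N X (Until e c) s' t' s''"
      "I s''" "eval N s'' e \<noteq> 0"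
      using less.hyps[of s'] by (auto simp: run_def)
    have "Suc (\<mu> s') * Suc T \<le> \<mu> s * Suc T" using 1(4) by (intro mult_le_mono1) simp
    then have "Suc (t + t') \<le> \<mu> s * Suc T + 1" using 1(1) 2(1) by simp
    moreover have "big N X (Until e c) s (Suc (t + t')) s''"
      using big.Loop[OF fits[OF less.prems] True 1(2) 2(2)] .
    ultimately show ?thesis using 2 unfolding run_def by blast
  next
    case False
    then have "big N X (Until e c) s 1 s" using big.Stop fits[OF less.prems] by blast
    then show ?thesis using False less.prems unfolding run_def
      by (intro exI[of _ 1] exI[of _ s] conjI) auto
  qed
qed

text \<open>
  The machine cannot compare numbers: a loop ends when its counter reaches a marked cell
  of the array \<open>k\<close>.
\<close>

definition marks :: "store \<Rightarrow> nm \<Rightarrow> nat \<Rightarrow> bool" where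
  "marks s k n \<longleftrightarrow> (\<forall>x\<le>n. s k x = of_bool (x = n))"

definition For :: "nm \<Rightarrow> nm \<Rightarrow> com \<Rightarrow> com" where
  "For k i c = (i ::= Const 0) ;; Until (Idx k (Var i)) (c ;; i ::= AddC (Var i) 1)"

lemma mods_For [simp]: "mods (For k i c) = insert (fst i) (mods c)"
  by (auto simp: For_def)

text \<open>Per round the test and the increment add 2 to \<open>T\<close>; initialisation and the
  last test give the other 2. The invariant must survive assignments to the counter, which is
  \<open>counter\<close>, and the body must leave the counter alone, hence
  \<open>M - {fst i}\<close>.\<close>

lemma run_For:
  assumes marks: "marks s k n" and n: "n \<le> X"
    and I0: "I 0 s"
    and step: "\<And>x s'. x < n \<Longrightarrow> I x s' \<Longrightarrow> s' i 0 = x \<Longrightarrow> same M s s' \<Longrightarrow>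
      run N X c T s' (I (Suc x))"
    and counter: "\<And>x v s'. I x s' \<Longrightarrow> I x (upd s' i 0 v)"
    and M: "mods c \<subseteq> M - {fst i}" "fst i \<in> M" "fst k \<notin> M"
  shows "run N X (For k i c) (n * (T + 2) + 2) s (I n)"
proof -
  let ?J = "\<lambda>s'. s' i 0 \<le> n \<and> I (s' i 0) s' \<and> same M s s'"
  have k: "s' k = s k" if "same M s s'" for s'
    using sameD[OF that, of "fst k" "snd k"] M by simp
  have ki: "marks s' k n" if "same M s s'" for s'
    using k[OF that] marks by (simp add: marks_def)
  have body: "run N X (c ;; i ::= AddC (Var i) 1) (T + 1) s'
      (\<lambda>s''. ?J s'' \<and> n - s'' i 0 < n - s' i 0)"
    if J: "?J s'" and e: "eval N s' (Idx k (Var i)) = 0" for s'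
  proof -
    define x where "x = s' i 0"
    have x: "x < n"
      using e ki[of s'] J by (auto simp: marks_def x_def order.order_iff_strict split: if_splits)
    have "run N X c T s' (\<lambda>s''. I (Suc x) s'' \<and> same (M - {fst i}) s' s'')"
      using step[OF x] J M(1) by (intro run_same) (auto simp: x_def)
    then have "run N X c T s' (\<lambda>s''. run N X (i ::= AddC (Var i) 1) 1 s''
      (\<lambda>s''. ?J s'' \<and> n - s'' i 0 < n - s' i 0))"
    proof (rule run_mono)
      fix s2
      assume s2: "I (Suc x) s2 \<and> same (M - {fst i}) s' s2"
      then have i: "s2 i 0 = x"
        using sameD[of "M - {fst i}" s' s2 "fst i" "snd i"] by (simp add: x_def)
      have "same M s s2"
        using s2 J same_trans same_mono[OF _ Diff_subset] by blast
      then have "same M s (upd s2 i 0 (Suc x))"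
        by (rule same_trans) (use M in simp)
      then have "wp N X (i ::= AddC (Var i) 1) (\<lambda>s''. ?J s'' \<and> n - s'' i 0 < n - s' i 0) s2"
        using i x n s2 counter[of "Suc x" s2 "Suc x"] by (auto simp: x_def[symmetric])
      from wp_run[OF this] show "run N X (i ::= AddC (Var i) 1) 1 s2
          (\<lambda>s''. ?J s'' \<and> n - s'' i 0 < n - s' i 0)" by simp
    qed simp
    then show ?thesis by (rule run_Seq)
  qed
  have "wp N X (i ::= Const 0) (\<lambda>s'. ?J s' \<and> s' i 0 = 0) s"
    using I0 counter[of 0 s 0] M by simp
  then have "run N X (i ::= Const 0) 1 s (\<lambda>s'. ?J s' \<and> s' i 0 = 0)"
    using wp_run by fastforce
  then have "run N X (i ::= Const 0) 1 s
    (\<lambda>s'. run N X (Until (Idx k (Var i)) (c ;; i ::= AddC (Var i) 1)) (n * (T + 2) + 1) s' (I n))"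
  proof (rule run_mono)
    fix s'
    assume s': "?J s' \<and> s' i 0 = 0"
    have "run N X (Until (Idx k (Var i)) (c ;; i ::= AddC (Var i) 1))
       ((n - s' i 0) * Suc (T + 1) + 1) s' (\<lambda>s''. ?J s'' \<and> eval N s'' (Idx k (Var i)) \<noteq> 0)"
      by (rule run_Until[where \<mu> = "\<lambda>s. n - s i 0"]) (use s' body in auto)
    then show "run N X (Until (Idx k (Var i)) (c ;; i ::= AddC (Var i) 1)) (n * (T + 2) + 1) s' (I n)"
    proof (rule run_mono)
      fix s''
      assume "?J s'' \<and> eval N s'' (Idx k (Var i)) \<noteq> 0"
      moreover from this have "s'' i 0 = n"
        using ki[of s''] by (auto simp: marks_def split: if_splits)
      ultimately show "I n s''" by auto
    qed (use s' in auto)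
  qed simp
  from run_Seq[OF this] show ?thesis unfolding For_def by (rule run_mono) auto
qed

section \<open>Words\<close>

text \<open>Bijective numeration: every natural number codes exactly one word over \<open>{..<k}\<close>.\<close>

definition enc :: "nat \<Rightarrow> nat list \<Rightarrow> nat" where
  "enc k = foldl (\<lambda>n a. k * n + a + 1) 0"

function dec :: "nat \<Rightarrow> nat \<Rightarrow> nat list" where
  "dec k n = (if n = 0 \<or> k = 0 then [] else dec k ((n - 1) div k) @ [(n - 1) mod k])"
  by auto
termination
  by (relation "measure snd") (auto intro: le_less_trans[OF div_le_dividend])

declare dec.simps [simp del]

lemma enc_Nil [simp]: "enc k [] = 0"
  by (simp add: enc_def)

lemma enc_snoc [simp]: "enc k (l @ [a]) = k * enc k l + a + 1"
  by (simp add: enc_def)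

lemma dec_0 [simp]: "dec k 0 = []"
  by (simp add: dec.simps)

lemma dec_snoc [simp]: "a < k \<Longrightarrow> dec k (Suc (k * n + a)) = dec k n @ [a]"
  by (subst dec.simps) simp

lemma word_code_cases:
  assumes "0 < k"
  obtains "n = 0" | m a where "a < k" "n = Suc (k * m + a)"
proof (cases "n = 0")
  case False
  then have "n = Suc (k * ((n - 1) div k) + (n - 1) mod k)" by simp
  then show ?thesis using that(2)[of "(n - 1) mod k"] assms mod_less_divisor by blast
qed (use that in simp)

lemma enc_dec [simp]: "0 < k \<Longrightarrow> enc k (dec k n) = n"
proof (induction n rule: less_induct)
  case (less n)
  from less.prems show ?case
  proof (cases rule: word_code_cases[of k n])
    case (2 m a)
    then have "m < n" using less.prems by (cases k) auto
    then show ?thesis using 2 less by simp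
  qed simp
qed

lemma dec_enc [simp]: "set l \<subseteq> {..<k} \<Longrightarrow> dec k (enc k l) = l"
  by (induction l rule: rev_induct) auto

lemma set_dec: "0 < k \<Longrightarrow> set (dec k n) \<subseteq> {..<k}"
proof (induction n rule: less_induct)
  case (less n)
  from less.prems show ?case
  proof (cases rule: word_code_cases[of k n])
    case (2 m a)
    then have "m < n" using less.prems by (cases k) auto
    then show ?thesis using 2 less by auto
  qed simp
qed

text \<open>For positive \<open>k\<close>, the number of words of length less than \<open>l\<close>
  over \<open>k\<close> letters, and so the least code of a word of length \<open>l\<close>.\<close>

primrec wcount :: "nat \<Rightarrow> nat \<Rightarrow> nat" where
  "wcount k 0 = 0"
| "wcount k (Suc l) = k * wcount k l + 1"

text \<open>Bijective numeration lists shorter words first. Bounding a code is therefore the same as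
  bounding a length, which lets a loop over all short words be a loop over numbers.\<close>

lemma less_wcount: "0 < k \<Longrightarrow> n < wcount k l \<longleftrightarrow> length (dec k n) < l"
proof (induction l arbitrary: n)
  case (Suc l)
  from Suc.prems show ?case
  proof (cases rule: word_code_cases[of k n])
    case (2 m a)
    have "n < wcount k (Suc l) \<longleftrightarrow> k * m + a < k * wcount k l" using 2 by simp
    also have "\<dots> \<longleftrightarrow> m < wcount k l"
    proof
      assume "m < wcount k l"
      then have "k * Suc m \<le> k * wcount k l" by (intro mult_le_mono2) simp
      then show "k * m + a < k * wcount k l" using \<open>a < k\<close> by simp
    next
      assume "k * m + a < k * wcount k l"
      then have "k * m < k * wcount k l" by linarith
      then show "m < wcount k l" by simp
    qed
    finally show ?thesis using Suc 2 by simp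
  qed simp
qed simp

lemma enc_less_wcount: "set l \<subseteq> {..<k} \<Longrightarrow> length l \<le> m \<Longrightarrow> 0 < k \<Longrightarrow> enc k l < wcount k (Suc m)"
  by (subst less_wcount) auto

lemma wcount_le: "2 \<le> k \<Longrightarrow> wcount k l \<le> k ^ l"
proof -
  assume k: "2 \<le> k"
  \<comment> \<open>The additional 1 makes the induction work: \<open>k * wcount k l + 1 + 1\<close>
    is absorbed by \<open>k * (wcount k l + 1)\<close>.\<close>
  have "wcount k l + 1 \<le> k ^ l"
  proof (induction l)
    case (Suc l)
    have "wcount k (Suc l) + 1 \<le> k * wcount k l + k" using k by simp
    also have "\<dots> = k * (wcount k l + 1)" by simp
    also have "\<dots> \<le> k * k ^ l" using Suc by (rule mult_le_mono2)
    finally show ?case by simp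
  qed simp
  then show ?thesis by simp
qed

section \<open>Binary notation cut into blocks of \<open>l\<close> digits\<close>

lemma binary_double: "0 < n \<Longrightarrow> binary (2 * n + of_bool b) = binary n @ [b]"
  by (subst binary.simps) auto

lemma binary_1: "binary (Suc 0) = [True]" and binary_0: "binary 0 = [False]"
  by (simp_all add: binary.simps)

lemma binary_nonempty [simp]: "binary n \<noteq> []"
  by (subst binary.simps) auto

lemma bit_cases:
  fixes D :: nat
  obtains D' b where "D = 2 * D' + of_bool b"
  using that[of "D div 2" "odd D"] by (simp add: mod_2_eq_odd flip: of_bool_odd_eq_mod_2)

text \<open>Behind the digits of \<open>Y\<close> the block \<open>D\<close> must appear with its
  leading zeros. Adding \<open>2 ^ l\<close> and dropping the leading 1 pads it to exactly
  \<open>l\<close> digits.\<close>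

lemma binary_append:
  "0 < Y \<Longrightarrow> D < 2 ^ l \<Longrightarrow> binary (Y * 2 ^ l + D) = binary Y @ tl (binary (2 ^ l + D))"
proof (induction l arbitrary: D)
  case 0
  then show ?case by (simp add: binary_1)
next
  case (Suc l)
  obtain D' b where D: "D = 2 * D' + of_bool b" by (rule bit_cases)
  have D': "D' < 2 ^ l" using Suc.prems D by (cases b) auto
  have "binary (Y * 2 ^ Suc l + D) = binary (2 * (Y * 2 ^ l + D') + of_bool b)"
    by (simp add: D algebra_simps)
  also have "\<dots> = binary Y @ tl (binary (2 ^ l + D')) @ [b]"
    by (subst binary_double) (use Suc.IH[OF Suc.prems(1) D'] Suc.prems(1) in auto)
  also have "tl (binary (2 ^ l + D')) @ [b] = tl (binary (2 * (2 ^ l + D') + of_bool b))"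
    by (subst binary_double) auto
  finally show ?case by (simp add: D algebra_simps)
qed

lemma length_binary_ge: "D < 2 ^ l \<Longrightarrow> length (binary (2 ^ l + D)) = Suc l"
proof (induction l arbitrary: D)
  case (Suc l)
  obtain D' b where D: "D = 2 * D' + of_bool b" by (rule bit_cases)
  have D': "D' < 2 ^ l" using Suc.prems D by (cases b) auto
  have "binary (2 ^ Suc l + D) = binary (2 ^ l + D') @ [b]"
    using binary_double[of "2 ^ l + D'" b] by (simp add: D algebra_simps)
  then show ?case using Suc.IH[OF D'] by simp
qed (simp add: binary_1)

lemma length_binary: "n < 2 ^ l \<Longrightarrow> 0 < l \<Longrightarrow> length (binary n) \<le> l"
proof (induction l arbitrary: n)
  case (Suc l)
  obtain n' b where n: "n = 2 * n' + of_bool b" by (rule bit_cases)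
  show ?case
  proof (cases "n' = 0")
    case True
    then have "n < 2" using n by simp
    then show ?thesis by (simp add: binary.simps)
  next
    case False
    have n': "n' < 2 ^ l" using Suc.prems n by (cases b) auto
    with False have "0 < l" by (cases l) auto
    then show ?thesis using False binary_double[of n' b] Suc.IH[OF n'] n by simp
  qed
qed simp


section \<open>Digits\<close>

definition dg :: "nat \<Rightarrow> nat \<Rightarrow> nat \<Rightarrow> nat" where
  "dg \<beta> j x = x div \<beta> ^ j mod \<beta>"

text \<open>A closed formula for the carry into position \<open>j\<close>, so that correctness of
  addition becomes an identity between quotients and remainders.\<close>

definition carry :: "nat \<Rightarrow> nat \<Rightarrow> nat \<Rightarrow> nat \<Rightarrow> nat \<Rightarrow> nat" where
  "carry \<beta> c j x y = (x mod \<beta> ^ j + y mod \<beta> ^ j + c) div \<beta> ^ j"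

lemma dg_less: "0 < \<beta> \<Longrightarrow> dg \<beta> j x < \<beta>"
  by (simp add: dg_def)

lemma mod_power_Suc: "x mod \<beta> ^ Suc j = x mod \<beta> ^ j + \<beta> ^ j * dg \<beta> j x" for x \<beta> :: nat
  by (simp add: dg_def mod_mult2_eq power_Suc2 del: power_Suc)

text \<open>Cut both summands at \<open>\<beta> ^ j\<close>. The low parts together with
  \<open>c\<close> produce the carry, and the high parts enter only through their lowest
  digits.\<close>

lemma add_digit:
  fixes \<beta> :: nat
  assumes "0 < \<beta>"
  shows "(dg \<beta> j x + dg \<beta> j y + carry \<beta> c j x y) mod \<beta> = dg \<beta> j (x + y + c)"
    and "(dg \<beta> j x + dg \<beta> j y + carry \<beta> c j x y) div \<beta> = carry \<beta> c (Suc j) x y"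
proof -
  let ?b = "\<beta> ^ j"
  have b: "0 < ?b" using assms by simp
  have "x + y + c = (x mod ?b + y mod ?b + c) + ?b * (x div ?b + y div ?b)"
    by (simp add: algebra_simps)
  then have "(x + y + c) div ?b = carry \<beta> c j x y + (x div ?b + y div ?b)"
    using b by (simp only: carry_def div_mult_self2[OF less_imp_neq[OF b, symmetric]])
  then show "(dg \<beta> j x + dg \<beta> j y + carry \<beta> c j x y) mod \<beta> = dg \<beta> j (x + y + c)"
    unfolding dg_def by (metis mod_add_eq mod_add_left_eq add.commute)
  have "carry \<beta> c (Suc j) x y =
      (x mod ?b + y mod ?b + c + ?b * (dg \<beta> j x + dg \<beta> j y)) div ?b div \<beta>"
    unfolding carry_def mod_power_Suc unfolding power_Suc2 div_mult2_eq
    by (simp add: algebra_simps)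
  also have "(x mod ?b + y mod ?b + c + ?b * (dg \<beta> j x + dg \<beta> j y)) div ?b =
      carry \<beta> c j x y + (dg \<beta> j x + dg \<beta> j y)"
    using b by (simp only: carry_def div_mult_self2[OF less_imp_neq[OF b, symmetric]])
  finally show "(dg \<beta> j x + dg \<beta> j y + carry \<beta> c j x y) div \<beta> = carry \<beta> c (Suc j) x y"
    by (simp add: ac_simps)
qed

lemma carry_0 [simp]: "carry \<beta> c 0 x y = c"
  by (simp add: carry_def)

lemma carry_le: "0 < \<beta> \<Longrightarrow> c \<le> 1 \<Longrightarrow> carry \<beta> c j x y \<le> 1"
proof -
  assume "0 < \<beta>" "c \<le> 1"
  then have "x mod \<beta> ^ j < \<beta> ^ j" "y mod \<beta> ^ j < \<beta> ^ j" by simp_all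
  then have "x mod \<beta> ^ j + y mod \<beta> ^ j + c < 2 * \<beta> ^ j" using \<open>c \<le> 1\<close> by linarith
  then have "carry \<beta> c j x y < 2" unfolding carry_def by (simp add: less_mult_imp_div_less)
  then show ?thesis by simp
qed

text \<open>Replaces the rounded square root by comparisons of integers, which the search in
  \<open>base_prog\<close> can make. The alternative \<open>b = 2\<close> comes from the maximum in
  \<open>base\<close>.\<close>

lemma base_eqI:
  assumes "2 \<le> b" "N \<le> b * b" "b = 2 \<or> (b - 1) * (b - 1) < N"
  shows "b = base N"
proof -
  have 1: "nat \<lceil>sqrt (real N)\<rceil> \<le> b"
  proof -
    have "sqrt (real N) \<le> real b"
      using assms(2) by (intro real_le_lsqrt) (auto simp: power2_eq_square simp flip: of_nat_mult)
    then show ?thesis by (simp add: ceiling_le_iff nat_le_iff)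
  qed
  show ?thesis
  proof (cases "b = 2")
    case True
    then show ?thesis using 1 by (simp add: base_def)
  next
    case False
    then have "real (b - 1) < sqrt (real N)"
      using assms(3) by (intro real_less_rsqrt) (auto simp: power2_eq_square simp flip: of_nat_mult)
    then have "int (b - 1) < \<lceil>sqrt (real N)\<rceil>" by (simp add: less_ceiling_iff)
    then have "b \<le> nat \<lceil>sqrt (real N)\<rceil>" by linarith
    then show ?thesis using 1 assms(1) by (simp add: base_def)
  qed
qed


section \<open>Mealy machines\<close>

text \<open>One step of the automaton, with the cells moved one place to the right.\<close>

primrec mealy :: "('a \<Rightarrow> 'a \<Rightarrow> 'a \<Rightarrow> 'a) \<Rightarrow> 'a \<Rightarrow> 'a \<Rightarrow> 'a list \<Rightarrow> 'a list" where
  "mealy d x y [] = []"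
| "mealy d x y (a # l) = d x y a # mealy d y a l"

lemma length_mealy [simp]: "length (mealy d x y l) = length l"
  by (induction l arbitrary: x y) auto

lemma nth_mealy:
  "i < length l \<Longrightarrow>
    mealy d x y l ! i = d ((x # y # l) ! i) ((x # y # l) ! Suc i) ((x # y # l) ! Suc (Suc i))"
proof (induction l arbitrary: x y i)
  case (Cons a l)
  then show ?case by (cases i) auto
qed simp

text \<open>A state \<open>(x, y)\<close> of one of the machines is coded by \<open>x * q + y\<close>.\<close>

locale cascade =
  fixes q :: nat and d :: "nat \<Rightarrow> nat \<Rightarrow> nat \<Rightarrow> nat"
  assumes d_less: "x < q \<Longrightarrow> y < q \<Longrightarrow> z < q \<Longrightarrow> d x y z < q"
begin

text \<open>The head of the list reads the input, and its output is the input of the next machine. A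
  machine remembers two letters, so its new state consists of the second of them and the letter just
  read.\<close>

primrec st :: "nat list \<Rightarrow> nat \<Rightarrow> nat list" where
  "st [] a = []"
| "st (p # s) a = (p mod q * q + a) # st s (d (p div q) (p mod q) a)"

primrec out :: "nat list \<Rightarrow> nat \<Rightarrow> nat" where
  "out [] a = a"
| "out (p # s) a = out s (d (p div q) (p mod q) a)"

primrec sts :: "nat list \<Rightarrow> nat list \<Rightarrow> nat list" where
  "sts s [] = s"
| "sts s (a # l) = sts (st s a) l"

primrec outs :: "nat list \<Rightarrow> nat list \<Rightarrow> nat list" where
  "outs s [] = []"
| "outs s (a # l) = out s a # outs (st s a) l"

text \<open>Codes of words grow at the right end, so the tables are filled by placing one more
  machine behind a cascade already tabulated.\<close>

lemma out_snoc: "out (s @ [p]) a = d (p div q) (p mod q) (out s a)"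
  by (induction s arbitrary: a) auto

lemma st_snoc: "st (s @ [p]) a = st s a @ [p mod q * q + out s a]"
  by (induction s arbitrary: a) auto

lemma sts_append: "sts s (l @ l') = sts (sts s l) l'"
  by (induction l arbitrary: s) auto

lemma outs_append: "outs s (l @ l') = outs s l @ outs (sts s l) l'"
  by (induction l arbitrary: s) auto

lemma length_st [simp]: "length (st s a) = length s"
  by (induction s arbitrary: a) auto

lemma length_sts [simp]: "length (sts s l) = length s"
  by (induction l arbitrary: s) auto

lemma length_outs [simp]: "length (outs s l) = length l"
  by (induction l arbitrary: s) auto

lemma pair_less: "p < q * q \<Longrightarrow> p div q < q \<and> p mod q < q"
  by (cases "q = 0") (auto simp: less_mult_imp_div_less)

lemma pair_code_less: "y < q \<Longrightarrow> a < q \<Longrightarrow> y * q + a < q * q"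
proof -
  assume "y < q" "a < q"
  then have "y * q + a < Suc y * q" by simp
  also have "\<dots> \<le> q * q" using \<open>y < q\<close> by (intro mult_le_mono1) simp
  finally show ?thesis .
qed

lemma out_less: "set s \<subseteq> {..<q * q} \<Longrightarrow> a < q \<Longrightarrow> out s a < q"
  by (induction s arbitrary: a) (auto simp: d_less pair_less)

lemma set_st: "set s \<subseteq> {..<q * q} \<Longrightarrow> a < q \<Longrightarrow> set (st s a) \<subseteq> {..<q * q}"
  by (induction s arbitrary: a) (auto simp: d_less pair_less pair_code_less)

lemma set_sts: "set s \<subseteq> {..<q * q} \<Longrightarrow> set l \<subseteq> {..<q} \<Longrightarrow> set (sts s l) \<subseteq> {..<q * q}"
proof (induction l arbitrary: s)
  case (Cons a l)
  then show ?case using set_st[of s a] by simp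
qed simp

lemma set_outs: "set s \<subseteq> {..<q * q} \<Longrightarrow> set l \<subseteq> {..<q} \<Longrightarrow> set (outs s l) \<subseteq> {..<q}"
proof (induction l arbitrary: s)
  case (Cons a l)
  then show ?case using set_st[of s a] out_less[of s a] by simp
qed simp

lemma set_mealy: "x < q \<Longrightarrow> y < q \<Longrightarrow> set l \<subseteq> {..<q} \<Longrightarrow> set (mealy d x y l) \<subseteq> {..<q}"
  by (induction l arbitrary: x y) (auto simp: d_less)

text \<open>Letter by letter or machine by machine makes no difference: the first machine may as
  well transform the whole word before the others start.\<close>

lemma outs_Cons:
  "y < q \<Longrightarrow> set l \<subseteq> {..<q} \<Longrightarrow> outs ((x * q + y) # s) l = outs s (mealy d x y l)"
  by (induction l arbitrary: x y s) auto

text \<open>\<open>x * q + x\<close> is the memory of two cells \<open>x\<close>, which is the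
  situation to the left of the configuration if \<open>x\<close> is the blank.\<close>

lemma outs_replicate:
  "x < q \<Longrightarrow> set l \<subseteq> {..<q} \<Longrightarrow>
    outs (replicate t (x * q + x)) l = (mealy d x x ^^ t) l"
proof (induction t arbitrary: l)
  case 0
  have "outs [] l = l" by (induction l) auto
  then show ?case by simp
next
  case (Suc t)
  then show ?case
    using set_mealy[of x x l] by (simp add: outs_Cons funpow_swap1)
qed

end

section \<open>The automaton as a cascade\<close>

definition count_letters :: "'a \<Rightarrow> 'a list \<Rightarrow> nat" where
  "count_letters z l = length (filter (\<lambda>a. a \<noteq> z) l)"

text \<open>Every letter except the blank \<open>z\<close> counts as a binary digit. Blanks around
  the result are thus skipped, and the states \<open>qs\<close> in front of it act as leading
  zeros.\<close>

definition word_value :: "'a \<Rightarrow> ('a \<Rightarrow> bool) \<Rightarrow> 'a list \<Rightarrow> nat" where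
  "word_value z isone = foldl (\<lambda>v a. if a = z then v else 2 * v + of_bool (isone a)) 0"

lemma count_letters_append [simp]:
  "count_letters z (l @ l') = count_letters z l + count_letters z l'"
  by (simp add: count_letters_def)

lemma word_value_Nil [simp]: "word_value z isone [] = 0"
  and word_value_snoc [simp]: "word_value z isone (l @ [a]) =
    (if a = z then word_value z isone l else 2 * word_value z isone l + of_bool (isone a))"
  by (simp_all add: word_value_def)

lemma word_value_append:
  "word_value z isone (l @ l') = word_value z isone l * 2 ^ count_letters z l' + word_value z isone l'"
proof (induction l' rule: rev_induct)
  case (snoc a l')
  then show ?case
    by (simp add: count_letters_def algebra_simps flip: append_assoc)
qed (simp add: count_letters_def)

lemma word_value_replicate: "word_value z isone (replicate n a) = 0" if "a = z \<or> \<not> isone a"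
proof (induction n)
  case (Suc n)
  have "replicate (Suc n) a = replicate n a @ [a]" by (simp add: replicate_append_same)
  then show ?case using Suc that by (auto simp del: replicate.simps)
qed simp

lemma word_value_bits:
  "word_value z isone l = binary_value (map isone l)" if "z \<notin> set l"
  using that by (induction l rule: rev_induct) (auto simp: binary_value_def)

lemma word_value_map:
  assumes "inj_on \<phi> V" "z \<in> V" "set l \<subseteq> V"
  shows "word_value (\<phi> z) isone (map \<phi> l) = word_value z (\<lambda>a. isone (\<phi> a)) l"
  using assms(3)
proof (induction l rule: rev_induct)
  case (snoc a l)
  then show ?case using assms by (auto simp: inj_on_eq_iff)
qed simp

lemma mealy_map:
  assumes "\<And>x y z. x \<in> V \<Longrightarrow> y \<in> V \<Longrightarrow> z \<in> V \<Longrightarrow> d' (\<phi> x) (\<phi> y) (\<phi> z) = \<phi> (d x y z)"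
    and "x \<in> V" "y \<in> V" "set l \<subseteq> V"
  shows "mealy d' (\<phi> x) (\<phi> y) (map \<phi> l) = map \<phi> (mealy d x y l)"
  using assms(2-4) by (induction l arbitrary: x y) (auto simp: assms(1))

lemma mealy_closed:
  assumes "\<And>x y z. x \<in> V \<Longrightarrow> y \<in> V \<Longrightarrow> z \<in> V \<Longrightarrow> d x y z \<in> V"
    and "x \<in> V" "y \<in> V" "set l \<subseteq> V"
  shows "set (mealy d x y l) \<subseteq> V"
  using assms(2-4) by (induction l arbitrary: x y) (auto simp: assms(1))

definition letter :: "nat \<Rightarrow> nat \<Rightarrow> nat \<Rightarrow> symbol \<Rightarrow> nat" where
  "letter z0 z1 zs a = (case a of Bit b \<Rightarrow> if b then z1 else z0 | _ \<Rightarrow> zs)"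

lemma set_operands_word: "set (operands_word Xs) \<subseteq> insert Semicolon (range Bit)"
  by (induction Xs rule: operands_word.induct) auto

text \<open>
  Output cells and their neighbours are frozen, so that the result can still be read after
  any larger number of steps.
\<close>

definition freeze :: "'q set \<Rightarrow> ('q \<Rightarrow> 'q \<Rightarrow> 'q \<Rightarrow> 'q) \<Rightarrow> 'q \<Rightarrow> 'q \<Rightarrow> 'q \<Rightarrow> 'q" where
  "freeze Q d a b c = (if a \<in> Q \<or> b \<in> Q \<or> c \<in> Q then b else d a b c)"

lemma ca_succ_freeze:
  assumes "\<And>i. C i \<notin> Q"
  shows "ca_succ (M\<lparr>delta := freeze Q (delta M)\<rparr>) C = ca_succ M C"
  using assms by (simp add: ca_succ_def freeze_def)

lemma frozen_result:
  fixes M :: "'q ca"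
  assumes ca: "is_ca M" and Q: "Q \<subseteq> states M" and perm: "permanent_right M s" and s: "s \<in> states M - Q"
    and w: "set w \<subseteq> states M"
    and u: "u \<noteq> []" "set u \<subseteq> Q"
    and result: "(ca_succ M ^^ T) (word_config s 0 w) = word_config s p u"
    and before: "\<And>t i. t < T \<Longrightarrow> (ca_succ M ^^ t) (word_config s 0 w) i \<notin> Q"
    and t: "T \<le> t"
  shows "\<exists>a b. (mealy (freeze Q (delta M)) s s ^^ t) (w @ replicate t s) =
    replicate a s @ u @ replicate b s"
proof -
  define M' where "M' = M\<lparr>delta := freeze Q (delta M)\<rparr>"
  define C where "C t = (ca_succ M' ^^ t) (word_config s 0 w)" for t
  have C_Suc: "C (Suc t) = ca_succ M' (C t)" for t by (simp add: C_def)
  have d: "delta M a b c \<in> states M" if "a \<in> states M" "b \<in> states M" "c \<in> states M" for a b c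
    using ca that by (auto simp: is_ca_def)
  have d': "freeze Q (delta M) a b c \<in> states M"
    if "a \<in> states M" "b \<in> states M" "c \<in> states M" for a b c
    using d that by (simp add: freeze_def)
  have ds: "delta M a s s = s" if "a \<in> states M" for a
    using perm that by (auto simp: permanent_right_def)
  have C_states: "C t i \<in> states M" for t i
  proof (induction t arbitrary: i)
    case 0
    then show ?case using s w by (auto simp: C_def word_config_def)
  next
    case (Suc t)
    then show ?case by (simp add: C_Suc ca_succ_def M'_def d')
  qed
  \<comment> \<open>A change travels at most one cell to the left per step.\<close>
  have C_left: "C t i = s" if "i < - int t" for t i
    using that
  proof (induction t arbitrary: i)
    case 0
    then show ?case by (simp add: C_def word_config_def)
  next
    case (Suc t)
    then show ?case using s ds[of s] by (simp add: C_Suc ca_succ_def M'_def freeze_def)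
  qed
  \<comment> \<open>A blank cell with a blank right neighbour stays blank, so nothing ever leaves
    the input on the right.\<close>
  have C_right: "C t i = s" if "int (length w) \<le> i" for t i
    using that
  proof (induction t arbitrary: i)
    case 0
    then show ?case by (simp add: C_def word_config_def)
  next
    case (Suc t)
    then show ?case using s ds[OF C_states] by (simp add: C_Suc ca_succ_def M'_def freeze_def)
  qed
  have until_T: "C t = (ca_succ M ^^ t) (word_config s 0 w)" if "t \<le> T" for t
    using that
  proof (induction t)
    case (Suc t)
    have "C (Suc t) = ca_succ M' ((ca_succ M ^^ t) (word_config s 0 w))"
      using Suc by (simp add: C_Suc)
    also have "\<dots> = ca_succ M ((ca_succ M ^^ t) (word_config s 0 w))"
      unfolding M'_def by (rule ca_succ_freeze) (use Suc.prems before in auto)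
    finally show ?case by simp
  qed (simp add: C_def)
  \<comment> \<open>A cell with an output state in its neighbourhood is frozen, and any other cell
    sees only blanks.\<close>
  have fixed: "ca_succ M' (word_config s p u) = word_config s p u"
  proof
    fix i
    define W where "W = word_config s p u"
    have W: "W j \<in> Q \<or> W j = s" for j
      using u(2) by (auto simp: W_def word_config_def)
    show "ca_succ M' (word_config s p u) i = word_config s p u i"
    proof (cases "W (i - 1) \<in> Q \<or> W i \<in> Q \<or> W (i + 1) \<in> Q")
      case True
      then show ?thesis by (simp add: ca_succ_def M'_def freeze_def flip: W_def)
    next
      case False
      then have "W (i - 1) = s" "W i = s" "W (i + 1) = s" using W by blast+
      then show ?thesis using False ds[of s] s
        by (simp add: ca_succ_def M'_def freeze_def flip: W_def)
    qed
  qed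
  have C_t: "C t = word_config s p u" if "T \<le> t" for t
    using that
  proof (induction t rule: dec_induct)
    case base
    then show ?case using until_T result by simp
  next
    case (step n)
    then show ?case using fixed by (simp add: C_Suc)
  qed
  \<comment> \<open>After \<open>j\<close> shifted steps place \<open>i\<close> of the list is cell
    \<open>i - j\<close>. The two letters fed in before the list are cells \<open>- j - 1\<close>
    and \<open>- j - 2\<close>, blank by \<open>C_left\<close>.\<close>
  have shifted: "(mealy (freeze Q (delta M)) s s ^^ j) (w @ replicate t s) =
      map (\<lambda>i. C j (int i - int j)) [0..<length w + t]" for j
  proof (induction j)
    case 0
    show ?case by (rule nth_equalityI) (auto simp: C_def word_config_def nth_append)
  next
    case (Suc j)
    define l where "l = map (\<lambda>i. C j (int i - int j)) [0..<length w + t]"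
    have nth: "(s # s # l) ! i = C j (int i - int j - 2)" if "i < length w + t + 2" for i
    proof (cases i)
      case 0
      then show ?thesis using C_left[of "- int j - 2" j] by simp
    next
      case (Suc i')
      then show ?thesis using C_left[of "- int j - 1" j] that
        by (cases i') (auto simp: l_def algebra_simps minus_diff_commute)
    qed
    have "mealy (freeze Q (delta M)) s s l = map (\<lambda>i. C (Suc j) (int i - int (Suc j))) [0..<length w + t]"
    proof (rule nth_equalityI)
      fix i
      assume "i < length (mealy (freeze Q (delta M)) s s l)"
      then have i: "i < length w + t" by (simp add: l_def)
      then have "i < length l" by (simp add: l_def)
      from nth_mealy[OF this] show "mealy (freeze Q (delta M)) s s l ! i =
          map (\<lambda>i. C (Suc j) (int i - int (Suc j))) [0..<length w + t] ! i"
        using i by (simp only: nth) (simp add: C_Suc ca_succ_def M'_def algebra_simps)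
    qed (simp add: l_def)
    then show ?case using Suc by (simp add: l_def)
  qed
  \<comment> \<open>The two ends of \<open>u\<close> are not blank, which forces all of
    \<open>u\<close> into the window and yields the numbers \<open>a\<close> and \<open>b\<close> of
    blanks around it.\<close>
  have "u ! 0 \<in> set u" "u ! (length u - 1) \<in> set u"
    using u(1) by auto
  then have "u ! 0 \<noteq> s" "u ! (length u - 1) \<noteq> s"
    using u s by blast+
  then have ends: "C t p \<noteq> s" "C t (p + int (length u) - 1) \<noteq> s"
    using u(1) C_t[OF t] nat_int[of "length u - 1"]
    by (auto simp: word_config_def of_nat_diff Suc_le_eq simp del: nat_int)
  have p: "- int t \<le> p" using ends(1) C_left[of p t] by linarith
  have p': "p + int (length u) \<le> int (length w)"
    using ends(2) C_right[of "p + int (length u) - 1" t] by linarith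
  define a where "a = nat (p + int t)"
  define b where "b = nat (int (length w) - p - int (length u))"
  have a: "int a = p + int t" and b: "int b = int (length w) - p - int (length u)"
    using p p' by (simp_all add: a_def b_def)
  have "map (\<lambda>i. C t (int i - int t)) [0..<length w + t] = replicate a s @ u @ replicate b s"
  proof (rule nth_equalityI)
    show "length (map (\<lambda>i. C t (int i - int t)) [0..<length w + t]) =
        length (replicate a s @ u @ replicate b s)"
      using a b by simp
    fix i
    assume "i < length (map (\<lambda>i. C t (int i - int t)) [0..<length w + t])"
    then have i: "i < length w + t" by simp
    then have "map (\<lambda>i. C t (int i - int t)) [0..<length w + t] ! i =
        word_config s p u (int i - int t)"
      using C_t[OF t] by simp
    also have "\<dots> = (replicate a s @ u @ replicate b s) ! i"
    proof (cases "a \<le> i \<and> i < a + length u")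
      case True
      then have "nat (int i - int t - p) = i - a" using a by linarith
      then show ?thesis using True a by (auto simp: word_config_def nth_append)
    next
      case False
      then show ?thesis using a b i by (auto simp: word_config_def nth_append)
    qed
    finally show "map (\<lambda>i. C t (int i - int t)) [0..<length w + t] ! i =
        (replicate a s @ u @ replicate b s) ! i" .
  qed
  then show ?thesis using shifted by auto
qed

text \<open>A bijection \<phi> renames the states to the numbers below \<open>q\<close>, the
  alphabet of the codes. The result survives because renaming commutes with \<open>mealy\<close> and
  \<open>word_value\<close>.\<close>

lemma operation_as_cascade:
  assumes "ca_linear_time_operation r opr"
  obtains q d z0 z1 zs z c and isone :: "nat \<Rightarrow> bool"
  where "2 \<le> q" "cascade q d" "z0 < q" "z1 < q" "zs < q" "z < q"
    and "\<And>Xs t. length Xs = r \<Longrightarrow> c * length (operands_word Xs) \<le> t \<Longrightarrow>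
      word_value z isone ((mealy d z z ^^ t)
        (map (letter z0 z1 zs) (operands_word Xs) @ replicate t z)) = opr Xs"
proof -
  obtain M :: "symbol ca" and f where
    comp: "ca_computes_linear_time M (insert Semicolon (range Bit)) (range Bit) f" and
    domf: "dom f = operands_word ` {Xs. length Xs = r}" and
    f: "\<forall>Xs. length Xs = r \<longrightarrow>
      (\<exists>Y. f (operands_word Xs) = Some (map Bit Y) \<and> binary_value Y = opr Xs)"
    using assms unfolding ca_linear_time_operation_def by (elim exE conjE) (rule that; assumption)
  let ?V = "states M"
  obtain Q qs s c \<pi> where ca: "is_ca M" and \<Sigma>: "insert Semicolon (range Bit) \<subseteq> ?V"
    and Q: "Q \<subseteq> ?V - insert Semicolon (range Bit)" and qs: "qs \<in> Q"
    and s: "s \<in> ?V - (Q \<union> insert Semicolon (range Bit) \<union> range Bit)"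
    and perm: "permanent_right M s" and \<pi>: "\<pi> qs = s"
    and result: "\<forall>w\<in>dom f. \<exists>T k v p. T \<le> c * length w \<and> v \<noteq> [] \<and> set v \<subseteq> Q - {qs} \<and>
           (ca_succ M ^^ T) (word_config s 0 w) = word_config s p (replicate k qs @ v) \<and>
           (\<forall>t<T. \<forall>i. (ca_succ M ^^ t) (word_config s 0 w) i \<notin> Q) \<and>
           f w = Some (map \<pi> v)"
    using comp unfolding ca_computes_linear_time_def by (elim exE conjE) (rule that; simp)
  have fin: "finite ?V" using ca by (simp add: is_ca_def)
  obtain \<phi> where \<phi>: "bij_betw \<phi> ?V {..<card ?V}"
    using ex_bij_betw_finite_nat[OF fin] by (auto simp: atLeast0LessThan)
  define q where "q = card ?V"
  define \<psi> where "\<psi> = inv_into ?V \<phi>"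
  have \<psi>\<phi>: "\<psi> (\<phi> a) = a" if "a \<in> ?V" for a
    using that \<phi> by (simp add: \<psi>_def bij_betw_inv_into_left)
  have \<phi>_less: "\<phi> a < q" if "a \<in> ?V" for a
    using that \<phi> by (auto simp: q_def bij_betw_def)
  have \<psi>_in: "\<psi> x \<in> ?V" if "x < q" for x
    using that \<phi> by (auto simp: q_def \<psi>_def bij_betw_def intro!: inv_into_into)
  have inj: "inj_on \<phi> ?V" using \<phi> by (simp add: bij_betw_def)
  define D where "D = freeze Q (delta M)"
  define d where "d x y z = \<phi> (D (\<psi> x) (\<psi> y) (\<psi> z))" for x y z
  define isone where "isone x = (\<pi> (\<psi> x) = Bit True)" for x
  have D: "D a b c \<in> ?V" if "a \<in> ?V" "b \<in> ?V" "c \<in> ?V" for a b c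
    using that ca by (auto simp: D_def freeze_def is_ca_def)
  have dD: "d (\<phi> a) (\<phi> b) (\<phi> c) = \<phi> (D a b c)" if "a \<in> ?V" "b \<in> ?V" "c \<in> ?V" for a b c
    using that by (simp add: d_def \<psi>\<phi>)
  have sV: "s \<in> ?V" using s by blast
  have bits: "Bit b \<in> ?V" "Semicolon \<in> ?V" for b using \<Sigma> by auto
  \<comment> \<open>Both bits are states, hence \<open>2 <= q\<close>, on which all estimates of
    word counts rest.\<close>
  have "card {Bit False, Bit True} \<le> q"
    unfolding q_def using fin bits by (intro card_mono) auto
  then have q: "2 \<le> q" by simp
  have cas: "cascade q d"
    by standard (auto simp: d_def intro!: \<phi>_less D \<psi>_in)
  have "word_value (\<phi> s) isone ((mealy d (\<phi> s) (\<phi> s) ^^ t)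
      (map (letter (\<phi> (Bit False)) (\<phi> (Bit True)) (\<phi> Semicolon)) (operands_word Xs) @
        replicate t (\<phi> s))) = opr Xs"
    if Xs: "length Xs = r" and t: "c * length (operands_word Xs) \<le> t" for Xs t
  proof -
    let ?w = "operands_word Xs"
    have w: "set ?w \<subseteq> ?V" using set_operands_word \<Sigma> by blast
    have "?w \<in> dom f" using domf Xs by blast
    then obtain T k v p where T: "T \<le> c * length ?w" and v: "v \<noteq> []" "set v \<subseteq> Q - {qs}"
      and run: "(ca_succ M ^^ T) (word_config s 0 ?w) = word_config s p (replicate k qs @ v)"
      and before: "\<forall>t<T. \<forall>i. (ca_succ M ^^ t) (word_config s 0 ?w) i \<notin> Q"
      and fv: "f ?w = Some (map \<pi> v)"
      using bspec[OF result] by blast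
    obtain Y where Y: "map \<pi> v = map Bit Y" "binary_value Y = opr Xs"
      using f[rule_format, OF Xs] fv by auto
    have "\<exists>a b. (mealy D s s ^^ t) (?w @ replicate t s) =
        replicate a s @ (replicate k qs @ v) @ replicate b s"
      unfolding D_def
      using v qs s Q T t before
      by (intro frozen_result[OF ca _ perm _ w _ _ run]) auto
    then obtain a b where ab: "(mealy D s s ^^ t) (?w @ replicate t s) =
        replicate a s @ (replicate k qs @ v) @ replicate b s" by blast
    have "set ((mealy D s s ^^ j) l) \<subseteq> ?V \<and>
        (mealy d (\<phi> s) (\<phi> s) ^^ j) (map \<phi> l) = map \<phi> ((mealy D s s ^^ j) l)"
      if "set l \<subseteq> ?V" for j l
    proof (induction j)
      case (Suc j)
      then show ?case
        using mealy_closed[of ?V D s s "(mealy D s s ^^ j) l"]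
          mealy_map[of ?V d \<phi> D s s "(mealy D s s ^^ j) l"] D dD sV by simp
    qed (use that in simp)
    moreover have "set (?w @ replicate t s) \<subseteq> ?V" using w sV by auto
    ultimately have "(mealy d (\<phi> s) (\<phi> s) ^^ t) (map \<phi> (?w @ replicate t s)) =
        map \<phi> ((mealy D s s ^^ t) (?w @ replicate t s))"
      and V: "set ((mealy D s s ^^ t) (?w @ replicate t s)) \<subseteq> ?V"
      by blast+
    moreover have "map \<phi> ?w = map (letter (\<phi> (Bit False)) (\<phi> (Bit True)) (\<phi> Semicolon)) ?w"
      using set_operands_word[of Xs] by (auto simp: letter_def)
    ultimately have "word_value (\<phi> s) isone ((mealy d (\<phi> s) (\<phi> s) ^^ t)
      (map (letter (\<phi> (Bit False)) (\<phi> (Bit True)) (\<phi> Semicolon)) (operands_word Xs) @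
        replicate t (\<phi> s))) =
        word_value s (\<lambda>a. isone (\<phi> a)) ((mealy D s s ^^ t) (?w @ replicate t s))"
      using word_value_map[OF inj sV V] by simp
    also have "\<dots> = word_value s (\<lambda>a. isone (\<phi> a)) v"
    proof -
      \<comment> \<open>\<pi> sends \<open>qs\<close> to the blank, which is not a bit, so
        \<open>qs\<close> counts as a digit 0.\<close>
      have "\<not> isone (\<phi> qs)"
        using qs Q s \<pi> by (auto simp: isone_def \<psi>\<phi> subset_iff)
      then show ?thesis
        by (simp add: ab word_value_append word_value_replicate count_letters_def)
    qed
    also have "\<dots> = binary_value (map (\<lambda>a. isone (\<phi> a)) v)"
      using v s by (intro word_value_bits) auto
    also have "map (\<lambda>a. isone (\<phi> a)) v = map (\<lambda>a. \<pi> a = Bit True) v"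
      using v Q by (auto simp: isone_def \<psi>\<phi> subset_iff)
    also have "\<dots> = map (\<lambda>x. x = Bit True) (map Bit Y)"
      by (simp flip: Y(1))
    also have "\<dots> = Y" by (simp add: comp_def)
    finally show ?thesis using Y(2) by simp
  qed
  with q cas show thesis
    using \<phi>_less bits sV by (intro that[of q d "\<phi> (Bit False)" "\<phi> (Bit True)" "\<phi> Semicolon" "\<phi> s" c isone]) auto
qed

section \<open>Program fragments\<close>

text \<open>
  Allocation of names by their first component, the second one being an index (a digit position,
  a letter, a word slot) or 0.  Here \<open>B = 2 ^ l\<close>.
    \<^item> 0: operand digits; 2: \<open>N\<close>; 4, 5: loop counters; 6: table of \<open>y \<ge> N\<close>; 7, 8: the base and its
      square; 9--15: \<open>q ^ (3 * l)\<close>, number of words and of states of length below \<open>l\<close>, \<open>B\<close>, \<open>l\<close>,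
      blank word, initial state; 16, 17: numbers of words and states; 18: number of positions
    \<^item> 3, 19--25: marks ending the loops
    \<^item> 26, 27 and 28, 29: remainder and quotient modulo \<open>base N\<close> and modulo \<open>B\<close>; 30, 31: carry, digit sum
    \<^item> 32, 33, 50, 53, 58: numbers in digits; 34: digits in base \<open>B\<close> of \<open>x * base N ^ j\<close>
    \<^item> 35, 36: words spelling \<open>n\<close> in binary: without leading zeros, and in \<open>l\<close> letters at index \<open>B + n\<close>
    \<^item> 37, 38, 39: next state and output of the cascade for one letter; local rule
    \<^item> 43, 44, 45: row addresses, next state and output of the cascade for a word
    \<^item> 48, 49: value and number of letters of a word; 51, 52: row addresses and digits of \<open>v * 2 ^ e\<close>
    \<^item> 55: the words of the configuration; 40--42, 46, 47, 54, 56, 57: scratch variables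
\<close>

lemma run_wp_Seq:
  assumes "wp N X c (\<lambda>s'. run N X c' T s' Q) s"
  shows "run N X (c ;; c') (units c + T) s Q"
  using run_Seq[OF wp_run[OF assms]] .

lemma upd_other [simp]: "k' \<noteq> k \<Longrightarrow> upd s k x v k' = s k'"
  by (simp add: upd_def)

lemma wp_run_units: "wp N X c Q s \<Longrightarrow> units c = T \<Longrightarrow> run N X c T s Q"
  using wp_run by blast

lemma run_Put:
  "fits N X s e \<Longrightarrow> fits N X s e' \<Longrightarrow> run N X c T (upd s k (eval N s e) (eval N s e')) Q \<Longrightarrow>
    run N X (Put k e e' ;; c) (1 + T) s Q"
  using run_wp_Seq[of N X "Put k e e'" c T Q s] by simp

lemma units_seqs [simp]: "units (seqs cs) = sum_list (map units cs)"
  by (induction cs) auto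

primrec mulv :: "nat \<Rightarrow> nm \<Rightarrow> exp" where
  "mulv 0 k = Const 0"
| "mulv (Suc n) k = AddV (mulv n k) k"

lemma eval_mulv [simp]: "eval N s (mulv n k) = n * s k 0"
  by (induction n) auto

lemma fits_mulv [simp]: "fits N X s (mulv n k) \<longleftrightarrow> n * s k 0 \<le> X"
  by (induction n) auto

definition const_digits :: "nat \<Rightarrow> nat \<Rightarrow> nat \<Rightarrow> com" where
  "const_digits a c m = seqs (map (\<lambda>j. (a, j) ::= Const (if j = 0 then c else 0)) [0..<m])"

definition move_digits ::
  "nat \<Rightarrow> nat \<Rightarrow> exp \<Rightarrow> nat \<Rightarrow> nat \<Rightarrow> exp \<Rightarrow> nat \<Rightarrow> com" where
  "move_digits a o1 e1 a' o2 e2 m =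
     seqs (map (\<lambda>j. Put (a, o1 + j) e1 (Idx (a', o2 + j) e2)) [0..<m])"

text \<open>Looking up remainder in \<open>h\<close> and quotient in \<open>h'\<close> replaces the
  comparison of a digit sum with the base. The carry out of the last place is dropped.\<close>

definition add_digits :: "nat \<Rightarrow> nat \<Rightarrow> nat \<Rightarrow> nat \<Rightarrow> nat \<Rightarrow> nat \<Rightarrow> com" where
  "add_digits h h' a y c m = (30, 0) ::= Const c ;; seqs (map (\<lambda>j.
     (31, 0) ::= AddV (AddV (Var (a, j)) (y, j)) (30, 0) ;;
     (a, j) ::= Idx (h, 0) (Var (31, 0)) ;;
     (30, 0) ::= Idx (h', 0) (Var (31, 0))) [0..<m])"

lemma mods_digits [simp]:
  "mods (const_digits a c m) = (if m = 0 then {} else {a})"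
  "mods (move_digits a o1 e1 a' o2 e2 m) = (if m = 0 then {} else {a})"
  "mods (add_digits h h' a y c m) = (if m = 0 then {30} else {a, 30, 31})"
  by (auto simp: const_digits_def move_digits_def add_digits_def)

lemma units_digits [simp]:
  "units (const_digits a c m) = m"
  "units (move_digits a o1 e1 a' o2 e2 m) = m"
  "units (add_digits h h' a y c m) = 3 * m + 1"
  by (auto simp: const_digits_def move_digits_def add_digits_def comp_def sum_list_triv)

text \<open>Nothing is said about places from \<open>m\<close> on, so additions need no overflow
  condition. That the final numbers fit is proved separately, in \<open>operand_less\<close> and
  \<open>two_power_le\<close>.\<close>

definition number :: "store \<Rightarrow> nat \<Rightarrow> nat \<Rightarrow> nat \<Rightarrow> nat \<Rightarrow> bool" where
  "number s a \<beta> m x \<longleftrightarrow> (\<forall>j<m. s (a, j) 0 = dg \<beta> j x)"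

text \<open>The range is \<open>2 * \<beta>\<close> because two digits and a carry of at most 1 stay
  below it.\<close>

definition divmod :: "store \<Rightarrow> nat \<Rightarrow> nat \<Rightarrow> nat \<Rightarrow> bool" where
  "divmod s h h' \<beta> \<longleftrightarrow> (\<forall>v<2 * \<beta>. s (h, 0) v = v mod \<beta> \<and> s (h', 0) v = v div \<beta>)"

lemma number_same: "number s a \<beta> m x \<Longrightarrow> same M s s' \<Longrightarrow> a \<notin> M \<Longrightarrow> number s' a \<beta> m x"
  by (simp add: number_def sameD)

lemma divmod_same: "divmod s h h' \<beta> \<Longrightarrow> same M s s' \<Longrightarrow> h \<notin> M \<Longrightarrow> h' \<notin> M \<Longrightarrow> divmod s' h h' \<beta>"
  by (simp add: divmod_def sameD)

lemma marks_same: "marks s k n \<Longrightarrow> same M s s' \<Longrightarrow> fst k \<notin> M \<Longrightarrow> marks s' k n"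
  by (cases k) (simp add: marks_def sameD)

lemma wp_const_digits:
  assumes "c < \<beta>" "c \<le> X" and "\<And>s'. number s' a \<beta> m c \<Longrightarrow> same {a} s s' \<Longrightarrow> Q s'"
  shows "wp N X (const_digits a c m) Q s"
  unfolding const_digits_def
proof (rule wp_seqs[where I = "\<lambda>j s. \<forall>i<j. s (a, i) 0 = (if i = 0 then c else 0)" and M = "{a}"])
  fix s'
  assume s': "\<forall>i<m. s' (a, i) 0 = (if i = 0 then c else 0)" and "same {a} s s'"
  have "dg \<beta> i c = (if i = 0 then c else 0)" for i
  proof (cases i)
    case (Suc i')
    have "c < \<beta> ^ Suc i'"
      using assms(1) by (metis less_le_trans self_le_power zero_less_Suc gr_zeroI less_one
          linorder_not_less less_zeroE)
    then show ?thesis using Suc by (simp add: dg_def)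
  qed (use assms(1) in \<open>simp add: dg_def\<close>)
  then show "Q s'" using s' assms(3) \<open>same {a} s s'\<close> by (simp add: number_def)
qed (use assms(2) in \<open>auto simp: less_Suc_eq\<close>)

lemma wp_move_digits:
  assumes e1: "\<And>s'. same {a} s s' \<Longrightarrow> eval N s' e1 = v1 \<and> fits N X s' e1"
    and e2: "\<And>s'. same {a} s s' \<Longrightarrow> eval N s' e2 = v2 \<and> fits N X s' e2"
    and "a \<noteq> a'"
    and Q: "\<And>s'. (\<And>j x. s' (a, j) x = (if o1 \<le> j \<and> j < o1 + m \<and> x = v1
      then s (a', o2 + (j - o1)) v2 else s (a, j) x)) \<Longrightarrow> same {a} s s' \<Longrightarrow> Q s'"
  shows "wp N X (move_digits a o1 e1 a' o2 e2 m) Q s"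
  unfolding move_digits_def
proof (rule wp_seqs[where M = "{a}" and I = "\<lambda>i s'. \<forall>j x. s' (a, j) x =
    (if o1 \<le> j \<and> j < o1 + i \<and> x = v1 then s (a', o2 + (j - o1)) v2 else s (a, j) x)"])
  fix j s'
  assume I: "\<forall>i x. s' (a, i) x =
    (if o1 \<le> i \<and> i < o1 + j \<and> x = v1 then s (a', o2 + (i - o1)) v2 else s (a, i) x)"
    and s': "same {a} s s'"
  show "wp N X (Put (a, o1 + j) e1 (Idx (a', o2 + j) e2)) (\<lambda>s'. \<forall>i x. s' (a, i) x =
      (if o1 \<le> i \<and> i < o1 + Suc j \<and> x = v1 then s (a', o2 + (i - o1)) v2 else s (a, i) x)) s'"
    using I e1[OF s'] e2[OF s'] sameD[OF s', of a'] \<open>a \<noteq> a'\<close> by auto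
qed (use Q in auto)

text \<open>The case \<open>y = a\<close> is permitted and gives doubling: place \<open>i\<close> of
  both summands is read before it is overwritten. This is why the invariant speaks of the digits of
  the summands only from place \<open>i\<close> on.\<close>

lemma wp_add_digits:
  assumes x: "number s a \<beta> m x" and y: "number s y \<beta> m x'" and dm: "divmod s h h' \<beta>"
    and \<beta>: "2 \<le> \<beta>" "2 * \<beta> \<le> X" "c \<le> 1"
    and tags: "{a, y, h, h'} \<inter> {30, 31} = {}" "h \<noteq> a" "h' \<noteq> a"
    and Q: "\<And>s'. number s' a \<beta> m (x + x' + c) \<Longrightarrow> same {a, 30, 31} s s' \<Longrightarrow> Q s'"
  shows "wp N X (add_digits h h' a y c m) Q s"
proof -
  let ?s = "upd s (30, 0) 0 c"
  have s: "same {a, 30, 31} s ?s" by simp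
  have "wp N X (seqs (map (\<lambda>j.
     (31, 0) ::= AddV (AddV (Var (a, j)) (y, j)) (30, 0) ;;
     (a, j) ::= Idx (h, 0) (Var (31, 0)) ;;
     (30, 0) ::= Idx (h', 0) (Var (31, 0))) [0..<m])) Q ?s"
  proof (rule wp_seqs[where M = "{a, 30, 31}" and I = "\<lambda>i s. s (30, 0) 0 = carry \<beta> c i x x' \<and>
      (\<forall>j<i. s (a, j) 0 = dg \<beta> j (x + x' + c)) \<and>
      (\<forall>j<m. i \<le> j \<longrightarrow> s (a, j) 0 = dg \<beta> j x \<and> s (y, j) 0 = dg \<beta> j x')"])
    show "?s (30, 0) 0 = carry \<beta> c 0 x x' \<and> (\<forall>j<0. ?s (a, j) 0 = dg \<beta> j (x + x' + c)) \<and>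
      (\<forall>j<m. 0 \<le> j \<longrightarrow> ?s (a, j) 0 = dg \<beta> j x \<and> ?s (y, j) 0 = dg \<beta> j x')"
      using x y tags by (auto simp: number_def)
  next
    fix i s'
    assume i: "i < m" and I: "s' (30, 0) 0 = carry \<beta> c i x x' \<and>
      (\<forall>j<i. s' (a, j) 0 = dg \<beta> j (x + x' + c)) \<and>
      (\<forall>j<m. i \<le> j \<longrightarrow> s' (a, j) 0 = dg \<beta> j x \<and> s' (y, j) 0 = dg \<beta> j x')"
      and s': "same {a, 30, 31} ?s s'"
    let ?v = "dg \<beta> i x + dg \<beta> i x' + carry \<beta> c i x x'"
    have "dg \<beta> i x < \<beta>" "dg \<beta> i x' < \<beta>" "carry \<beta> c i x x' \<le> 1"
      using \<beta> dg_less[of \<beta>] carry_le[of \<beta> c i x x'] by simp_all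
    then have v: "?v < 2 * \<beta>" by linarith
    have "s' (h, 0) ?v = dg \<beta> i (x + x' + c)" "s' (h', 0) ?v = carry \<beta> c (Suc i) x x'"
      using dm v sameD[OF s'] tags \<beta> add_digit[of \<beta> i x x' c] by (auto simp: divmod_def)
    then show "wp N X ((31, 0) ::= AddV (AddV (Var (a, i)) (y, i)) (30, 0) ;;
       (a, i) ::= Idx (h, 0) (Var (31, 0)) ;; (30, 0) ::= Idx (h', 0) (Var (31, 0)))
       (\<lambda>s. s (30, 0) 0 = carry \<beta> c (Suc i) x x' \<and>
      (\<forall>j<Suc i. s (a, j) 0 = dg \<beta> j (x + x' + c)) \<and>
      (\<forall>j<m. Suc i \<le> j \<longrightarrow> s (a, j) 0 = dg \<beta> j x \<and> s (y, j) 0 = dg \<beta> j x')) s'"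
      using I i v \<beta> tags by (auto simp: less_Suc_eq)
  next
    fix s'
    assume "s' (30, 0) 0 = carry \<beta> c m x x' \<and>
      (\<forall>j<m. s' (a, j) 0 = dg \<beta> j (x + x' + c)) \<and>
      (\<forall>j<m. m \<le> j \<longrightarrow> s' (a, j) 0 = dg \<beta> j x \<and> s' (y, j) 0 = dg \<beta> j x')"
      "same {a, 30, 31} ?s s'"
    then show "Q s'" using Q same_trans[OF s] by (simp add: number_def)
  qed auto
  then show ?thesis using \<beta> by (simp add: add_digits_def)
qed

text \<open>A loop up to \<beta> fills a table of length \<open>2 * \<beta>\<close>:
  \<open>x\<close> and \<open>x + \<beta>\<close> have the same remainder, and the quotient is 1 for
  the second while the initial 0 serves the first.\<close>

definition divmod_prog :: "nat \<Rightarrow> nat \<Rightarrow> nat \<Rightarrow> nat \<Rightarrow> com" where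
  "divmod_prog k v h h' = For (k, 0) (4, 0)
     (Put (h, 0) (Var (4, 0)) (Var (4, 0)) ;;
      Put (h, 0) (AddV (Var (4, 0)) (v, 0)) (Var (4, 0)) ;;
      Put (h', 0) (AddV (Var (4, 0)) (v, 0)) (Const 1))"

lemma run_divmod_prog:
  assumes "marks s (k, 0) \<beta>" "s (v, 0) 0 = \<beta>" "s (h', 0) = (\<lambda>_. 0)" "2 * \<beta> \<le> X"
    and "distinct [k, v, h, h', 4]"
  shows "run N X (divmod_prog k v h h') (\<beta> * 5 + 2) s
    (\<lambda>s'. divmod s' h h' \<beta> \<and> same {4, h, h'} s s')"
proof -
  let ?c = "Put (h, 0) (Var (4, 0)) (Var (4, 0)) ;;
      Put (h, 0) (AddV (Var (4, 0)) (v, 0)) (Var (4, 0)) ;;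
      Put (h', 0) (AddV (Var (4, 0)) (v, 0)) (Const 1)"
  let ?I = "\<lambda>x (s :: store). \<forall>y. (y < x \<longrightarrow> s (h, 0) y = y \<and> s (h, 0) (y + \<beta>) = y) \<and>
    s (h', 0) y = of_bool (\<beta> \<le> y \<and> y < \<beta> + x)"
  have "run N X (divmod_prog k v h h') (\<beta> * (3 + 2) + 2) s (?I \<beta>)"
    unfolding divmod_prog_def
  proof (rule run_For[where I = ?I and M = "{4, h, h'}"])
    fix x s'
    assume x: "x < \<beta>" and I: "?I x s'" and i: "s' (4, 0) 0 = x"
      and s': "same {4, h, h'} s s'"
    have v: "s' (v, 0) 0 = \<beta>" using sameD[OF s', of v] assms by auto
    have "wp N X ?c (?I (Suc x)) s'"
      using x i v assms(4,5) I by (auto simp: less_Suc_eq) linarith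
    then show "run N X ?c 3 s' (?I (Suc x))" by (rule wp_run_units) simp
  qed (use assms in \<open>auto simp: sameD\<close>)
  then have "run N X (divmod_prog k v h h') (\<beta> * (3 + 2) + 2) s
      (\<lambda>s'. ?I \<beta> s' \<and> same {4, h, h'} s s')"
    by (rule run_same) (auto simp: divmod_prog_def)
  then show ?thesis
  proof (rule run_mono)
    fix s'
    assume s': "?I \<beta> s' \<and> same {4, h, h'} s s'"
    have "s' (h, 0) u = u mod \<beta> \<and> s' (h', 0) u = u div \<beta>" if "u < 2 * \<beta>" for u
    proof (cases "u < \<beta>")
      case True
      then show ?thesis using s' by simp
    next
      case False
      define w where "w = u - \<beta>"
      have w: "u = w + \<beta>" "w < \<beta>" using False that by (auto simp: w_def)
      then show ?thesis using s' by (auto simp: div_add_self2)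
    qed
    then show "divmod s' h h' \<beta> \<and> same {4, h, h'} s s'" using s' by (simp add: divmod_def)
  qed auto
qed

section \<open>Pre-computation of the parameters\<close>

text \<open>\<open>z0\<close>, \<open>z1\<close>, \<open>zs\<close> stand for the letters 0, 1 and
  \<open>;\<close>, and \<open>z\<close> for the blank. The exponent bounding the operands is called
  \<open>dd\<close>, as \<open>d\<close> is the local rule.\<close>

locale coded_operation = cascade q d for q :: nat and d +
  fixes z0 z1 zs z :: nat and isone :: "nat \<Rightarrow> bool" and r dd c :: nat
  assumes q: "2 \<le> q" and letters: "z0 < q" "z1 < q" "zs < q" "z < q"
begin

text \<open>
  Binary digits are grouped into blocks of \<open>l\<close>, where \<open>N \<le> q ^ (3 * l) \<le> q ^ 3 * N\<close>.
  An operand has \<open>m1\<close> blocks; \<open>kw\<close> words, of length at most \<open>l\<close> each, make up the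
  configuration; \<open>m2\<close> digits suffice for the result.
\<close>

definition m1 :: nat where "m1 = 3 * q * dd"
definition kw0 :: nat where "kw0 = r * (m1 + 1)"
definition kw :: nat where "kw = kw0 + c * kw0"
definition m2 :: nat where "m2 = 3 * kw"

text \<open>Comparison with \<open>N\<close> is all that both searches, for the base and for
  \<open>l\<close>, require. They overshoot \<open>N\<close> by a factor of at most 4 and
  \<open>q ^ 3\<close>, so a table of length \<open>N + q ^ 3 * N\<close> reaches far
  enough.\<close>

definition ge_prog :: com where
  "ge_prog = (2, 0) ::= Size ;; Put (3, 0) (mulv (q ^ 3) (2, 0)) (Const 1) ;;
     For (3, 0) (4, 0) (Put (6, 0) (AddV (Var (4, 0)) (2, 0)) (Const 1))"

text \<open>The square is kept beside the base \<open>b\<close> and updated by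
  \<open>b * b + b + b + 1\<close>.\<close>

definition base_prog :: com where
  "base_prog = (7, 0) ::= Const 2 ;; (8, 0) ::= Const 4 ;;
     Until (Idx (6, 0) (Var (8, 0)))
       ((8, 0) ::= AddC (AddV (AddV (Var (8, 0)) (7, 0)) (7, 0)) 1 ;;
        (7, 0) ::= AddC (Var (7, 0)) 1)"

text \<open>None of these quantities could be computed from \<open>l\<close> afterwards without
  multiplication. Each satisfies a linear recurrence in \<open>l\<close> with constant coefficients,
  so all are carried along.\<close>

definition lengthen :: com where
  "lengthen = (9, 0) ::= mulv (q ^ 3) (9, 0) ;;
     (10, 0) ::= AddC (mulv q (10, 0)) 1 ;;
     (11, 0) ::= AddC (mulv (q * q) (11, 0)) 1 ;;
     (12, 0) ::= mulv 2 (12, 0) ;;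
     (13, 0) ::= AddC (Var (13, 0)) 1 ;;
     (14, 0) ::= AddC (mulv q (14, 0)) (z + 1) ;;
     (15, 0) ::= AddC (mulv (q * q) (15, 0)) (z * q + z + 1)"

lemma units_lengthen: "units lengthen = 7"
  by (simp add: lengthen_def)

text \<open>The step before the loop secures \<open>0 < l\<close>; for \<open>N = 1\<close> the loop
  alone would stop at \<open>l = 0\<close>.\<close>

definition length_prog :: com where
  "length_prog = (9, 0) ::= Const 1 ;; (12, 0) ::= Const 1 ;; lengthen ;;
     Until (Idx (6, 0) (Var (9, 0))) lengthen"

text \<open>The first two lines compute \<open>wcount q (Suc l)\<close> and
  \<open>wcount (q * q) (Suc l)\<close>: tables cover words of length at most \<open>l\<close>,
  whereas loops that append a letter run over the words shorter than \<open>l\<close>.\<close>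

definition size_prog :: com where
  "size_prog = (16, 0) ::= AddC (mulv q (10, 0)) 1 ;;
     (17, 0) ::= AddC (mulv (q * q) (11, 0)) 1 ;;
     (18, 0) ::= AddC (mulv kw (13, 0)) 1 ;;
     Put (19, 0) (Var (7, 0)) (Const 1) ;; Put (20, 0) (Var (12, 0)) (Const 1) ;;
     Put (21, 0) (Var (10, 0)) (Const 1) ;; Put (22, 0) (Var (11, 0)) (Const 1) ;;
     Put (23, 0) (Var (17, 0)) (Const 1) ;; Put (24, 0) (Var (18, 0)) (Const 1) ;;
     Put (25, 0) (Var (16, 0)) (Const 1)"

definition has_length :: "store \<Rightarrow> nat \<Rightarrow> bool" where
  "has_length s l \<longleftrightarrow> s (9, 0) 0 = q ^ (3 * l) \<and> s (10, 0) 0 = wcount q l \<and>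
     s (11, 0) 0 = wcount (q * q) l \<and> s (12, 0) 0 = 2 ^ l \<and> s (13, 0) 0 = l \<and>
     s (14, 0) 0 = enc q (replicate l z) \<and> s (15, 0) 0 = enc (q * q) (replicate l (z * q + z))"

end

text \<open>\<open>X\<close> bounds every value handled by the imperative programs. The factor in
  front of \<open>q ^ 6 * N\<close> makes room for the addresses of products
  \<open>v * 2 ^ e\<close>, estimated in \<open>UE_le\<close>.\<close>

locale coded_operation_run = coded_operation +
  fixes N X :: nat
  assumes N: "0 < N" and X: "(kw + 3) * q ^ 6 * N \<le> X"
begin

lemma X_le: "n \<le> (kw + 3) * (q ^ 6 * N) \<Longrightarrow> n \<le> X"
  using X by (simp add: mult.assoc)

lemma X6: "q ^ 6 * N \<le> X" and X1: "1 \<le> X" and X3: "(q ^ 3 + 1) * N \<le> X"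
proof -
  show *: "q ^ 6 * N \<le> X" by (rule X_le) simp
  have "0 < q ^ 6 * N" using q N by simp
  then show "1 \<le> X" using * by linarith
  have "q ^ 3 + 1 \<le> 2 * q ^ 3" using q by simp
  also have "\<dots> \<le> q ^ 3 * q ^ 3"
    using q self_le_power[of q 3] by (intro mult_le_mono1) auto
  also have "\<dots> = q ^ 6" by (simp flip: power_add)
  finally have "(q ^ 3 + 1) * N \<le> q ^ 6 * N" by (rule mult_le_mono1)
  then show "(q ^ 3 + 1) * N \<le> X" using * by simp
qed

lemma q3: "8 \<le> q ^ 3"
  using power_mono[OF q, of 3] by simp

lemma X9: "9 * N \<le> X"
proof -
  have "9 * N \<le> (q ^ 3 + 1) * N" using q3 by (intro mult_le_mono1) simp
  then show ?thesis using X3 by linarith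
qed

lemma run_ge_prog:
  assumes "s (3, 0) = (\<lambda>_. 0)" "s (6, 0) = (\<lambda>_. 0)"
  shows "run N X ge_prog (q ^ 3 * N * 3 + 4) s (\<lambda>s'. s' (2, 0) 0 = N \<and>
    (\<forall>y < N + q ^ 3 * N. s' (6, 0) y = of_bool (N \<le> y)) \<and> same {2, 3, 4, 6} s s')"
proof -
  let ?n = "q ^ 3 * N"
  have n: "?n + N \<le> X" using X3 by simp
  let ?I = "\<lambda>x (s :: store). s (2, 0) 0 = N \<and> (\<forall>y. s (6, 0) y = of_bool (N \<le> y \<and> y < N + x))"
  let ?s1 = "upd (upd s (2, 0) 0 N) (3, 0) ?n 1"
  have "run N X (For (3, 0) (4, 0) (Put (6, 0) (AddV (Var (4, 0)) (2, 0)) (Const 1)))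
      (?n * (1 + 2) + 2) ?s1 (?I ?n)"
  proof (rule run_For[where I = ?I and M = "{4, 6}"])
    fix x s'
    assume x: "x < ?n" and I: "?I x s'" and i: "s' (4, 0) 0 = x"
    have "wp N X (Put (6, 0) (AddV (Var (4, 0)) (2, 0)) (Const 1)) (?I (Suc x)) s'"
      using x I i n X1 by auto
    then show "run N X (Put (6, 0) (AddV (Var (4, 0)) (2, 0)) (Const 1)) 1 s' (?I (Suc x))"
      by (rule wp_run_units) simp
  qed (use assms n in \<open>auto simp: marks_def\<close>)
  then have "run N X ge_prog (1 + (1 + (?n * (1 + 2) + 2))) s (?I ?n)"
    unfolding ge_prog_def using n X1
    by (intro run_Put) auto
  then have "run N X ge_prog (1 + (1 + (?n * (1 + 2) + 2))) s (\<lambda>s'. ?I ?n s' \<and> same {2, 3, 4, 6} s s')"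
    by (rule run_same) (auto simp: ge_prog_def)
  then show ?thesis by (rule run_mono) auto
qed

lemma run_base_prog:
  assumes ge: "\<And>y. y < N + q ^ 3 * N \<Longrightarrow> s (6, 0) y = of_bool (N \<le> y)"
  shows "run N X base_prog (N * 3 + 3) s (\<lambda>s'. s' (7, 0) 0 = base N \<and> same {7, 8} s s' \<and>
    base N * base N \<le> 4 * N)"
proof -
  let ?I = "\<lambda>s'. \<exists>b. s' (7, 0) 0 = b \<and> s' (8, 0) 0 = b * b \<and> 2 \<le> b \<and>
    (b = 2 \<or> (b - 1) * (b - 1) < N) \<and> same {7, 8} s s'"
  have N8: "N + 8 * N \<le> N + q ^ 3 * N" using q3 by simp
  \<comment> \<open>If \<open>b\<close> is not 2, then \<open>b <= 2 * (b - 1)\<close> and the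
    previous square was below \<open>N\<close>. So all squares tried lie inside the comparison
    table.\<close>
  have b4: "b * b \<le> 4 * N" if "2 \<le> b" "b = 2 \<or> (b - 1) * (b - 1) < N" for b
  proof (cases "b = 2")
    case True
    then show ?thesis using N by simp
  next
    case False
    then have "b * b \<le> (2 * (b - 1)) * (2 * (b - 1))" using that by (intro mult_le_mono) auto
    then show ?thesis using that False by simp
  qed
  have test: "s' (6, 0) (s' (8, 0) 0) = of_bool (N \<le> s' (8, 0) 0)" if I: "?I s'" for s'
  proof -
    from I obtain b where b: "s' (8, 0) 0 = b * b" "2 \<le> b" "b = 2 \<or> (b - 1) * (b - 1) < N"
      "same {7, 8} s s'" by blast
    have "b * b < N + q ^ 3 * N" using b4[OF b(2,3)] N8 N by linarith
    then show ?thesis using ge b sameD[OF b(4), of 6 0] by simp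
  qed
  let ?c = "(8, 0) ::= AddC (AddV (AddV (Var (8, 0)) (7, 0)) (7, 0)) 1 ;;
        (7, 0) ::= AddC (Var (7, 0)) 1"
  have step: "run N X ?c 2 s' (\<lambda>s''. ?I s'' \<and> N - s'' (7, 0) 0 < N - s' (7, 0) 0)"
    if I: "?I s'" and e: "eval N s' (Idx (6, 0) (Var (8, 0))) = 0" for s'
  proof -
    from I obtain b where b: "s' (7, 0) 0 = b" "s' (8, 0) 0 = b * b" "2 \<le> b"
      "same {7, 8} s s'" by blast
    have bN: "b * b < N" using e test[OF I] b by (simp split: if_splits)
    have "b \<le> b * b" by simp
    with bN have bN': "b < N" by linarith
    have "Suc b * Suc b \<le> (2 * b) * (2 * b)" using b(3) by (intro mult_le_mono) auto
    then have "Suc b * Suc b \<le> 4 * N" using bN by simp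
    then have le: "b * b + b + b + 1 \<le> X" using X9 by simp
    have same: "same {7, 8} s (upd (upd s' (8, 0) 0 (b * b + b + b + 1)) (7, 0) 0 (b + 1))"
      by (rule same_trans[OF b(4)]) (simp add: same_def)
    have "wp N X ?c (\<lambda>s''. ?I s'' \<and> N - s'' (7, 0) 0 < N - s' (7, 0) 0) s'"
      using b bN bN' le same by (auto simp: algebra_simps)
    then show ?thesis by (rule wp_run_units) simp
  qed
  let ?s2 = "upd (upd s (7, 0) 0 2) (8, 0) 0 4"
  have "run N X (Until (Idx (6, 0) (Var (8, 0))) ?c) ((N - ?s2 (7, 0) 0) * Suc 2 + 1) ?s2
      (\<lambda>s'. ?I s' \<and> eval N s' (Idx (6, 0) (Var (8, 0))) \<noteq> 0)"
    by (rule run_Until[where \<mu> = "\<lambda>s. N - s (7, 0) 0", OF _ _ step]) (auto simp: same_def)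
  then have "run N X (Until (Idx (6, 0) (Var (8, 0))) ?c) (N * 3 + 1) ?s2
      (\<lambda>s'. s' (7, 0) 0 = base N \<and> same {7, 8} s s' \<and> base N * base N \<le> 4 * N)"
  proof (rule run_mono)
    fix s'
    assume I: "?I s' \<and> eval N s' (Idx (6, 0) (Var (8, 0))) \<noteq> 0"
    then obtain b where b: "s' (7, 0) 0 = b" "s' (8, 0) 0 = b * b" "2 \<le> b"
      "b = 2 \<or> (b - 1) * (b - 1) < N" "same {7, 8} s s'" by blast
    have "N \<le> b * b" using test[OF conjunct1[OF I]] conjunct2[OF I] b(2) by simp
    then have "b = base N" using base_eqI b by blast
    then show "s' (7, 0) 0 = base N \<and> same {7, 8} s s' \<and> base N * base N \<le> 4 * N"
      using b b4 by auto
  qed auto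
  moreover have "4 \<le> X" "2 \<le> X" using X9 N by simp_all
  ultimately have "run N X base_prog (1 + (1 + (N * 3 + 1))) s
      (\<lambda>s'. s' (7, 0) 0 = base N \<and> same {7, 8} s s' \<and> base N * base N \<le> 4 * N)"
    unfolding base_prog_def
    by (intro run_Put) auto
  then show ?thesis by (rule run_mono) auto
qed

text \<open>The exponent leaves room for the codes: a word of length \<open>Suc l\<close> over
  \<open>q * q\<close> letters has a code below \<open>wcount (q * q) (Suc (Suc l))\<close>, hence
  below \<open>q ^ (2 * l + 4)\<close>.\<close>

lemma wp_lengthen:
  assumes l: "has_length s l" and le: "q ^ (3 * l + 6) \<le> X"
  shows "wp N X lengthen (\<lambda>s'. has_length s' (Suc l) \<and> same {9..15} s s') s"
proof -
  have le': "q ^ k \<le> X" if "k \<le> 3 * l + 6" for k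
    using le_trans[OF power_increasing[OF that] le] q by simp
  have qq: "2 \<le> q * q" using q mult_le_mono[OF q q] by simp
  have 1: "q ^ 3 * q ^ (3 * l) \<le> X"
    using le'[of "3 + 3 * l"] by (simp add: power_add)
  have 2: "Suc (q * wcount q l) \<le> X"
    using wcount_le[OF q, of "Suc l"] le'[of "Suc l"] by simp
  have 3: "Suc (q * q * wcount (q * q) l) \<le> X"
    using wcount_le[OF qq, of "Suc l"] le'[of "2 * Suc l"]
    by (simp add: power_mult power2_eq_square)
  have "(2::nat) ^ Suc l \<le> q ^ Suc l" using q by (rule power_mono) simp
  then have 4: "2 * 2 ^ l \<le> X" using le'[of "Suc l"] by simp
  have "Suc l < q ^ Suc l" using less_exp[of "Suc l"] power_mono[OF q, of "Suc l"] by linarith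
  then have 5: "Suc l \<le> X" using le'[of "Suc l"] by simp
  have r1: "enc q (replicate (Suc l) z) = q * enc q (replicate l z) + z + 1"
    using enc_snoc[of q "replicate l z" z] by (simp add: replicate_append_same)
  have "enc q (replicate (Suc l) z) < wcount q (Suc (Suc l))"
    using letters by (intro enc_less_wcount) auto
  also have "\<dots> \<le> X" using wcount_le[OF q, of "Suc (Suc l)"] le'[of "Suc (Suc l)"] by linarith
  finally have 6: "Suc (q * enc q (replicate l z) + z) \<le> X" using r1 by simp
  have r2: "enc (q * q) (replicate (Suc l) (z * q + z)) =
      q * q * enc (q * q) (replicate l (z * q + z)) + (z * q + z) + 1"
    using enc_snoc[of "q * q" "replicate l (z * q + z)" "z * q + z"]
    by (simp add: replicate_append_same)
  have "enc (q * q) (replicate (Suc l) (z * q + z)) < wcount (q * q) (Suc (Suc l))"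
    using letters pair_code_less[of z z] by (intro enc_less_wcount) auto
  also have "\<dots> \<le> (q * q) ^ Suc (Suc l)" by (rule wcount_le[OF qq])
  also have "\<dots> = q ^ (2 * Suc (Suc l))" by (simp add: power_mult power2_eq_square)
  also have "\<dots> \<le> X" by (rule le') simp
  finally have 7: "Suc (q * q * enc (q * q) (replicate l (z * q + z)) + (z * q + z)) \<le> X"
    using r2 by simp
  show ?thesis
    unfolding lengthen_def using l 1 2 3 4 5 6 7 X1 r1 r2
    by (auto simp: has_length_def same_def power_add algebra_simps simp del: replicate.simps)
qed

text \<open>Within the loop \<open>l\<close> grows only while \<open>q ^ (3 * l) < N\<close>, so the
  overshoot is at most one factor \<open>q ^ 3\<close>; the same inequality gives
  \<open>l < N\<close>, which makes \<open>N - l\<close> a variant.\<close>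

lemma run_length_prog:
  assumes ge: "\<And>y. y < N + q ^ 3 * N \<Longrightarrow> s (6, 0) y = of_bool (N \<le> y)"
    and zero: "\<And>h. h \<in> {10, 11, 13, 14, 15} \<Longrightarrow> s (h, 0) 0 = 0"
  shows "run N X length_prog (N * 8 + 10) s (\<lambda>s'. same {9..15} s s' \<and>
    (\<exists>l>0. has_length s' l \<and> N \<le> q ^ (3 * l) \<and> q ^ (3 * l) \<le> q ^ 3 * N))"
proof -
  let ?I = "\<lambda>s'. same {9..15} s s' \<and> (\<exists>l>0. has_length s' l \<and> q ^ (3 * l) \<le> q ^ 3 * N)"
  have test: "eval N s' (Idx (6, 0) (Var (9, 0))) = of_bool (N \<le> q ^ (3 * l))"
    if "same {9..15} s s'" "has_length s' l" "q ^ (3 * l) \<le> q ^ 3 * N" for s' l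
    using that ge[of "q ^ (3 * l)"] sameD[OF that(1), of 6 0] N by (simp add: has_length_def)
  have step: "run N X lengthen 7 s' (\<lambda>s''. ?I s'' \<and> N - s'' (13, 0) 0 < N - s' (13, 0) 0)"
    if I: "?I s'" and e: "eval N s' (Idx (6, 0) (Var (9, 0))) = 0" for s'
  proof -
    from I obtain l where s': "same {9..15} s s'" and l: "0 < l" "has_length s' l"
      "q ^ (3 * l) \<le> q ^ 3 * N" by blast
    have less: "q ^ (3 * l) < N" using e test[OF s' l(2,3)] by (simp split: if_splits)
    have "q ^ l \<le> q ^ (3 * l)" using q by (intro power_increasing) auto
    then have "l < q ^ (3 * l)" using less_exp[of l] power_mono[OF q, of l] by linarith
    then have lN: "l < N" using less by simp
    have "q ^ (3 * l + 6) \<le> q ^ 6 * N" using less by (simp add: power_add)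
    then have "q ^ (3 * l + 6) \<le> X" using X6 by simp
    from wp_lengthen[OF l(2) this]
    have "wp N X lengthen (\<lambda>s''. ?I s'' \<and> N - s'' (13, 0) 0 < N - s' (13, 0) 0) s'"
    proof (rule wp_mono)
      fix s''
      assume s'': "has_length s'' (Suc l) \<and> same {9..15} s' s''"
      have "q ^ (3 * Suc l) \<le> q ^ 3 * N" using less by (simp add: power_add)
      then show "?I s'' \<and> N - s'' (13, 0) 0 < N - s' (13, 0) 0"
        using s'' l lN same_trans[OF s'] by (auto simp: has_length_def)
    qed
    then show ?thesis by (rule wp_run_units) (simp add: lengthen_def)
  qed
  let ?e = "Idx (6, 0) (Var (9, 0))"
  have loop: "run N X (Until ?e lengthen) (N * 8 + 1) s' (\<lambda>s'. same {9..15} s s' \<and>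
    (\<exists>l>0. has_length s' l \<and> N \<le> q ^ (3 * l) \<and> q ^ (3 * l) \<le> q ^ 3 * N))" if "?I s'" for s'
  proof -
    have "run N X (Until ?e lengthen) ((N - s' (13, 0) 0) * Suc 7 + 1) s'
        (\<lambda>s'. ?I s' \<and> eval N s' ?e \<noteq> 0)"
      by (rule run_Until[where \<mu> = "\<lambda>s. N - s (13, 0) 0", OF that _ step]) auto
    then show ?thesis
    proof (rule run_mono)
      fix s'
      assume I: "?I s' \<and> eval N s' ?e \<noteq> 0"
      then obtain l where l: "0 < l" "has_length s' l" "q ^ (3 * l) \<le> q ^ 3 * N" by blast
      have "N \<le> q ^ (3 * l)" using I test[OF _ l(2,3)] by (auto split: if_splits)
      then show "same {9..15} s s' \<and>
          (\<exists>l>0. has_length s' l \<and> N \<le> q ^ (3 * l) \<and> q ^ (3 * l) \<le> q ^ 3 * N)"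
        using I l by blast
    qed auto
  qed
  let ?s2 = "upd (upd s (9, 0) 0 1) (12, 0) 0 1"
  have "has_length ?s2 0" using zero by (simp add: has_length_def)
  moreover have "q ^ (3 * 0 + 6) \<le> X" using X6 N by (simp add: le_trans[OF _ X6])
  ultimately have "wp N X lengthen (\<lambda>s'. has_length s' (Suc 0) \<and> same {9..15} ?s2 s') ?s2"
    by (rule wp_lengthen)
  then have "wp N X lengthen
    (\<lambda>s'. run N X (Until ?e lengthen) (N * 8 + 1) s' (\<lambda>s'. same {9..15} s s' \<and>
    (\<exists>l>0. has_length s' l \<and> N \<le> q ^ (3 * l) \<and> q ^ (3 * l) \<le> q ^ 3 * N))) ?s2"
  proof (rule wp_mono)
    fix s'
    assume s': "has_length s' (Suc 0) \<and> same {9..15} ?s2 s'"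
    have "same {9..15} s ?s2" by (rule same_trans[of _ _ "upd s (9, 0) 0 1"]) simp_all
    then have "?I s'" using s' N same_trans by fastforce
    then show "run N X (Until ?e lengthen) (N * 8 + 1) s' (\<lambda>s'. same {9..15} s s' \<and>
      (\<exists>l>0. has_length s' l \<and> N \<le> q ^ (3 * l) \<and> q ^ (3 * l) \<le> q ^ 3 * N))"
      by (rule loop)
  qed
  from run_wp_Seq[OF this]
  have "run N X (lengthen ;; Until ?e lengthen) (7 + (N * 8 + 1)) ?s2 (\<lambda>s'. same {9..15} s s' \<and>
    (\<exists>l>0. has_length s' l \<and> N \<le> q ^ (3 * l) \<and> q ^ (3 * l) \<le> q ^ 3 * N))"
    by (simp add: units_lengthen)
  then have "run N X length_prog (1 + (1 + (7 + (N * 8 + 1)))) s (\<lambda>s'. same {9..15} s s' \<and>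
    (\<exists>l>0. has_length s' l \<and> N \<le> q ^ (3 * l) \<and> q ^ (3 * l) \<le> q ^ 3 * N))"
    unfolding length_prog_def using X1
    by (intro run_Put) auto
  then show ?thesis by (rule run_mono) auto
qed

end

locale coded_tables = coded_operation_run +
  fixes l :: nat
  assumes l: "0 < l" "N \<le> q ^ (3 * l)" "q ^ (3 * l) \<le> q ^ 3 * N"
    and base4: "base N * base N \<le> 4 * N"
begin

abbreviation b :: nat where "b \<equiv> base N"
abbreviation B :: nat where "B \<equiv> 2 ^ l"
abbreviation U :: nat where "U \<equiv> wcount q (Suc l)"
abbreviation S :: nat where "S \<equiv> wcount (q * q) (Suc l)"
abbreviation E :: nat where "E \<equiv> kw * l + 1"

definition sizes :: "store \<Rightarrow> bool" where
  "sizes s \<longleftrightarrow> has_length s l \<and> s (7, 0) 0 = b \<and> s (16, 0) 0 = U \<and> s (17, 0) 0 = S \<and>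
     s (18, 0) 0 = E \<and> marks s (19, 0) b \<and> marks s (20, 0) B \<and> marks s (21, 0) (wcount q l) \<and>
     marks s (22, 0) (wcount (q * q) l) \<and> marks s (23, 0) S \<and> marks s (24, 0) E \<and> marks s (25, 0) U"

lemma b2: "2 \<le> b"
  by (simp add: base_def)

lemma qq: "2 \<le> q * q"
  using mult_le_mono[OF q q] by simp

text \<open>One factor \<open>q ^ 3\<close> pays for the overshoot of \<open>q ^ (3 * l)\<close>
  over \<open>N\<close>, the other for three more letters.\<close>

lemma q_power_le: "k \<le> 3 * l + 3 \<Longrightarrow> q ^ k \<le> q ^ 6 * N"
proof -
  assume "k \<le> 3 * l + 3"
  then have "q ^ k \<le> q ^ (3 * l + 3)" using q by (intro power_increasing) auto
  also have "\<dots> = q ^ 3 * q ^ (3 * l)" by (simp add: power_add)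
  also have "\<dots> \<le> q ^ 3 * (q ^ 3 * N)" using l(3) by (rule mult_le_mono2)
  also have "\<dots> = q ^ 6 * N" by (simp flip: power_add mult.assoc)
  finally show ?thesis .
qed

lemma U_le: "U \<le> q ^ Suc l" and S_le: "S \<le> q ^ (2 * l + 2)"
  using wcount_le[OF q, of "Suc l"] wcount_le[OF qq, of "Suc l"]
  by (simp_all add: power_add power_mult power2_eq_square)

text \<open>This is the size of the transition table. Its exponents \<open>2 * l + 2\<close> and
  \<open>Suc l\<close> add up to the largest value that \<open>q_power_le\<close> admits.\<close>

lemma SU_le: "S * U \<le> q ^ 6 * N"
proof -
  have "S * U \<le> q ^ (2 * l + 2) * q ^ Suc l" by (intro mult_le_mono S_le U_le)
  also have "\<dots> = q ^ (2 * l + 2 + Suc l)" by (rule power_add[symmetric])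
  also have "\<dots> \<le> q ^ 6 * N" by (rule q_power_le) simp
  finally show ?thesis .
qed

lemma E_le: "E \<le> (kw + 1) * q ^ l"
proof -
  have "l < q ^ l" using less_exp[of l] power_mono[OF q, of l] by linarith
  then have "kw * l + 1 \<le> kw * q ^ l + 1 * q ^ l" by (intro add_mono mult_le_mono) auto
  then show ?thesis by (simp add: algebra_simps)
qed

lemma UE_le: "U * E \<le> (kw + 1) * (q ^ 6 * N)"
proof -
  have "U * E \<le> q ^ Suc l * ((kw + 1) * q ^ l)" by (intro mult_le_mono U_le E_le)
  also have "\<dots> = (kw + 1) * q ^ (Suc l + l)" by (simp add: power_add algebra_simps)
  also have "\<dots> \<le> (kw + 1) * (q ^ 6 * N)" by (intro mult_le_mono q_power_le) auto
  finally show ?thesis .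
qed

lemma B_le: "2 * B \<le> q ^ 6 * N"
proof -
  have "2 * B \<le> q ^ Suc l" using power_mono[OF q, of "Suc l"] by simp
  also have "\<dots> \<le> q ^ 6 * N" by (rule q_power_le) simp
  finally show ?thesis .
qed

lemma b_le: "2 * b \<le> q ^ 6 * N"
proof -
  have "2 * b \<le> b * b" using b2 by simp
  also have "\<dots> \<le> 4 * N" by (rule base4)
  also have "\<dots> \<le> q ^ 6 * N"
  proof (rule mult_le_mono1)
    have "(2::nat) ^ 6 \<le> q ^ 6" using q by (rule power_mono) simp
    then show "4 \<le> q ^ 6" by simp
  qed
  finally show ?thesis .
qed

lemma sizes_le: "U \<le> X" "S \<le> X" "E \<le> X" "b \<le> X" "B \<le> X" "2 * b \<le> X" "2 * B \<le> X" "S * U \<le> X"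
  "U * E \<le> X" "wcount q l \<le> X" "wcount (q * q) l \<le> X"
proof -
  have "1 * U \<le> S * U" "S * 1 \<le> S * U" by (intro mult_le_mono; simp)+
  then show "U \<le> X" "S \<le> X" "S * U \<le> X" using SU_le X6 by linarith+
  have "1 * E \<le> U * E" by (intro mult_le_mono) simp_all
  then have EU: "E \<le> U * E" unfolding mult_1 .
  show UE: "U * E \<le> X"
    by (rule X_le, rule le_trans[OF UE_le]) (intro mult_le_mono1, simp)
  show "E \<le> X" by (rule le_trans[OF EU UE])
  show "2 * b \<le> X" "2 * B \<le> X" using b_le B_le X6 by linarith+
  then show "b \<le> X" "B \<le> X" by linarith+
  have "wcount q l \<le> U" "wcount (q * q) l \<le> S" using q by (simp_all add: le_SucI)
  then show "wcount q l \<le> X" "wcount (q * q) l \<le> X" using \<open>U \<le> X\<close> \<open>S \<le> X\<close> by linarith+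
qed

lemma wp_size_prog:
  assumes "has_length s l" "s (7, 0) 0 = b" "\<And>h. h \<in> {19..25} \<Longrightarrow> s (h, 0) = (\<lambda>_. 0)"
  shows "wp N X size_prog (\<lambda>s'. sizes s' \<and> same {16..25} s s') s"
  using assms(1,2) sizes_le X1 unfolding size_prog_def
  by (auto simp: assms(3) sizes_def has_length_def marks_def same_def)

end

section \<open>Pre-computation of the tables\<close>

context coded_operation
begin

text \<open>Array 33 holds \<open>base N ^ j\<close> and array 32 the running multiple. After
  \<open>base N\<close> rounds the latter is \<open>base N ^ Suc j\<close>, which becomes the
  increment of the next row.\<close>

definition conv_row :: "nat \<Rightarrow> com" where
  "conv_row j = const_digits 32 0 m1 ;;
     For (19, 0) (4, 0)
       (move_digits 34 (j * m1) (Var (4, 0)) 32 0 (Const 0) m1 ;; add_digits 28 29 32 33 0 m1) ;;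
     move_digits 33 0 (Const 0) 32 0 (Const 0) m1"

definition conv_prog :: com where
  "conv_prog = const_digits 33 1 m1 ;; seqs (map conv_row [0..<2 * dd])"

text \<open>Entries \<open>2 * n\<close> and \<open>2 * n + 1\<close> arise from entry
  \<open>n\<close> by appending a letter. In array 35 entry 0 is the empty word when round 0 reads
  it, which makes entry 1 the single letter, and only then becomes the word for zero. In array 36
  entry 1 has to be the empty word, its leading 1 being dropped; round 0 spoils it, so it is cleared
  in every round.\<close>

definition bits_prog :: com where
  "bits_prog = For (20, 0) (4, 0)
     ((40, 0) ::= Idx (35, 0) (Var (4, 0)) ;;
      Put (35, 0) (AddC (mulv 2 (4, 0)) 1) (AddC (mulv q (40, 0)) (z1 + 1)) ;;
      Put (35, 0) (mulv 2 (4, 0)) (AddC (mulv q (40, 0)) (z0 + 1)) ;;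
      (40, 0) ::= Idx (36, 0) (Var (4, 0)) ;;
      Put (36, 0) (AddC (mulv 2 (4, 0)) 1) (AddC (mulv q (40, 0)) (z1 + 1)) ;;
      Put (36, 0) (mulv 2 (4, 0)) (AddC (mulv q (40, 0)) (z0 + 1)) ;;
      Put (36, 0) (Const 1) (Const 0))"

definition delta_prog :: com where
  "delta_prog = seqs (map (\<lambda>p. seqs (map (\<lambda>a.
     Put (39, p) (Const a) (Const (d (p div q) (p mod q) a))) [0..<q])) [0..<q * q])"

text \<open>\<open>p\<close> is the state of a machine placed behind the cascade coded by the
  counter. The new machine reads what that cascade emits, kept in \<open>(41, 0)\<close>.\<close>

definition step_row :: "nat \<Rightarrow> com" where
  "step_row a = Put (37, a) (Const 0) (Const 0) ;; Put (38, a) (Const 0) (Const a) ;;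
     For (22, 0) (4, 0)
       ((40, 0) ::= Idx (37, a) (Var (4, 0)) ;; (41, 0) ::= Idx (38, a) (Var (4, 0)) ;;
        seqs (map (\<lambda>p.
          Put (37, a) (AddC (mulv (q * q) (4, 0)) (p + 1))
            (AddC (AddV (mulv (q * q) (40, 0)) (41, 0)) (p mod q * q + 1)) ;;
          Put (38, a) (AddC (mulv (q * q) (4, 0)) (p + 1)) (Idx (39, p) (Var (41, 0))))
          [0..<q * q]))"

definition step_prog :: com where
  "step_prog = delta_prog ;; seqs (map step_row [0..<q])"

end

section \<open>Correctness of the tables for base conversion and for binary words\<close>

context coded_tables
begin

lemma B2: "2 \<le> B"
  using l(1) by (cases l) simp_all

definition conv_ok :: "store \<Rightarrow> nat \<Rightarrow> bool" where
  "conv_ok s j \<longleftrightarrow> (\<forall>i<m1. \<forall>x<b. s (34, j * m1 + i) x = dg B i (x * b ^ j))"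

text \<open>All rows live in arrays with first component 34, so \<open>same\<close> cannot tell them
  apart; the last conjunct is the frame for the other rows.\<close>

lemma run_conv_row:
  assumes pw: "number s 33 B m1 (b ^ j)" and dm: "divmod s 28 29 B" and st: "marks s (19, 0) b"
  shows "run N X (conv_row j) (b * (4 * m1 + 3) + 2 * m1 + 2) s
    (\<lambda>s'. number s' 33 B m1 (b ^ Suc j) \<and> conv_ok s' j \<and>
    (\<forall>k x. \<not> (j * m1 \<le> k \<and> k < j * m1 + m1) \<longrightarrow> s' (34, k) x = s (34, k) x))"
proof -
  let ?c = "move_digits 34 (j * m1) (Var (4, 0)) 32 0 (Const 0) m1 ;; add_digits 28 29 32 33 0 m1"
  let ?I = "\<lambda>x (s' :: store). number s' 32 B m1 (x * b ^ j) \<and>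
    (\<forall>i<m1. \<forall>y<x. s' (34, j * m1 + i) y = dg B i (y * b ^ j)) \<and>
    (\<forall>k x. \<not> (j * m1 \<le> k \<and> k < j * m1 + m1) \<longrightarrow> s' (34, k) x = s (34, k) x)"
  have step: "run N X ?c (4 * m1 + 1) s' (?I (Suc x))"
    if x: "x < b" and I: "?I x s'" and i: "s' (4, 0) 0 = x" and s': "same {4, 30, 31, 32, 34} s s'"
    for x s'
  proof (rule wp_run_units)
    show "wp N X ?c (?I (Suc x)) s'"
      unfolding wp.simps
    proof (rule wp_move_digits[where ?v1.0 = x and ?v2.0 = 0])
      fix s2
      assume s2: "\<And>k y. s2 (34, k) y = (if j * m1 \<le> k \<and> k < j * m1 + m1 \<and> y = x
        then s' (32, 0 + (k - j * m1)) 0 else s' (34, k) y)" "same {34} s' s2"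
      have "number s2 32 B m1 (x * b ^ j)" using I number_same[OF _ s2(2)] by simp
      moreover have "number s2 33 B m1 (b ^ j)"
        using number_same[OF pw s'] number_same[OF _ s2(2)] by simp
      moreover have "divmod s2 28 29 B"
        using divmod_same[OF dm s'] divmod_same[OF _ s2(2)] by simp
      ultimately show "wp N X (add_digits 28 29 32 33 0 m1) (?I (Suc x)) s2"
        using B2 sizes_le(7)
      proof (rule wp_add_digits)
        fix s3
        assume s3: "number s3 32 B m1 (x * b ^ j + b ^ j + 0)" "same {32, 30, 31} s2 s3"
        have e: "s3 (34, k) = s2 (34, k)" for k using sameD[OF s3(2)] by simp
        have "s2 (34, j * m1 + i) x = dg B i (x * b ^ j)" if "i < m1" for i
          using that s2(1) I by (simp add: number_def)
        then show "?I (Suc x) s3"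
          using s3(1) I by (auto simp: e s2(1) add.commute less_Suc_eq)
      qed simp_all
    next
      fix s2
      assume "same {34} s' s2"
      then show "eval N s2 (Var (4, 0)) = x \<and> fits N X s2 (Var (4, 0))"
        using i sameD[of "{34}" s' s2 4 0] by simp
    qed auto
  qed simp
  have loop: "run N X (For (19, 0) (4, 0) ?c) (b * (4 * m1 + 1 + 2) + 2) s1 (?I b)"
    if s1: "number s1 32 B m1 0" "same {32} s s1" for s1
  proof (rule run_For[where I = ?I and M = "{4, 30, 31, 32, 34}"])
    show "marks s1 (19, 0) b" using marks_same[OF st s1(2)] by simp
    show "?I 0 s1" using s1 sameD[OF s1(2)] by simp
  next
    fix x s'
    assume "same {4, 30, 31, 32, 34} s1 s'"
    moreover have "same {4, 30, 31, 32, 34} s s1" by (rule same_mono[OF s1(2)]) simp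
    ultimately have "same {4, 30, 31, 32, 34} s s'" using same_trans by blast
    moreover assume "x < b" "?I x s'" "s' (4, 0) 0 = x"
    ultimately show "run N X ?c (4 * m1 + 1) s' (?I (Suc x))" by (intro step)
  qed (use sizes_le(4) in \<open>auto simp: number_def\<close>)
  have copy: "run N X (move_digits 33 0 (Const 0) 32 0 (Const 0) m1) m1 s2
    (\<lambda>s'. number s' 33 B m1 (b ^ Suc j) \<and> conv_ok s' j \<and>
      (\<forall>k x. \<not> (j * m1 \<le> k \<and> k < j * m1 + m1) \<longrightarrow> s' (34, k) x = s (34, k) x))"
    if s2: "?I b s2" for s2
  proof (rule wp_run_units, rule wp_move_digits[where ?v1.0 = 0 and ?v2.0 = 0])
    fix s3
    assume s3: "\<And>k y. s3 (33, k) y = (if 0 \<le> k \<and> k < 0 + m1 \<and> y = 0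
        then s2 (32, 0 + (k - 0)) 0 else s2 (33, k) y)" "same {33} s2 s3"
    have "s3 (34, k) = s2 (34, k)" for k using sameD[OF s3(2)] by simp
    then show "number s3 33 B m1 (b ^ Suc j) \<and> conv_ok s3 j \<and>
        (\<forall>k x. \<not> (j * m1 \<le> k \<and> k < j * m1 + m1) \<longrightarrow> s3 (34, k) x = s (34, k) x)"
      using s2 by (simp add: conv_ok_def number_def s3(1))
  qed auto
  have "run N X (conv_row j) (m1 + (b * (4 * m1 + 1 + 2) + 2 + m1)) s
    (\<lambda>s'. number s' 33 B m1 (b ^ Suc j) \<and> conv_ok s' j \<and>
    (\<forall>k x. \<not> (j * m1 \<le> k \<and> k < j * m1 + m1) \<longrightarrow> s' (34, k) x = s (34, k) x))"
    unfolding conv_row_def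
  proof (rule run_SeqI[OF wp_run_units])
    show "wp N X (const_digits 32 0 m1) (\<lambda>s1. number s1 32 B m1 0 \<and> same {32} s s1) s"
      by (rule wp_const_digits) auto
  next
    fix s1
    assume "number s1 32 B m1 0 \<and> same {32} s s1"
    then show "run N X (For (19, 0) (4, 0) ?c ;; move_digits 33 0 (Const 0) 32 0 (Const 0) m1)
      (b * (4 * m1 + 1 + 2) + 2 + m1) s1 (\<lambda>s'. number s' 33 B m1 (b ^ Suc j) \<and> conv_ok s' j \<and>
      (\<forall>k x. \<not> (j * m1 \<le> k \<and> k < j * m1 + m1) \<longrightarrow> s' (34, k) x = s (34, k) x))"
      by (intro run_SeqI[OF loop copy]) auto
  qed simp
  then show ?thesis by (rule run_mono) (auto simp: algebra_simps)
qed

lemma run_conv_prog: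
  assumes dm: "divmod s 28 29 B" and st: "marks s (19, 0) b"
  shows "run N X conv_prog (m1 + 2 * dd * (b * (4 * m1 + 3) + 2 * m1 + 2)) s
    (\<lambda>s'. \<forall>j<2 * dd. conv_ok s' j)"
  unfolding conv_prog_def
proof (rule run_SeqI[OF wp_run_units])
  show "wp N X (const_digits 33 1 m1) (\<lambda>s1. number s1 33 B m1 1 \<and> same {33} s s1) s"
    using B2 X1 by (intro wp_const_digits) auto
  fix s1
  assume s1: "number s1 33 B m1 1 \<and> same {33} s s1"
  let ?I = "\<lambda>j s'. number s' 33 B m1 (b ^ j) \<and> (\<forall>j'<j. conv_ok s' j')"
  have "run N X (seqs (map conv_row [0..<2 * dd])) (2 * dd * (b * (4 * m1 + 3) + 2 * m1 + 2)) s1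
      (?I (2 * dd))"
  proof (rule run_seqs[where I = ?I and M = "{4, 30, 31, 32, 33, 34}"])
    fix j s'
    assume I: "?I j s'" and s': "same {4, 30, 31, 32, 33, 34} s1 s'"
    have "divmod s' 28 29 B" "marks s' (19, 0) b"
      using divmod_same[OF dm] marks_same[OF st] divmod_same[OF _ s'] marks_same[OF _ s'] s1 by auto
    from run_conv_row[OF conjunct1[OF I] this]
    show "run N X (conv_row j) (b * (4 * m1 + 3) + 2 * m1 + 2) s' (?I (Suc j))"
    proof (rule run_mono)
      fix s2
      assume s2: "number s2 33 B m1 (b ^ Suc j) \<and> conv_ok s2 j \<and>
        (\<forall>k x. \<not> (j * m1 \<le> k \<and> k < j * m1 + m1) \<longrightarrow> s2 (34, k) x = s' (34, k) x)"
      have "conv_ok s2 j'" if "j' < j" for j'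
      proof -
        have "Suc j' * m1 \<le> j * m1" using that by (intro mult_le_mono1) simp
        then have "\<not> j * m1 \<le> j' * m1 + i" if "i < m1" for i using that by simp
        then show ?thesis using I s2 that by (simp add: conv_ok_def)
      qed
      then show "?I (Suc j) s2" using s2 by (auto simp: less_Suc_eq)
    qed simp
  next
    fix j
    show "mods (conv_row j) \<subseteq> {4, 30, 31, 32, 33, 34}" by (auto simp: conv_row_def)
  qed (use s1 in simp)
  then show "run N X (seqs (map conv_row [0..<2 * dd])) (2 * dd * (b * (4 * m1 + 3) + 2 * m1 + 2)) s1
      (\<lambda>s'. \<forall>j<2 * dd. conv_ok s' j)"
    by (rule run_mono) auto
qed simp

lemma mods_conv_prog: "mods conv_prog \<subseteq> {4, 30, 31, 32, 33, 34}"
  by (auto simp: conv_prog_def conv_row_def)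

abbreviation zb :: "bool \<Rightarrow> nat" where "zb x \<equiv> if x then z1 else z0"

definition bits_ok :: "store \<Rightarrow> bool" where
  "bits_ok s \<longleftrightarrow> (\<forall>n<B. s (35, 0) n = enc q (map zb (binary n)) \<and>
     s (36, 0) (B + n) = enc q (map zb (tl (binary (B + n)))))"

lemma enc_le_X: "set w \<subseteq> {..<q} \<Longrightarrow> length w \<le> Suc l \<Longrightarrow> enc q w \<le> X"
proof -
  assume "set w \<subseteq> {..<q}" "length w \<le> Suc l"
  then have "enc q w < wcount q (Suc (Suc l))" using q by (intro enc_less_wcount) auto
  also have "\<dots> \<le> q ^ Suc (Suc l)" by (rule wcount_le[OF q])
  also have "\<dots> \<le> q ^ 6 * N" by (rule q_power_le) (use l in simp)
  finally show ?thesis using X6 by simp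
qed

lemma run_bits_prog:
  assumes zero: "s (35, 0) 0 = 0" "s (36, 0) 0 = 0" "s (36, 0) 1 = 0" and st: "marks s (20, 0) B"
  shows "run N X bits_prog (B * 9 + 2) s bits_ok"
proof -
  have [simp]: "set (map zb w) \<subseteq> {..<q}" for w using letters by auto
  \<comment> \<open>Index 0 stands apart: it changes from the empty word to the word for zero during
    the first round. Index 1 of array 36 stays the empty word throughout.\<close>
  let ?I = "\<lambda>x (s :: store). s (35, 0) 0 = (if x = 0 then 0 else enc q (map zb (binary 0))) \<and>
    s (36, 0) 1 = 0 \<and> (x = 0 \<longrightarrow> s (36, 0) 0 = 0) \<and>
    (\<forall>n. 0 < n \<and> n < 2 * x \<longrightarrow> s (35, 0) n = enc q (map zb (binary n)) \<and>
      s (36, 0) n = enc q (map zb (tl (binary n))))"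
  have "run N X bits_prog (B * (7 + 2) + 2) s (?I B)"
    unfolding bits_prog_def
  proof (rule run_For[where I = ?I and M = "{4, 35, 36, 40}"], rule st, rule sizes_le,
      goal_cases I0 step)
    case (step x s')
    then have x: "x < B" and I: "?I x s'" and i: "s' (4, 0) 0 = x" by blast+
    let ?t = "s' (35, 0) x" and ?u = "s' (36, 0) x"
    have len: "length (binary x) \<le> l" by (rule length_binary[OF x l(1)])
    have pos: "?t = enc q (map zb (binary x)) \<and> ?u = enc q (map zb (tl (binary x)))" if "0 < x"
      using I that by simp
    have bin: "enc q (map zb (binary (2 * x + of_bool c))) = q * ?t + zb c + 1" for c
    proof (cases "x = 0")
      case True
      then show ?thesis using I by (cases c) (auto simp: binary_0 binary_1 enc_def)
    next
      case False
      then show ?thesis using pos by (simp add: binary_double del: of_bool_eq_iff)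
    qed
    have tlb: "enc q (map zb (tl (binary (2 * x + of_bool c)))) = q * ?u + zb c + 1" if "0 < x" for c
      using that pos by (simp add: binary_double)
    have lx: "length (binary (2 * x + of_bool c)) \<le> Suc l" for c
      by (rule length_binary) (use x in \<open>cases c; simp\<close>, simp)
    have b1: "q * ?t + zb c + 1 \<le> X" for c
      unfolding bin[symmetric] using lx letters by (intro enc_le_X) auto
    have b2: "q * ?u + zb c + 1 \<le> X" for c
    proof (cases "x = 0")
      case True
      then show ?thesis using I b1[of c] by simp
    next
      case False
      then show ?thesis
        using lx[of c] letters by (subst tlb[symmetric]) (auto intro!: enc_le_X)
    qed
    have x2: "2 * x + 1 \<le> X" using x sizes_le(7) by linarith
    show ?case
    proof (rule wp_run_units, goal_cases)
      case 1
      have 2: "n < 2 * Suc x \<longleftrightarrow> n < 2 * x \<or> n = 2 * x \<or> n = 2 * x + 1" for n by auto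
      show ?case
        unfolding 2
        using i I x2 X1 b1[of True] b1[of False] b2[of True] b2[of False] bin[of True] bin[of False]
          tlb[of True] tlb[of False] binary_0 binary_1
        by (cases "x = 0") auto
    qed simp
  qed (use zero in auto)
  then show ?thesis
  proof (rule run_mono)
    fix s'
    assume I: "?I B s'"
    have "s' (35, 0) n = enc q (map zb (binary n))" if "n < B" for n
      using I that by (cases "n = 0") auto
    then show "bits_ok s'" using I by (simp add: bits_ok_def)
  qed simp
qed

end

section \<open>Transition tables of the cascade\<close>

context coded_operation
begin

text \<open>Appending the letters in order to the words with codes 0, 1, 2 and so on yields the
  codes 1, 2, 3 and so on without gaps. The target address \<open>(46, 0)\<close> therefore just
  advances by 1.\<close>

definition trans_row :: com where
  "trans_row = (46, 0) ::= Var (42, 0) ;;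
     For (21, 0) (5, 0)
       ((40, 0) ::= Idx (44, 0) (AddV (Var (42, 0)) (5, 0)) ;;
        (41, 0) ::= Idx (45, 0) (AddV (Var (42, 0)) (5, 0)) ;;
        seqs (map (\<lambda>a.
          (46, 0) ::= AddC (Var (46, 0)) 1 ;;
          (47, 0) ::= Idx (38, a) (Var (40, 0)) ;;
          Put (44, 0) (Var (46, 0)) (Idx (37, a) (Var (40, 0))) ;;
          Put (45, 0) (Var (46, 0)) (AddC (AddV (mulv q (41, 0)) (47, 0)) 1)) [0..<q]))"

text \<open>The starts of the rows, multiples of the row length, are accumulated in
  \<open>(42, 0)\<close> and recorded in array 43, as the operation cannot multiply. A row opens
  with the empty word, which leaves the state unchanged and has empty output.\<close>

definition trans_prog :: com where
  "trans_prog = (42, 0) ::= Const 0 ;;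
     For (23, 0) (4, 0)
      (Put (43, 0) (Var (4, 0)) (Var (42, 0)) ;; Put (44, 0) (Var (42, 0)) (Var (4, 0)) ;;
       Put (45, 0) (Var (42, 0)) (Const 0) ;; trans_row ;; (42, 0) ::= AddV (Var (42, 0)) (16, 0))"

end

context coded_tables
begin

lemma wp_delta_prog:
  "wp N X delta_prog (\<lambda>s'. \<forall>p<q * q. \<forall>a<q. s' (39, p) a = d (p div q) (p mod q) a) s"
  unfolding delta_prog_def
proof (rule wp_seqs[where M = "{39}" and I = "\<lambda>i (s' :: store). \<forall>p<i. \<forall>a<q. s' (39, p) a = d (p div q) (p mod q) a"])
  fix p and s' :: store
  assume p: "p < q * q" and I: "\<forall>p'<p. \<forall>a<q. s' (39, p') a = d (p' div q) (p' mod q) a"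
  have "q ^ 1 \<le> q ^ 6 * N" by (rule q_power_le) simp
  then have qX: "q \<le> X" using X6 by simp
  show "wp N X (seqs (map (\<lambda>a. Put (39, p) (Const a) (Const (d (p div q) (p mod q) a))) [0..<q]))
    (\<lambda>s'. \<forall>p'<Suc p. \<forall>a<q. s' (39, p') a = d (p' div q) (p' mod q) a) s'"
  proof (rule wp_seqs[where M = "{39}" and I = "\<lambda>i s'. (\<forall>p'<p. \<forall>a<q. s' (39, p') a = d (p' div q) (p' mod q) a) \<and>
      (\<forall>a<i. s' (39, p) a = d (p div q) (p mod q) a)"])
    fix a and s'' :: store
    assume a: "a < q" and "(\<forall>p'<p. \<forall>a<q. s'' (39, p') a = d (p' div q) (p' mod q) a) \<and>
      (\<forall>a'<a. s'' (39, p) a' = d (p div q) (p mod q) a')"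
    moreover have "d (p div q) (p mod q) a < q" using a pair_less[OF p] by (simp add: d_less)
    ultimately show "wp N X (Put (39, p) (Const a) (Const (d (p div q) (p mod q) a))) (\<lambda>s'.
        (\<forall>p'<p. \<forall>a<q. s' (39, p') a = d (p' div q) (p' mod q) a) \<and>
        (\<forall>a'<Suc a. s' (39, p) a' = d (p div q) (p mod q) a')) s''"
      using a qX by (auto simp: less_Suc_eq)
  qed (use I in \<open>auto simp: less_Suc_eq\<close>)
qed auto

abbreviation step_state :: "nat \<Rightarrow> nat \<Rightarrow> nat" where
  "step_state a n \<equiv> enc (q * q) (st (dec (q * q) n) a)"

abbreviation step_out :: "nat \<Rightarrow> nat \<Rightarrow> nat" where
  "step_out a n \<equiv> out (dec (q * q) n) a"

definition step_ok :: "store \<Rightarrow> nat \<Rightarrow> nat \<Rightarrow> bool" where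
  "step_ok s a x \<longleftrightarrow> (\<forall>n<x. s (37, a) n = step_state a n \<and> s (38, a) n = step_out a n)"

lemma qq_pos: "0 < q * q" and q_pos: "0 < q"
  using q by simp_all

lemma step_state_snoc:
  "p < q * q \<Longrightarrow> step_state a (Suc (q * q * n + p)) =
    q * q * step_state a n + (p mod q * q + step_out a n) + 1"
  "p < q * q \<Longrightarrow> step_out a (Suc (q * q * n + p)) = d (p div q) (p mod q) (step_out a n)"
  by (simp_all add: st_snoc out_snoc)

lemma step_out_less: "a < q \<Longrightarrow> step_out a n < q"
  using set_dec[OF qq_pos] by (intro out_less)

lemma enc_state_less:
  "set w \<subseteq> {..<q * q} \<Longrightarrow> length w \<le> l \<Longrightarrow> enc (q * q) w < S"
  using qq_pos by (intro enc_less_wcount) auto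

lemma step_state_less: "a < q \<Longrightarrow> n < S \<Longrightarrow> step_state a n < S"
  using less_wcount[OF qq_pos, of n "Suc l"] set_st[OF set_dec[OF qq_pos]]
  by (intro enc_state_less) auto

lemma run_step_row:
  assumes a: "a < q" and st: "marks s (22, 0) (wcount (q * q) l)"
    and delta: "\<forall>p<q * q. \<forall>a<q. s (39, p) a = d (p div q) (p mod q) a"
  shows "run N X (step_row a) (S * (2 * (q * q) + 4) + 4) s (\<lambda>s'. step_ok s' a S \<and>
    (\<forall>a'. a' \<noteq> a \<longrightarrow> s' (37, a') = s (37, a') \<and> s' (38, a') = s (38, a')))"
proof -
  let ?S = "wcount (q * q) l"
  let ?p = "\<lambda>p. Put (37, a) (AddC (mulv (q * q) (4, 0)) (p + 1))
            (AddC (AddV (mulv (q * q) (40, 0)) (41, 0)) (p mod q * q + 1)) ;;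
          Put (38, a) (AddC (mulv (q * q) (4, 0)) (p + 1)) (Idx (39, p) (Var (41, 0)))"
  let ?c = "(40, 0) ::= Idx (37, a) (Var (4, 0)) ;; (41, 0) ::= Idx (38, a) (Var (4, 0)) ;;
        seqs (map ?p [0..<q * q])"
  let ?F = "\<lambda>s'. \<forall>a'. a' \<noteq> a \<longrightarrow> s' (37, a') = s (37, a') \<and> s' (38, a') = s (38, a')"
  \<comment> \<open>After \<open>x\<close> rounds the codes covered are 0 and all one-letter
    extensions of codes below \<open>x\<close>, altogether \<open>q * q * x + 1\<close> consecutive
    ones.\<close>
  let ?I = "\<lambda>x s'. step_ok s' a (q * q * x + 1) \<and> ?F s'"
  let ?M = "{4, 37, 38, 40, 41}"
  have step: "run N X ?c (2 * (q * q) + 2) s' (?I (Suc x))"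
    if x: "x < ?S" and I: "?I x s'" and i: "s' (4, 0) 0 = x" and s': "same ?M s s'" for x s'
  proof (rule wp_run_units)
    have le: "q * q * x + 1 + p \<le> X" if "p < q * q" for p
    proof -
      have "q * q * Suc x \<le> q * q * ?S" using x by (intro mult_le_mono2) simp
      then show ?thesis using that sizes_le(2) by simp
    qed
    \<comment> \<open>The word to be extended was entered in an earlier round, because extending
      increases the code.\<close>
    have "1 * x \<le> q * q * x" using qq_pos by (intro mult_le_mono1) simp
    then have "x < q * q * x + 1" by linarith
    then have now: "s' (37, a) x = step_state a x" "s' (38, a) x = step_out a x"
      using I by (simp_all add: step_ok_def)
    let ?s2 = "upd (upd s' (40, 0) 0 (step_state a x)) (41, 0) 0 (step_out a x)"
    have "wp N X (seqs (map ?p [0..<q * q])) (?I (Suc x)) ?s2"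
    proof (rule wp_seqs[where M = "{37, 38}" and I = "\<lambda>p s'. step_ok s' a (q * q * x + 1 + p) \<and> ?F s'"])
      show "step_ok ?s2 a (q * q * x + 1 + 0) \<and> ?F ?s2" using I by (simp add: step_ok_def)
    next
      fix p s3
      assume p: "p < q * q" and J: "step_ok s3 a (q * q * x + 1 + p) \<and> ?F s3"
        and s3: "same {37, 38} ?s2 s3"
      let ?n = "Suc (q * q * x + p)"
      have v: "s3 (4, 0) 0 = x" "s3 (40, 0) 0 = step_state a x" "s3 (41, 0) 0 = step_out a x"
        using sameD[OF s3] i by simp_all
      have "s3 (39, p) (step_out a x) = s (39, p) (step_out a x)"
        using sameD[OF s3] sameD[OF s'] by simp
      also have "\<dots> = step_out a ?n"
        unfolding step_state_snoc(2)[OF p] using delta p step_out_less[OF a] by blast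
      finally have v': "s3 (39, p) (step_out a x) = step_out a ?n" .
      have n: "?n \<le> X" using le[OF p] by simp
      have "q * q * Suc x \<le> q * q * ?S" using x by (intro mult_le_mono2) simp
      then have "?n < S" using p by simp
      then have "step_state a ?n \<le> X"
        using step_state_less[OF a] sizes_le(2) by (meson le_trans less_imp_le)
      then have n': "q * q * step_state a x + (p mod q * q + step_out a x) + 1 \<le> X"
        using step_state_snoc(1)[OF p] by simp
      have e: "q * q * step_state a x + step_out a x + (p mod q * q + 1) = step_state a ?n"
        using step_state_snoc(1)[OF p, of x a] by simp
      show "wp N X (?p p) (\<lambda>s'. step_ok s' a (q * q * x + 1 + Suc p) \<and> ?F s') s3"
        using v v' n n' e J by (auto simp: step_ok_def less_Suc_eq)
    next
      fix s3
      assume "step_ok s3 a (q * q * x + 1 + q * q) \<and> ?F s3"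
      then show "?I (Suc x) s3" by (simp add: algebra_simps)
    qed auto
    then show "wp N X ?c (?I (Suc x)) s'" using i now by simp
  qed (simp add: comp_def sum_list_triv)
  let ?s2 = "upd (upd s (37, a) 0 0) (38, a) 0 a"
  have "run N X (For (22, 0) (4, 0) ?c) (?S * (2 * (q * q) + 2 + 2) + 2) ?s2 (?I ?S)"
  proof (rule run_For[where I = ?I and M = ?M])
    show "marks ?s2 (22, 0) ?S" using st by (simp add: marks_def)
    show "?I 0 ?s2" by (simp add: step_ok_def enc_def)
    fix x s'
    assume "same ?M ?s2 s'"
    moreover have "same ?M s ?s2" by (rule same_trans[of _ _ "upd s (37, a) 0 0"]) simp_all
    ultimately have "same ?M s s'" using same_trans by blast
    moreover assume "x < ?S" "?I x s'" "s' (4, 0) 0 = x"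
    ultimately show "run N X ?c (2 * (q * q) + 2) s' (?I (Suc x))" by (intro step)
  qed (use sizes_le in \<open>auto simp: step_ok_def\<close>)
  moreover have "a \<le> X"
    using a q_power_le[of 1] X6 by simp
  ultimately have "run N X (step_row a) (1 + (1 + (?S * (2 * (q * q) + 2 + 2) + 2))) s (?I ?S)"
    unfolding step_row_def by (intro run_Put) auto
  then show ?thesis
  proof (rule run_mono)
    have "?S \<le> S" using q by (simp add: le_SucI)
    then show "1 + (1 + (?S * (2 * (q * q) + 2 + 2) + 2)) \<le> S * (2 * (q * q) + 4) + 4"
      using mult_le_mono1[of ?S S "2 * (q * q) + 2 + 2"]
      by (simp del: wcount.simps add: algebra_simps)
  qed simp
qed

lemma run_step_prog:
  assumes st: "marks s (22, 0) (wcount (q * q) l)"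
  shows "run N X step_prog (q * q * q + q * (S * (2 * (q * q) + 4) + 4)) s
    (\<lambda>s'. \<forall>a<q. step_ok s' a S)"
  unfolding step_prog_def
proof (rule run_SeqI[OF wp_run_units])
  show "wp N X delta_prog (\<lambda>s'. (\<forall>p<q * q. \<forall>a<q. s' (39, p) a = d (p div q) (p mod q) a) \<and>
      same {39} s s') s"
    by (rule wp_same[OF wp_delta_prog]) (auto simp: delta_prog_def)
  show "units delta_prog = q * q * q"
    by (simp add: delta_prog_def comp_def sum_list_triv)
  fix s1
  assume s1: "(\<forall>p<q * q. \<forall>a<q. s1 (39, p) a = d (p div q) (p mod q) a) \<and> same {39} s s1"
  let ?I = "\<lambda>i s'. \<forall>a<i. step_ok s' a S"
  show "run N X (seqs (map step_row [0..<q])) (q * (S * (2 * (q * q) + 4) + 4)) s1 (?I q)"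
  proof (rule run_seqs[where I = ?I and M = "{4, 37, 38, 40, 41}"])
    fix a s'
    assume a: "a < q" and I: "?I a s'" and s': "same {4, 37, 38, 40, 41} s1 s'"
    have "marks s' (22, 0) (wcount (q * q) l)"
      using s1 marks_same[OF st] marks_same[OF _ s'] by auto
    moreover have "\<forall>p<q * q. \<forall>a<q. s' (39, p) a = d (p div q) (p mod q) a"
      using s1 sameD[OF s'] by simp
    ultimately have "run N X (step_row a) (S * (2 * (q * q) + 4) + 4) s' (\<lambda>s2. step_ok s2 a S \<and>
      (\<forall>a'. a' \<noteq> a \<longrightarrow> s2 (37, a') = s' (37, a') \<and> s2 (38, a') = s' (38, a')))"
      by (rule run_step_row[OF a])
    then show "run N X (step_row a) (S * (2 * (q * q) + 4) + 4) s' (?I (Suc a))"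
      by (rule run_mono) (use I in \<open>auto simp: step_ok_def less_Suc_eq\<close>)
  next
    fix a
    show "mods (step_row a) \<subseteq> {4, 37, 38, 40, 41}" by (auto simp: step_row_def)
  qed simp
qed

abbreviation trans_state :: "nat \<Rightarrow> nat \<Rightarrow> nat" where
  "trans_state x u \<equiv> enc (q * q) (sts (dec (q * q) x) (dec q u))"

abbreviation trans_out :: "nat \<Rightarrow> nat \<Rightarrow> nat" where
  "trans_out x u \<equiv> enc q (outs (dec (q * q) x) (dec q u))"

definition trans_ok :: "store \<Rightarrow> nat \<Rightarrow> nat \<Rightarrow> bool" where
  "trans_ok s x m \<longleftrightarrow> (\<forall>u<m. s (44, 0) (x * U + u) = trans_state x u \<and>
     s (45, 0) (x * U + u) = trans_out x u)"

lemma length_word: "u < U \<longleftrightarrow> length (dec q u) \<le> l"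
  using less_wcount[OF q_pos, of u "Suc l"] by auto

lemma length_state: "x < S \<longleftrightarrow> length (dec (q * q) x) \<le> l"
  using less_wcount[OF qq_pos, of x "Suc l"] by auto

lemma trans_state_less: "x < S \<Longrightarrow> trans_state x u < S"
  using length_state set_sts[OF set_dec[OF qq_pos] set_dec[OF q_pos]]
  by (intro enc_state_less) auto

lemma trans_out_less: "u < U \<Longrightarrow> trans_out x u < U"
  using length_word q set_outs[OF set_dec[OF qq_pos] set_dec[OF q_pos]]
  by (intro enc_less_wcount) auto

lemma trans_snoc:
  assumes "a < q"
  shows "trans_state x (Suc (q * u + a)) = step_state a (trans_state x u)"
    and "trans_out x (Suc (q * u + a)) = q * trans_out x u + step_out a (trans_state x u) + 1"
  using assms set_sts[OF set_dec[OF qq_pos] set_dec[OF q_pos]]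
  by (simp_all add: sts_append outs_append)

lemma run_trans_row:
  assumes x: "x < S" and st: "marks s (21, 0) (wcount q l)" and step: "\<forall>a<q. step_ok s a S"
    and p: "s (42, 0) 0 = x * U" and ok: "trans_ok s x 1"
  shows "run N X trans_row (U * (4 * q + 4) + 3) s (\<lambda>s'. trans_ok s' x U \<and>
    (\<forall>n<x * U. s' (44, 0) n = s (44, 0) n \<and> s' (45, 0) n = s (45, 0) n))"
proof -
  let ?n = "wcount q l"
  let ?b = "\<lambda>a. (46, 0) ::= AddC (Var (46, 0)) 1 ;;
          (47, 0) ::= Idx (38, a) (Var (40, 0)) ;;
          Put (44, 0) (Var (46, 0)) (Idx (37, a) (Var (40, 0))) ;;
          Put (45, 0) (Var (46, 0)) (AddC (AddV (mulv q (41, 0)) (47, 0)) 1)"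
  let ?c = "(40, 0) ::= Idx (44, 0) (AddV (Var (42, 0)) (5, 0)) ;;
        (41, 0) ::= Idx (45, 0) (AddV (Var (42, 0)) (5, 0)) ;; seqs (map ?b [0..<q])"
  let ?J = "\<lambda>m s'. s' (46, 0) 0 = x * U + m \<and> trans_ok s' x (m + 1) \<and>
    (\<forall>n<x * U. s' (44, 0) n = s (44, 0) n \<and> s' (45, 0) n = s (45, 0) n)"
  let ?I = "\<lambda>y s'. ?J (q * y) s'"
  let ?M = "{5, 40, 41, 44, 45, 46, 47}"
  have "Suc x * U \<le> S * U" using x by (intro mult_le_mono1) simp
  then have xU: "x * U + U \<le> X" using sizes_le(8) by simp
  have body: "run N X ?c (4 * q + 2) s' (?I (Suc y))"
    if y: "y < ?n" and I: "?I y s'" and i: "s' (5, 0) 0 = y" and s': "same ?M s s'" for y s'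
  proof (rule wp_run_units)
    have "q * Suc y \<le> q * ?n" using y by (intro mult_le_mono2) simp
    then have yU: "q * y + q < U" by simp
    have "1 * y \<le> q * y" using q by (intro mult_le_mono1) simp
    then have yq: "y \<le> q * y" by linarith
    then have "y < q * y + 1" by linarith
    then have now: "s' (44, 0) (x * U + y) = trans_state x y" "s' (45, 0) (x * U + y) = trans_out x y"
      using I by (simp_all add: trans_ok_def)
    have s'p: "s' (42, 0) 0 = x * U" using p sameD[OF s'] by simp
    let ?t = "trans_state x y" and ?o = "trans_out x y"
    let ?s2 = "upd (upd s' (40, 0) 0 ?t) (41, 0) 0 ?o"
    have "wp N X (seqs (map ?b [0..<q])) (?I (Suc y)) ?s2"
    proof (rule wp_seqs[where M = "{44, 45, 46, 47}" and I = "\<lambda>a s'. ?J (q * y + a) s'"])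
      show "?J (q * y + 0) ?s2" using I by (simp add: trans_ok_def)
    next
      fix a s3
      assume a: "a < q" and J: "?J (q * y + a) s3" and s3: "same {44, 45, 46, 47} ?s2 s3"
      have v: "s3 (40, 0) 0 = ?t" "s3 (41, 0) 0 = ?o"
        using sameD[OF s3] by simp_all
      have "step_ok s a S" using step a by blast
      then have v': "s3 (37, a) ?t = step_state a ?t" "s3 (38, a) ?t = step_out a ?t"
        using sameD[OF s3] sameD[OF s'] trans_state_less[OF x] by (simp_all add: step_ok_def)
      note sn = trans_snoc[OF a, of x y]
      have "Suc (q * y + a) < U" using yU a by simp
      from trans_out_less[OF this, of x] sizes_le(1)
      have o: "q * ?o + step_out a ?t + 1 \<le> X" unfolding sn by linarith
      have m: "x * U + Suc (q * y + a) \<le> X" using xU yU a by linarith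
      define k where "k = x * U"
      have ok: "\<And>u. u < Suc (q * y + a) \<Longrightarrow> s3 (44, 0) (k + u) = trans_state x u \<and>
          s3 (45, 0) (k + u) = trans_out x u"
        using J by (simp add: trans_ok_def k_def)
      show "wp N X (?b a) (\<lambda>s'. ?J (q * y + Suc a) s') s3"
        using v v' o m J sn ok X1
        by (simp add: trans_ok_def less_Suc_eq del: wcount.simps flip: k_def)
    next
      fix s3
      assume "?J (q * y + q) s3"
      then show "?I (Suc y) s3" by (simp add: algebra_simps del: wcount.simps)
    qed auto
    moreover have "x * U + y \<le> X" using xU yU yq by linarith
    ultimately show "wp N X ?c (?I (Suc y)) s'"
      using i now s'p by (simp del: wcount.simps)
  qed (simp add: comp_def sum_list_triv)
  let ?s1 = "upd s (46, 0) 0 (x * U)"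
  have "run N X (For (21, 0) (5, 0) ?c) (?n * (4 * q + 2 + 2) + 2) ?s1 (?I ?n)"
  proof (rule run_For[where I = ?I and M = ?M])
    show "marks ?s1 (21, 0) ?n" using st by (simp add: marks_def)
    show "?I 0 ?s1" using ok by (simp add: trans_ok_def del: wcount.simps)
    fix y s'
    assume "same ?M ?s1 s'"
    moreover have "same ?M s ?s1" by simp
    ultimately have "same ?M s s'" using same_trans by blast
    moreover assume "y < ?n" "?I y s'" "s' (5, 0) 0 = y"
    ultimately show "run N X ?c (4 * q + 2) s' (?I (Suc y))" by (intro body)
  qed (use sizes_le in \<open>auto simp: trans_ok_def simp del: wcount.simps\<close>)
  then have "run N X trans_row (1 + (?n * (4 * q + 2 + 2) + 2)) s (?I ?n)"
    unfolding trans_row_def using p xU by (intro run_Put) (auto simp del: wcount.simps)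
  then show ?thesis
  proof (rule run_mono)
    have "?n \<le> U" using q by (simp add: le_SucI)
    then show "1 + (?n * (4 * q + 2 + 2) + 2) \<le> U * (4 * q + 4) + 3"
      using mult_le_mono1[of ?n U "4 * q + 2 + 2"] by (simp del: wcount.simps add: algebra_simps)
  qed simp
qed

lemma run_trans_prog:
  assumes st: "marks s (21, 0) (wcount q l)" "marks s (23, 0) S" and step: "\<forall>a<q. step_ok s a S"
    and u: "s (16, 0) 0 = U"
  shows "run N X trans_prog (S * (U * (4 * q + 4) + 9) + 3) s
    (\<lambda>s'. \<forall>x<S. s' (43, 0) x = x * U \<and> trans_ok s' x U)"
proof -
  let ?c = "Put (43, 0) (Var (4, 0)) (Var (42, 0)) ;; Put (44, 0) (Var (42, 0)) (Var (4, 0)) ;;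
       Put (45, 0) (Var (42, 0)) (Const 0) ;; trans_row ;; (42, 0) ::= AddV (Var (42, 0)) (16, 0)"
  let ?J = "\<lambda>x s'. \<forall>x'<x. s' (43, 0) x' = x' * U \<and> trans_ok s' x' U"
  let ?I = "\<lambda>x s'. s' (42, 0) 0 = x * U \<and> ?J x s'"
  let ?M = "{4, 5, 40, 41, 42, 43, 44, 45, 46, 47}"
  let ?T = "U * (4 * q + 4) + 3"
  have body: "run N X ?c (1 + (1 + (1 + (?T + 1)))) s' (?I (Suc x))"
    if x: "x < S" and I: "?I x s'" and i: "s' (4, 0) 0 = x" and s': "same ?M s s'" for x s'
  proof -
    define s3 where "s3 = upd (upd (upd s' (43, 0) x (x * U)) (44, 0) (x * U) x) (45, 0) (x * U) 0"
    \<comment> \<open>Rows do not overlap, so writing into row \<open>x\<close> preserves the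
      earlier ones.\<close>
    have below: "x' * U + u < x * U" if "x' < x" "u < U" for x' u
    proof -
      have "Suc x' * U \<le> x * U" using that(1) by (intro mult_le_mono1) simp
      then show ?thesis using that(2) by simp
    qed
    have "Suc x * U \<le> S * U" using x by (intro mult_le_mono1) simp
    then have xU: "x * U + U \<le> X" using sizes_le(8) by simp
    have J3: "?J x s3 \<and> s3 (43, 0) x = x * U"
      using I below by (auto simp: s3_def trans_ok_def simp del: wcount.simps) (metis less_irrefl)+
    have t3: "trans_ok s3 x 1"
      using q by (simp add: s3_def trans_ok_def del: wcount.simps)
    have "run N X trans_row ?T s3 (\<lambda>s2. trans_ok s2 x U \<and>
      (\<forall>n<x * U. s2 (44, 0) n = s3 (44, 0) n \<and> s2 (45, 0) n = s3 (45, 0) n))"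
    proof (rule run_trans_row[OF x])
      show "marks s3 (21, 0) (wcount q l)" using marks_same[OF st(1) s'] by (simp add: s3_def marks_def)
      show "\<forall>a<q. step_ok s3 a S" using step sameD[OF s'] by (simp add: s3_def step_ok_def del: wcount.simps)
      show "s3 (42, 0) 0 = x * U" using I by (simp add: s3_def del: wcount.simps)
    qed (rule t3)
    then have "run N X trans_row ?T s3 (\<lambda>s2. (trans_ok s2 x U \<and>
      (\<forall>n<x * U. s2 (44, 0) n = s3 (44, 0) n \<and> s2 (45, 0) n = s3 (45, 0) n)) \<and>
      same {5, 40, 41, 44, 45, 46, 47} s3 s2)"
      by (rule run_same) (auto simp: trans_row_def)
    then have "run N X (trans_row ;; (42, 0) ::= AddV (Var (42, 0)) (16, 0)) (?T + 1) s3 (?I (Suc x))"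
    proof (rule run_SeqI[OF _ wp_run_units])
      fix s2
      assume s2: "(trans_ok s2 x U \<and>
        (\<forall>n<x * U. s2 (44, 0) n = s3 (44, 0) n \<and> s2 (45, 0) n = s3 (45, 0) n)) \<and>
        same {5, 40, 41, 44, 45, 46, 47} s3 s2"
      then have same2: "same {5, 40, 41, 44, 45, 46, 47} s3 s2" by blast
      have "s2 (42, 0) 0 = x * U" "s2 (16, 0) 0 = U" "\<And>x'. s2 (43, 0) x' = s3 (43, 0) x'"
        using sameD[OF same2] sameD[OF s'] I u by (simp_all add: s3_def del: wcount.simps)
      moreover have "trans_ok s2 x' U" if "x' < x" for x'
        using conjunct1[OF J3] s2 that below[OF that] unfolding trans_ok_def by presburger
      ultimately show "wp N X ((42, 0) ::= AddV (Var (42, 0)) (16, 0)) (?I (Suc x)) s2"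
        using xU s2 J3 by (auto simp: less_Suc_eq trans_ok_def simp del: wcount.simps)
    qed simp
    then show ?thesis
      unfolding s3_def using i I xU x sizes_le(2) by (intro run_Put) (auto simp del: wcount.simps)
  qed
  let ?s1 = "upd s (42, 0) 0 0"
  have "run N X (For (23, 0) (4, 0) ?c) (S * (1 + (1 + (1 + (?T + 1))) + 2) + 2) ?s1 (?I S)"
  proof (rule run_For[where I = ?I and M = ?M])
    show "marks ?s1 (23, 0) S" using st by (simp add: marks_def del: wcount.simps)
    fix y s'
    assume "same ?M ?s1 s'"
    moreover have "same ?M s ?s1" by simp
    ultimately have "same ?M s s'" using same_trans by blast
    moreover assume "y < S" "?I y s'" "s' (4, 0) 0 = y"
    ultimately show "run N X ?c (1 + (1 + (1 + (?T + 1)))) s' (?I (Suc y))" by (intro body)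
  next
    show "mods ?c \<subseteq> ?M - {fst (4, 0 :: nat)}" by (auto simp: trans_row_def)
  qed (use sizes_le in \<open>auto simp: trans_ok_def simp del: wcount.simps\<close>)
  then have "run N X trans_prog (1 + (S * (1 + (1 + (1 + (?T + 1))) + 2) + 2)) s (?I S)"
    unfolding trans_prog_def by (intro run_Put) auto
  then show ?thesis by (rule run_mono) (auto simp: algebra_simps simp del: wcount.simps)
qed

end

section \<open>Values of words and their products with powers of two\<close>

context coded_operation
begin

text \<open>A new letter other than the blank doubles the value and adds its bit. Doubling adds
  array 50 to itself, with the bit supplied as initial carry.\<close>

definition value_prog :: com where
  "value_prog = const_digits 48 0 m2 ;; (49, 0) ::= Const 0 ;;
     For (21, 0) (4, 0) (seqs (map (\<lambda>a.
       move_digits 50 0 (Const 0) 48 0 (Var (4, 0)) m2 ;;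
       (if a = z then Skip else add_digits 26 27 50 50 (of_bool (isone a)) m2) ;;
       move_digits 48 0 (AddC (mulv q (4, 0)) (a + 1)) 50 0 (Const 0) m2 ;;
       Put (49, 0) (AddC (mulv q (4, 0)) (a + 1)) (AddC (Idx (49, 0) (Var (4, 0))) (of_bool (a \<noteq> z))))
       [0..<q]))"

text \<open>Successive doublings are stored side by side. The position counts letters to the right
  of a word, at most \<open>kw * l\<close>, hence a row length of \<open>kw * l + 1\<close>; the
  address \<open>(42, 0)\<close> runs on from row to row.\<close>

definition out_row :: com where
  "out_row = move_digits 50 0 (Const 0) 48 0 (Var (4, 0)) m2 ;;
     For (24, 0) (5, 0)
       (move_digits 52 0 (Var (42, 0)) 50 0 (Const 0) m2 ;;
        add_digits 26 27 50 50 0 m2 ;; (42, 0) ::= AddC (Var (42, 0)) 1)"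

definition out_prog :: com where
  "out_prog = (42, 0) ::= Const 0 ;;
     For (25, 0) (4, 0) (Put (51, 0) (Var (4, 0)) (Var (42, 0)) ;; out_row)"

end

context coded_tables
begin

abbreviation val :: "nat \<Rightarrow> nat" where "val u \<equiv> word_value z isone (dec q u)"
abbreviation cnt :: "nat \<Rightarrow> nat" where "cnt u \<equiv> count_letters z (dec q u)"

definition value_ok :: "store \<Rightarrow> nat \<Rightarrow> bool" where
  "value_ok s m \<longleftrightarrow> (\<forall>u<m. s (49, 0) u = cnt u \<and> (\<forall>j<m2. s (48, j) u = dg b j (val u)))"

lemma cnt_le: "u < U \<Longrightarrow> cnt u \<le> l"
  using length_word[of u] by (auto simp: count_letters_def intro: le_trans[OF length_filter_le])

lemma l_less_X: "Suc l \<le> X"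
  using less_exp[of l] sizes_le(5) by linarith

lemma value_snoc:
  assumes "a < q"
  shows "val (Suc (q * u + a)) = (if a = z then val u else val u + val u + of_bool (isone a))"
    and "cnt (Suc (q * u + a)) = cnt u + of_bool (a \<noteq> z)"
  using assms by (simp_all add: count_letters_def)

lemma run_value_prog:
  assumes st: "marks s (21, 0) (wcount q l)" and dm: "divmod s 26 27 b"
  shows "run N X value_prog (U * (q * (5 * m2 + 2) + 2) + m2 + 3) s (\<lambda>s'. value_ok s' U)"
proof -
  let ?n = "wcount q l"
  let ?add = "\<lambda>a. if a = z then Skip else add_digits 26 27 50 50 (of_bool (isone a)) m2"
  let ?row = "\<lambda>a. move_digits 50 0 (Const 0) 48 0 (Var (4, 0)) m2 ;; ?add a ;;
       move_digits 48 0 (AddC (mulv q (4, 0)) (a + 1)) 50 0 (Const 0) m2 ;;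
       Put (49, 0) (AddC (mulv q (4, 0)) (a + 1)) (AddC (Idx (49, 0) (Var (4, 0))) (of_bool (a \<noteq> z)))"
  let ?I = "\<lambda>x s'. value_ok s' (q * x + 1)"
  let ?M = "{4, 30, 31, 48, 49, 50}"
  have row: "wp N X (?row a) (\<lambda>s'. value_ok s' (q * x + 1 + Suc a)) s3"
    if x: "x < ?n" and a: "a < q" and ok: "value_ok s3 (q * x + 1 + a)" and s3: "same ?M s s3"
      and i: "s3 (4, 0) 0 = x" for x a s3
  proof -
    define k where "k = Suc (q * x + a)"
    have "q * Suc x \<le> q * ?n" using x by (intro mult_le_mono2) simp
    then have kU: "k < U" using a by (simp add: k_def)
    have "1 * x \<le> q * x" using q by (intro mult_le_mono1) simp
    then have xk: "x < q * x + 1 + a" "x < k" unfolding k_def by linarith+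
    have x_ok: "s3 (49, 0) x = cnt x" "\<And>j. j < m2 \<Longrightarrow> s3 (48, j) x = dg b j (val x)"
      using ok xk by (simp_all add: value_ok_def)
    have kX: "q * x + Suc a \<le> X" "cnt x + 1 \<le> X"
      using kU sizes_le(1) cnt_le[of x] xk l_less_X by (simp_all add: k_def del: wcount.simps)
    have fin: "wp N X (move_digits 48 0 (AddC (mulv q (4, 0)) (a + 1)) 50 0 (Const 0) m2 ;;
       Put (49, 0) (AddC (mulv q (4, 0)) (a + 1)) (AddC (Idx (49, 0) (Var (4, 0))) (of_bool (a \<noteq> z))))
       (\<lambda>s'. value_ok s' (q * x + 1 + Suc a)) s4"
      if s4: "number s4 50 b m2 (val k)" "same {50, 30, 31} s3 s4" for s4
      unfolding wp.simps(3)
    proof (rule wp_move_digits[where ?v1.0 = k and ?v2.0 = 0])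
      fix s5
      assume s5: "\<And>j y. s5 (48, j) y = (if 0 \<le> j \<and> j < 0 + m2 \<and> y = k
        then s4 (50, 0 + (j - 0)) 0 else s4 (48, j) y)" "same {48} s4 s5"
      have e: "s5 (4, 0) 0 = x" "s5 (49, 0) = s3 (49, 0)" "\<And>j. s4 (48, j) = s3 (48, j)"
        using i sameD[OF s5(2)] sameD[OF s4(2)] by simp_all
      show "wp N X (Put (49, 0) (AddC (mulv q (4, 0)) (a + 1))
          (AddC (Idx (49, 0) (Var (4, 0))) (of_bool (a \<noteq> z))))
          (\<lambda>s'. value_ok s' (q * x + 1 + Suc a)) s5"
        using e s5(1) s4(1) kX x_ok(1) ok value_snoc(2)[OF a, of x]
        by (auto simp: value_ok_def number_def less_Suc_eq k_def)
    next
      fix s5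
      assume "same {48} s4 s5"
      then have "s5 (4, 0) 0 = x" using i sameD[OF s4(2)] by (simp add: sameD)
      then show "eval N s5 (AddC (mulv q (4, 0)) (a + 1)) = k \<and>
          fits N X s5 (AddC (mulv q (4, 0)) (a + 1))"
        using kX by (simp add: k_def)
    qed auto
    show ?thesis
      unfolding wp.simps(3)
    proof (rule wp_move_digits[where ?v1.0 = 0 and ?v2.0 = x])
      fix s4
      assume s4: "\<And>j y. s4 (50, j) y = (if 0 \<le> j \<and> j < 0 + m2 \<and> y = 0
        then s3 (48, 0 + (j - 0)) x else s3 (50, j) y)" "same {50} s3 s4"
      have num: "number s4 50 b m2 (val x)" using s4(1) x_ok(2) by (simp add: number_def)
      have "wp N X (?add a) (\<lambda>s5. number s5 50 b m2 (val k) \<and> same {50, 30, 31} s3 s5) s4"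
      proof (cases "a = z")
        case True
        then show ?thesis
          using num value_snoc(1)[OF a, of x] same_mono[OF s4(2), of "{50, 30, 31}"]
          by (simp add: k_def)
      next
        case False
        have "wp N X (add_digits 26 27 50 50 (of_bool (isone a)) m2)
            (\<lambda>s5. number s5 50 b m2 (val k) \<and> same {50, 30, 31} s3 s5) s4"
        proof (rule wp_add_digits[OF num num _ b2 sizes_le(6)])
          show "divmod s4 26 27 b"
            using divmod_same[OF dm s3] divmod_same[OF _ s4(2)] by simp
          fix s5
          assume s5: "number s5 50 b m2 (val x + val x + of_bool (isone a))"
            "same {50, 30, 31} s4 s5"
          have "same {50, 30, 31} s3 s4" by (rule same_mono[OF s4(2)]) simp
          then show "number s5 50 b m2 (val k) \<and> same {50, 30, 31} s3 s5"
            using s5 same_trans value_snoc(1)[OF a, of x] False by (auto simp: k_def)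
        qed simp_all
        then show ?thesis using False by simp
      qed
      then show "wp N X (?add a) (wp N X (move_digits 48 0 (AddC (mulv q (4, 0)) (a + 1)) 50 0 (Const 0) m2)
       (wp N X (Put (49, 0) (AddC (mulv q (4, 0)) (a + 1)) (AddC (Idx (49, 0) (Var (4, 0))) (of_bool (a \<noteq> z))))
       (\<lambda>s'. value_ok s' (q * x + 1 + Suc a)))) s4"
        by (rule wp_mono) (use fin in \<open>simp only: wp_Seq\<close>)
    next
      fix s4
      assume "same {50} s3 s4"
      then show "eval N s4 (Var (4, 0)) = x \<and> fits N X s4 (Var (4, 0))"
        using i by (simp add: sameD)
    qed auto
  qed
  have body: "run N X (seqs (map ?row [0..<q])) (q * (5 * m2 + 2)) s' (?I (Suc x))"
    if x: "x < ?n" and I: "?I x s'" and i: "s' (4, 0) 0 = x" and s': "same ?M s s'" for x s'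
  proof -
    have "run N X (seqs (map ?row [0..<q])) (units (seqs (map ?row [0..<q]))) s' (?I (Suc x))"
    proof (rule wp_run, rule wp_seqs[where M = "{30, 31, 48, 49, 50}" and
          I = "\<lambda>a s'. value_ok s' (q * x + 1 + a)"])
      show "value_ok s' (q * x + 1 + 0)" using I by simp
      fix a s3
      assume a: "a < q" and ok: "value_ok s3 (q * x + 1 + a)" and s3: "same {30, 31, 48, 49, 50} s' s3"
      have "same ?M s' s3" by (rule same_mono[OF s3]) simp
      then have "same ?M s s3" using same_trans[OF s'] by blast
      moreover have "s3 (4, 0) 0 = x" using i sameD[OF s3] by simp
      ultimately show "wp N X (?row a) (\<lambda>s'. value_ok s' (q * x + 1 + Suc a)) s3"
        using row[OF x a ok] by blast
    next
      fix s3
      assume "value_ok s3 (q * x + 1 + q)"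
      then show "?I (Suc x) s3" by (simp add: algebra_simps)
    qed auto
    \<comment> \<open>The letters do not cost the same: for the blank no addition takes
      place.\<close>
    moreover have "units (seqs (map ?row [0..<k])) \<le> k * (5 * m2 + 2)" for k
      by (induction k) auto
    ultimately show ?thesis by (rule run_mono)
  qed
  let ?c = "For (21, 0) (4, 0) (seqs (map ?row [0..<q]))"
  have loop: "run N X ?c (?n * (q * (5 * m2 + 2) + 2) + 2) s1 (?I ?n)"
    if s1: "value_ok s1 1" "same {48, 49} s s1" for s1
  proof (rule run_For[where I = ?I and M = ?M])
    show "marks s1 (21, 0) ?n" using marks_same[OF st s1(2)] by simp
    fix y s'
    assume "same ?M s1 s'"
    moreover have "same ?M s s1" by (rule same_mono[OF s1(2)]) simp
    ultimately have "same ?M s s'" using same_trans by blast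
    moreover assume "y < ?n" "?I y s'" "s' (4, 0) 0 = y"
    ultimately show "run N X (seqs (map ?row [0..<q])) (q * (5 * m2 + 2)) s' (?I (Suc y))"
      by (intro body)
  qed (use s1 sizes_le in \<open>auto simp: value_ok_def simp del: wcount.simps split: if_splits\<close>)
  have "run N X value_prog (m2 + (1 + (?n * (q * (5 * m2 + 2) + 2) + 2))) s (?I ?n)"
    unfolding value_prog_def
  proof (rule run_SeqI[OF wp_run_units])
    show "wp N X (const_digits 48 0 m2) (\<lambda>s1. number s1 48 b m2 0 \<and> same {48} s s1) s"
      using b2 by (intro wp_const_digits) auto
    fix s1
    assume s1: "number s1 48 b m2 0 \<and> same {48} s s1"
    have "same {48, 49} s (upd s1 (49, 0) 0 0)"
      using same_trans[OF same_mono[of "{48}" s s1 "{48, 49}"]] s1 by simp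
    moreover have "value_ok (upd s1 (49, 0) 0 0) 1"
      using s1 by (simp add: value_ok_def number_def count_letters_def)
    ultimately have "run N X ?c (?n * (q * (5 * m2 + 2) + 2) + 2) (upd s1 (49, 0) 0 0) (?I ?n)"
      by (intro loop)
    then show "run N X ((49, 0) ::= Const 0 ;; ?c) (1 + (?n * (q * (5 * m2 + 2) + 2) + 2)) s1 (?I ?n)"
      by (intro run_Put) simp_all
  qed simp
  then show ?thesis
  proof (rule run_mono)
    have "?n \<le> U" using q by (simp add: le_SucI)
    then have "?n * (q * (5 * m2 + 2) + 2) \<le> U * (q * (5 * m2 + 2) + 2)" by (rule mult_le_mono1)
    then show "m2 + (1 + (?n * (q * (5 * m2 + 2) + 2) + 2)) \<le> U * (q * (5 * m2 + 2) + 2) + m2 + 3"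
      by linarith
  qed simp
qed

definition out_ok :: "store \<Rightarrow> nat \<Rightarrow> nat \<Rightarrow> bool" where
  "out_ok s u m \<longleftrightarrow> (\<forall>e<m. \<forall>j<m2. s (52, j) (u * E + e) = dg b j (val u * 2 ^ e))"

lemma run_out_row:
  assumes u: "u < U" and st: "marks s (24, 0) E" and dm: "divmod s 26 27 b"
    and p: "s (42, 0) 0 = u * E" and i: "s (4, 0) 0 = u"
    and val: "\<And>j. j < m2 \<Longrightarrow> s (48, j) u = dg b j (val u)"
  shows "run N X out_row (E * (4 * m2 + 4) + m2 + 2) s (\<lambda>s'. out_ok s' u E \<and>
    s' (42, 0) 0 = Suc u * E \<and> (\<forall>j. \<forall>n<u * E. s' (52, j) n = s (52, j) n))"
proof -
  let ?c = "move_digits 52 0 (Var (42, 0)) 50 0 (Const 0) m2 ;;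
        add_digits 26 27 50 50 0 m2 ;; (42, 0) ::= AddC (Var (42, 0)) 1"
  let ?I = "\<lambda>e s'. s' (42, 0) 0 = u * E + e \<and> number s' 50 b m2 (val u * 2 ^ e) \<and> out_ok s' u e \<and>
    (\<forall>j. \<forall>n<u * E. s' (52, j) n = s (52, j) n)"
  let ?M = "{5, 30, 31, 42, 50, 52}"
  have "Suc u * E \<le> U * E" using u by (intro mult_le_mono1) simp
  then have uX: "u * E + E \<le> X" using sizes_le(9) by (simp add: add.commute)
  have body: "run N X ?c (4 * m2 + 2) s' (?I (Suc e))"
    if e: "e < E" and I: "?I e s'" and s': "same ?M s s'" for e s'
  proof (rule wp_run_units)
    show "wp N X ?c (?I (Suc e)) s'"
      unfolding wp.simps(3)
    proof (rule wp_move_digits[where ?v1.0 = "u * E + e" and ?v2.0 = 0])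
      fix s2
      assume s2: "\<And>j y. s2 (52, j) y = (if 0 \<le> j \<and> j < 0 + m2 \<and> y = u * E + e
        then s' (50, 0 + (j - 0)) 0 else s' (52, j) y)" "same {52} s' s2"
      have num: "number s2 50 b m2 (val u * 2 ^ e)" using I number_same[OF _ s2(2)] by auto
      show "wp N X (add_digits 26 27 50 50 0 m2)
          (wp N X ((42, 0) ::= AddC (Var (42, 0)) 1) (?I (Suc e))) s2"
      proof (rule wp_add_digits[OF num num _ b2 sizes_le(6)])
        show "divmod s2 26 27 b"
          using divmod_same[OF dm s'] divmod_same[OF _ s2(2)] by simp
        fix s3
        assume s3: "number s3 50 b m2 (val u * 2 ^ e + val u * 2 ^ e + 0)" "same {50, 30, 31} s2 s3"
        have e42: "s3 (42, 0) 0 = u * E + e" using I sameD[OF s3(2)] sameD[OF s2(2)] by simp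
        have e52: "s3 (52, j) = s2 (52, j)" for j using sameD[OF s3(2)] by simp
        have "out_ok s3 u (Suc e)"
          unfolding out_ok_def
        proof (intro allI impI)
          fix e' j
          assume "e' < Suc e" "j < m2"
          then show "s3 (52, j) (u * E + e') = dg b j (val u * 2 ^ e')"
            using I by (cases "e' = e") (auto simp: e52 s2(1) out_ok_def number_def)
        qed
        moreover have "\<forall>j. \<forall>n<u * E. s3 (52, j) n = s (52, j) n"
          using I by (simp add: e52 s2(1))
        moreover have "number s3 50 b m2 (val u * 2 ^ Suc e)"
          using s3(1) by (simp add: mult_2 algebra_simps)
        ultimately show "wp N X ((42, 0) ::= AddC (Var (42, 0)) 1) (?I (Suc e)) s3"
          using e42 uX e by (simp add: out_ok_def number_def)
      qed simp_all
    next
      fix s2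
      assume "same {52} s' s2"
      then show "eval N s2 (Var (42, 0)) = u * E + e \<and> fits N X s2 (Var (42, 0))"
        using I by (simp add: sameD)
    qed auto
  qed simp
  have loop: "run N X (For (24, 0) (5, 0) ?c) (E * (4 * m2 + 2 + 2) + 2) s1 (?I E)"
    if s1: "number s1 50 b m2 (val u)" "same {50} s s1" for s1
  proof (rule run_For[where I = ?I and M = ?M])
    show "marks s1 (24, 0) E" using marks_same[OF st s1(2)] by simp
    show "?I 0 s1" using s1 p sameD[OF s1(2)] by (simp add: out_ok_def)
    fix y s'
    assume "same ?M s1 s'"
    moreover have "same ?M s s1" by (rule same_mono[OF s1(2)]) simp
    ultimately have "same ?M s s'" using same_trans by blast
    moreover assume "y < E" "?I y s'"
    ultimately show "run N X ?c (4 * m2 + 2) s' (?I (Suc y))"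
      by (intro body)
  qed (use sizes_le in \<open>auto simp: out_ok_def number_def\<close>)
  have "run N X out_row (m2 + (E * (4 * m2 + 2 + 2) + 2)) s (?I E)"
    unfolding out_row_def
  proof (rule run_SeqI[OF wp_run_units])
    show "wp N X (move_digits 50 0 (Const 0) 48 0 (Var (4, 0)) m2)
      (\<lambda>s1. number s1 50 b m2 (val u) \<and> same {50} s s1) s"
      by (rule wp_move_digits[where ?v1.0 = 0 and ?v2.0 = u])
         (use i val in \<open>auto simp: sameD number_def\<close>)
    fix s1
    assume "number s1 50 b m2 (val u) \<and> same {50} s s1"
    then show "run N X (For (24, 0) (5, 0) ?c) (E * (4 * m2 + 2 + 2) + 2) s1 (?I E)"
      by (intro loop) blast+
  qed simp
  then show ?thesis by (rule run_mono) (auto simp: algebra_simps)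
qed

lemma run_out_prog:
  assumes st: "marks s (25, 0) U" "marks s (24, 0) E" and dm: "divmod s 26 27 b"
    and val: "value_ok s U"
  shows "run N X out_prog (U * (E * (4 * m2 + 4) + m2 + 5) + 3) s
    (\<lambda>s'. \<forall>u<U. s' (51, 0) u = u * E \<and> out_ok s' u E)"
proof -
  let ?c = "Put (51, 0) (Var (4, 0)) (Var (42, 0)) ;; out_row"
  let ?I = "\<lambda>x s'. s' (42, 0) 0 = x * E \<and> (\<forall>u<x. s' (51, 0) u = u * E \<and> out_ok s' u E)"
  let ?M = "{4, 5, 30, 31, 42, 50, 51, 52}"
  let ?T = "E * (4 * m2 + 4) + m2 + 2"
  have body: "run N X ?c (1 + ?T) s' (?I (Suc x))"
    if x: "x < U" and I: "?I x s'" and i: "s' (4, 0) 0 = x" and s': "same ?M s s'" for x s'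
  proof -
    define s2 where "s2 = upd s' (51, 0) x (x * E)"
    have "run N X out_row ?T s2 (\<lambda>s3. out_ok s3 x E \<and>
      s3 (42, 0) 0 = Suc x * E \<and> (\<forall>j. \<forall>n<x * E. s3 (52, j) n = s2 (52, j) n))"
    proof (rule run_out_row[OF x])
      show "marks s2 (24, 0) E" using marks_same[OF st(2) s'] by (simp add: s2_def marks_def)
      show "divmod s2 26 27 b" using divmod_same[OF dm s'] by (simp add: s2_def divmod_def)
      show "s2 (48, j) x = dg b j (val x)" if "j < m2" for j
        using val x that sameD[OF s'] by (simp add: s2_def value_ok_def)
    qed (use I i in \<open>simp_all add: s2_def\<close>)
    then have "run N X out_row ?T s2 (\<lambda>s3. (out_ok s3 x E \<and>
      s3 (42, 0) 0 = Suc x * E \<and> (\<forall>j. \<forall>n<x * E. s3 (52, j) n = s2 (52, j) n)) \<and>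
      same {5, 30, 31, 42, 50, 52} s2 s3)"
      by (rule run_same) (auto simp: out_row_def)
    then have "run N X out_row ?T s2 (?I (Suc x))"
    proof (rule run_mono)
      fix s3
      assume s3: "(out_ok s3 x E \<and>
        s3 (42, 0) 0 = Suc x * E \<and> (\<forall>j. \<forall>n<x * E. s3 (52, j) n = s2 (52, j) n)) \<and>
        same {5, 30, 31, 42, 50, 52} s2 s3"
      have "s3 (51, 0) = s2 (51, 0)" using s3 sameD[of _ s2 s3 51 0] by auto
      moreover have "out_ok s3 u E" if "u < x" for u
      proof -
        have "Suc u * E \<le> x * E" using that by (intro mult_le_mono1) simp
        then have "u * E + e < x * E" if "e < E" for e using that by simp
        then show ?thesis using s3 I that by (simp add: out_ok_def s2_def)
      qed
      ultimately show "?I (Suc x) s3"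
        using s3 I by (auto simp: s2_def less_Suc_eq)
    qed simp
    then show ?thesis
      unfolding s2_def using i I by (intro run_Put) auto
  qed
  let ?s1 = "upd s (42, 0) 0 0"
  have "run N X (For (25, 0) (4, 0) ?c) (U * (1 + ?T + 2) + 2) ?s1 (?I U)"
  proof (rule run_For[where I = ?I and M = ?M])
    show "marks ?s1 (25, 0) U" using st by (simp add: marks_def del: wcount.simps)
    fix y s'
    assume "same ?M ?s1 s'"
    moreover have "same ?M s ?s1" by simp
    ultimately have "same ?M s s'" using same_trans by blast
    moreover assume "y < U" "?I y s'" "s' (4, 0) 0 = y"
    ultimately show "run N X ?c (1 + ?T) s' (?I (Suc y))" by (intro body)
  next
    show "mods ?c \<subseteq> ?M - {fst (4, 0 :: nat)}" by (auto simp: out_row_def)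
  qed (use sizes_le in \<open>auto simp: out_ok_def simp del: wcount.simps\<close>)
  then have "run N X out_prog (1 + (U * (1 + ?T + 2) + 2)) s (?I U)"
    unfolding out_prog_def by (intro run_Put) auto
  then show ?thesis by (rule run_mono) (auto simp: algebra_simps simp del: wcount.simps)
qed

end

section \<open>All tables together in linear time\<close>

lemma same_Un: "same M s s' \<Longrightarrow> same M' s' s'' \<Longrightarrow> same (M \<union> M') s s''"
  by (simp add: same_def)

lemma run_obtain:
  assumes "run N X c T s Q" "mods c \<subseteq> M"
  obtains t s' where "t \<le> T" "big N X c s t s'" "Q s'" "same M s s'"
  using run_same[OF assms] by (auto simp: run_def)

text \<open>Absorbs an additive constant into a multiple of \<open>Y\<close>.\<close>

lemma linear_bound: "a \<le> Y \<Longrightarrow> 1 \<le> Y \<Longrightarrow> a * k + c \<le> (k + c) * Y" for a k c Y :: nat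
proof -
  assume "a \<le> Y" "1 \<le> Y"
  then have "a * k + c * 1 \<le> Y * k + c * Y" by (intro add_mono mult_le_mono) auto
  then show ?thesis by (simp add: algebra_simps)
qed

context coded_operation
begin

definition tables_prog :: com where
  "tables_prog = size_prog ;; divmod_prog 19 7 26 27 ;; divmod_prog 20 12 28 29 ;; conv_prog ;;
     bits_prog ;; step_prog ;; trans_prog ;; value_prog ;; out_prog"

text \<open>One summand for each of the nine programs in their order: in its running time the table
  sizes are replaced by \<open>Y = q ^ 6 * N\<close>, the size of the product table by
  \<open>(kw + 1) * Y\<close>, and constants are multiplied by \<open>Y\<close>.\<close>

definition tables_factor :: nat where
  "tables_factor = 10 + (5 + 2) + (5 + 2) + (2 * dd * (4 * m1 + 3) + (m1 + 2 * dd * (2 * m1 + 2))) +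
     (9 + 2) + (q * (2 * (q * q) + 4) + (q * q * q + q * 4)) + ((4 * q + 4) + (9 + 3)) +
     (q * (5 * m2 + 2) + 2 + (m2 + 3)) + ((4 * m2 + 4) * (kw + 1) + (m2 + 5 + 3))"

end

context coded_tables
begin

definition tables :: "store \<Rightarrow> bool" where
  "tables s \<longleftrightarrow> sizes s \<and> divmod s 26 27 b \<and> divmod s 28 29 B \<and> (\<forall>j<2 * dd. conv_ok s j) \<and>
     bits_ok s \<and> (\<forall>x<S. s (43, 0) x = x * U \<and> trans_ok s x U) \<and> value_ok s U \<and>
     (\<forall>u<U. s (51, 0) u = u * E \<and> out_ok s u E)"

lemma sizes_same: "sizes s \<Longrightarrow> same M s s' \<Longrightarrow> M \<inter> {7..25} = {} \<Longrightarrow> sizes s'"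
proof -
  assume s: "sizes s" and s': "same M s s'" "M \<inter> {7..25} = {}"
  have "s' (h, 0) = s (h, 0)" if "7 \<le> h" "h \<le> 25" for h
  proof -
    have "h \<notin> M" using s'(2) that by auto
    then show ?thesis by (rule sameD[OF s'(1)])
  qed
  then show ?thesis using s by (simp add: sizes_def has_length_def marks_def)
qed

lemma conv_ok_same: "conv_ok s j \<Longrightarrow> same M s s' \<Longrightarrow> 34 \<notin> M \<Longrightarrow> conv_ok s' j"
  by (simp add: conv_ok_def sameD)

lemma bits_ok_same: "bits_ok s \<Longrightarrow> same M s s' \<Longrightarrow> M \<inter> {35, 36} = {} \<Longrightarrow> bits_ok s'"
  by (simp add: bits_ok_def sameD)

lemma trans_ok_same: "trans_ok s a m \<Longrightarrow> same M s s' \<Longrightarrow> M \<inter> {44, 45} = {} \<Longrightarrow> trans_ok s' a m"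
  by (simp add: trans_ok_def sameD)

lemma value_ok_same: "value_ok s m \<Longrightarrow> same M s s' \<Longrightarrow> M \<inter> {48, 49} = {} \<Longrightarrow> value_ok s' m"
  by (simp add: value_ok_def sameD)

lemma run_tables_prog:
  assumes len: "has_length s l" and base: "s (7, 0) 0 = b"
    and zero: "\<And>h. h \<in> {19..25} \<union> {27, 29, 35, 36} \<Longrightarrow> s (h, 0) = (\<lambda>_. 0)"
  shows "run N X tables_prog (tables_factor * (q ^ 6 * N)) s tables"
proof -
  have "run N X size_prog (units size_prog) s sizes"
    using wp_run[OF wp_size_prog[OF len base zero]] by (auto intro: run_mono)
  from run_obtain[OF this, of "{16..25}"]
  obtain t1 s1 where 1: "t1 \<le> units size_prog" "big N X size_prog s t1 s1" "sizes s1" "same {16..25} s s1"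
    by (auto simp: size_prog_def)
  note s1 = 1(3)[unfolded sizes_def]
  have "run N X (divmod_prog 19 7 26 27) (b * 5 + 2) s1
      (\<lambda>s'. divmod s' 26 27 b \<and> same {4, 26, 27} s1 s')"
    using s1 zero[of 27] sameD[OF 1(4), of 27 0] sizes_le(6) by (intro run_divmod_prog) auto
  then obtain t2 s2 where 2: "t2 \<le> b * 5 + 2" "big N X (divmod_prog 19 7 26 27) s1 t2 s2"
    "divmod s2 26 27 b" "same {4, 26, 27} s1 s2" by (auto simp: run_def)
  have s2: "sizes s2" by (rule sizes_same[OF 1(3) 2(4)]) simp
  note c2 = same_Un[OF 1(4) 2(4)]
  have "run N X (divmod_prog 20 12 28 29) (B * 5 + 2) s2
      (\<lambda>s'. divmod s' 28 29 B \<and> same {4, 28, 29} s2 s')"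
    using s2[unfolded sizes_def has_length_def] zero[of 29] sameD[OF c2, of 29 0] sizes_le(7)
    by (intro run_divmod_prog) auto
  then obtain t3 s3 where 3: "t3 \<le> B * 5 + 2" "big N X (divmod_prog 20 12 28 29) s2 t3 s3"
    "divmod s3 28 29 B" "same {4, 28, 29} s2 s3" by (auto simp: run_def)
  have s3: "sizes s3" by (rule sizes_same[OF s2 3(4)]) simp
  note c3 = same_Un[OF c2 3(4)]
  obtain t4 s4 where 4: "t4 \<le> m1 + 2 * dd * (b * (4 * m1 + 3) + 2 * m1 + 2)"
    "big N X conv_prog s3 t4 s4" "\<forall>j<2 * dd. conv_ok s4 j" "same {4, 30, 31, 32, 33, 34} s3 s4"
    using run_obtain[OF run_conv_prog[OF 3(3)] mods_conv_prog] s3 by (auto simp: sizes_def)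
  have s4: "sizes s4" by (rule sizes_same[OF s3 4(4)]) simp
  note c4 = same_Un[OF c3 4(4)]
  have "run N X bits_prog (B * 9 + 2) s4 bits_ok"
    using s4 zero[of 35] zero[of 36] sameD[OF c4, of 35 0] sameD[OF c4, of 36 0]
    by (intro run_bits_prog) (auto simp: sizes_def)
  from run_obtain[OF this, of "{4, 35, 36, 40}"]
  obtain t5 s5 where 5: "t5 \<le> B * 9 + 2" "big N X bits_prog s4 t5 s5" "bits_ok s5"
    "same {4, 35, 36, 40} s4 s5" by (auto simp: bits_prog_def)
  have s5: "sizes s5" by (rule sizes_same[OF s4 5(4)]) simp
  have "mods step_prog \<subseteq> {4, 37, 38, 39, 40, 41}"
    by (auto simp: step_prog_def delta_prog_def step_row_def)
  from run_obtain[OF run_step_prog this, of s5]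
  obtain t6 s6 where 6: "t6 \<le> q * q * q + q * (S * (2 * (q * q) + 4) + 4)"
    "big N X step_prog s5 t6 s6" "\<forall>a<q. step_ok s6 a S" "same {4, 37, 38, 39, 40, 41} s5 s6"
    using s5 unfolding sizes_def by blast
  have s6: "sizes s6" by (rule sizes_same[OF s5 6(4)]) simp
  have "mods trans_prog \<subseteq> {4, 5, 40, 41, 42, 43, 44, 45, 46, 47}"
    by (auto simp: trans_prog_def trans_row_def)
  from run_obtain[OF run_trans_prog this, of s6]
  obtain t7 s7 where 7: "t7 \<le> S * (U * (4 * q + 4) + 9) + 3"
    "big N X trans_prog s6 t7 s7" "\<forall>x<S. s7 (43, 0) x = x * U \<and> trans_ok s7 x U"
    "same {4, 5, 40, 41, 42, 43, 44, 45, 46, 47} s6 s7"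
    using s6 6(3) unfolding sizes_def by blast
  have s7: "sizes s7" by (rule sizes_same[OF s6 7(4)]) simp
  have d7: "divmod s7 26 27 b"
    by (rule divmod_same[OF 2(3) same_Un[OF 3(4) same_Un[OF 4(4) same_Un[OF 5(4)
          same_Un[OF 6(4) 7(4)]]]]]) simp_all
  have "mods value_prog \<subseteq> {4, 30, 31, 48, 49, 50}"
    by (auto simp: value_prog_def split: if_splits)
  from run_obtain[OF run_value_prog this, of s7]
  obtain t8 s8 where 8: "t8 \<le> U * (q * (5 * m2 + 2) + 2) + m2 + 3"
    "big N X value_prog s7 t8 s8" "value_ok s8 U" "same {4, 30, 31, 48, 49, 50} s7 s8"
    using s7 d7 unfolding sizes_def by blast
  have s8: "sizes s8" by (rule sizes_same[OF s7 8(4)]) simp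
  have d8: "divmod s8 26 27 b" by (rule divmod_same[OF d7 8(4)]) simp_all
  have "mods out_prog \<subseteq> {4, 5, 30, 31, 42, 50, 51, 52}"
    by (auto simp: out_prog_def out_row_def)
  from run_obtain[OF run_out_prog this, of s8]
  obtain t9 s9 where 9: "t9 \<le> U * (E * (4 * m2 + 4) + m2 + 5) + 3"
    "big N X out_prog s8 t9 s9" "\<forall>u<U. s9 (51, 0) u = u * E \<and> out_ok s9 u E"
    "same {4, 5, 30, 31, 42, 50, 51, 52} s8 s9"
    using s8 d8 8(3) unfolding sizes_def by blast
  \<comment> \<open>The facts \<open>f8\<close> down to \<open>f3\<close> frame all stages after the
    eighth down to the third, so that every table is carried to the final store.\<close>
  note f8 = 9(4)
  note f7 = same_Un[OF 8(4) f8]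
  note f6 = same_Un[OF 7(4) f7]
  note f5 = same_Un[OF 6(4) f6]
  note f4 = same_Un[OF 5(4) f5]
  note f3 = same_Un[OF 4(4) f4]
  have "tables s9"
    unfolding tables_def
  proof (intro conjI)
    show "sizes s9" by (rule sizes_same[OF s8 f8]) simp
    show "divmod s9 26 27 b" by (rule divmod_same[OF d8 f8]) simp_all
    show "divmod s9 28 29 B" by (rule divmod_same[OF 3(3) f3]) simp_all
    show "\<forall>j<2 * dd. conv_ok s9 j" using 4(3) conv_ok_same[OF _ f4] by simp
    show "bits_ok s9" by (rule bits_ok_same[OF 5(3) f5]) simp
    show "\<forall>x<S. s9 (43, 0) x = x * U \<and> trans_ok s9 x U"
      using 7(3) sameD[OF f7, of 43 0] trans_ok_same[OF _ f7] by simp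
    show "value_ok s9 U" by (rule value_ok_same[OF 8(3) f8]) simp
  qed (rule 9(3))
  moreover have "big N X tables_prog s (t1 + (t2 + (t3 + (t4 + (t5 + (t6 + (t7 + (t8 + t9)))))))) s9"
    unfolding tables_prog_def
    by (rule big.Seq[OF 1(2) big.Seq[OF 2(2) big.Seq[OF 3(2) big.Seq[OF 4(2) big.Seq[OF 5(2)
          big.Seq[OF 6(2) big.Seq[OF 7(2) big.Seq[OF 8(2) 9(2)]]]]]]]])
  moreover have "t1 + (t2 + (t3 + (t4 + (t5 + (t6 + (t7 + (t8 + t9))))))) \<le> tables_factor * (q ^ 6 * N)"
  proof -
    define Y where "Y = q ^ 6 * N"
    have Y1: "1 \<le> Y" using q N by (simp add: Y_def Suc_le_eq)
    have le: "b \<le> Y" "B \<le> Y" "S \<le> Y" "U \<le> Y" "S * U \<le> Y" "U * E \<le> (kw + 1) * Y"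
    proof -
      show "S * U \<le> Y" using SU_le by (simp add: Y_def)
      moreover have "1 * U \<le> S * U" "S * 1 \<le> S * U" by (intro mult_le_mono; simp)+
      ultimately show "U \<le> Y" "S \<le> Y" by linarith+
      show "b \<le> Y" "B \<le> Y" using b_le B_le by (simp_all add: Y_def)
    qed (use UE_le in \<open>simp add: Y_def\<close>)
    note lin = linear_bound[OF _ Y1]
    have "t1 \<le> 10 * 1" using 1(1) by (simp add: size_prog_def)
    also have "\<dots> \<le> 10 * Y" using Y1 by (rule mult_le_mono2)
    finally have "t1 \<le> 10 * Y" .
    moreover have "t2 \<le> (5 + 2) * Y" using 2(1) lin[OF le(1), of 5 2] by (rule le_trans)
    moreover have "t3 \<le> (5 + 2) * Y" using 3(1) lin[OF le(2), of 5 2] by (rule le_trans)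
    moreover have "t4 \<le> b * (2 * dd * (4 * m1 + 3)) + (m1 + 2 * dd * (2 * m1 + 2))"
      using 4(1) by (simp add: algebra_simps)
    then have "t4 \<le> (2 * dd * (4 * m1 + 3) + (m1 + 2 * dd * (2 * m1 + 2))) * Y"
      using lin[OF le(1)] by (rule le_trans)
    moreover have "t5 \<le> (9 + 2) * Y" using 5(1) lin[OF le(2), of 9 2] by (rule le_trans)
    moreover have "t6 \<le> S * (q * (2 * (q * q) + 4)) + (q * q * q + q * 4)"
      using 6(1) by (simp add: algebra_simps del: wcount.simps)
    then have "t6 \<le> (q * (2 * (q * q) + 4) + (q * q * q + q * 4)) * Y"
      using lin[OF le(3)] by (rule le_trans)
    moreover have "t7 \<le> S * U * (4 * q + 4) + (S * 9 + 3)"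
      using 7(1) by (simp add: algebra_simps del: wcount.simps)
    then have "t7 \<le> ((4 * q + 4) + (9 + 3)) * Y"
      using lin[OF le(5), of "4 * q + 4" 0] lin[OF le(3), of 9 3] unfolding add_mult_distrib by linarith
    moreover have "t8 \<le> (q * (5 * m2 + 2) + 2 + (m2 + 3)) * Y"
      using 8(1) lin[OF le(4), of "q * (5 * m2 + 2) + 2" "m2 + 3"] by linarith
    moreover have "t9 \<le> U * E * (4 * m2 + 4) + (U * (m2 + 5) + 3)"
      using 9(1) by (simp add: algebra_simps del: wcount.simps)
    then have "t9 \<le> ((4 * m2 + 4) * (kw + 1) + (m2 + 5 + 3)) * Y"
    proof -
      have "U * E * (4 * m2 + 4) \<le> (kw + 1) * Y * (4 * m2 + 4)"
        using le(6) by (rule mult_le_mono1)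
      also have "\<dots> = (4 * m2 + 4) * (kw + 1) * Y" by (simp only: mult_ac)
      finally have "U * E * (4 * m2 + 4) \<le> (4 * m2 + 4) * (kw + 1) * Y" .
      moreover have "U * (m2 + 5) + 3 \<le> (m2 + 5 + 3) * Y" by (rule lin[OF le(4)])
      ultimately show ?thesis
        using \<open>t9 \<le> U * E * (4 * m2 + 4) + (U * (m2 + 5) + 3)\<close> unfolding add_mult_distrib[of _ _ Y]
        by linarith
    qed
    ultimately show ?thesis
      unfolding tables_factor_def Y_def[symmetric] add_mult_distrib[of _ _ Y] by linarith
  qed
  ultimately show ?thesis unfolding run_def by blast
qed

end

section \<open>The operation\<close>

context coded_operation
begin

text \<open>Blocks arrive with the most significant first, and \<open>(54, 0)\<close> tells whether
  a nonzero one has occurred. Until then a zero block gives the empty word, except that the last one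
  spells zero; the first nonzero block is written without leading zeros, all later ones with
  them.\<close>

definition block_prog :: "nat \<Rightarrow> nat \<Rightarrow> com" where
  "block_prog j w = If0 (Var (54, 0))
     (If0 (Var (32, j)) ((55, w) ::= (if j = 0 then Idx (35, 0) (Var (32, 0)) else Const 0))
       ((55, w) ::= Idx (35, 0) (Var (32, j)) ;; (54, 0) ::= Const 1))
     ((55, w) ::= Idx (36, 0) (AddV (Var (32, j)) (12, 0)))"

definition convert_prog :: "nat \<Rightarrow> com" where
  "convert_prog i = const_digits 32 0 m1 ;; seqs (map (\<lambda>j.
     move_digits 53 0 (Const 0) 34 (j * m1) (Var (0, i * (2 * dd) + j)) m1 ;;
     add_digits 28 29 32 53 0 m1) [0..<2 * dd])"

text \<open>The last slot of an operand is for the separator: \<open>zs + 1\<close> codes the word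
  with the single letter \<open>zs\<close>, and 0 the empty word after the last operand.\<close>

definition operand_prog :: "nat \<Rightarrow> com" where
  "operand_prog i = convert_prog i ;; (54, 0) ::= Const 0 ;;
     seqs (map (\<lambda>k. block_prog (m1 - 1 - k) (i * (m1 + 1) + k)) [0..<m1]) ;;
     (55, i * (m1 + 1) + m1) ::= Const (if Suc i < r then zs + 1 else 0)"

definition pad_prog :: com where
  "pad_prog = seqs (map (\<lambda>g. (55, kw0 + g) ::= Var (14, 0)) [0..<c * kw0])"

text \<open>\<open>(56, 0)\<close> carries the state of the cascade from one word to the next. The
  cascade preserves lengths, so each output word fits into the slot of its input.\<close>

definition pass_prog :: com where
  "pass_prog = (56, 0) ::= Var (15, 0) ;; seqs (map (\<lambda>w.
     (42, 0) ::= AddV (Idx (43, 0) (Var (56, 0))) (55, w) ;;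
     (55, w) ::= Idx (45, 0) (Var (42, 0)) ;;
     (56, 0) ::= Idx (44, 0) (Var (42, 0))) [0..<kw])"

text \<open>\<open>(57, 0)\<close> counts the letters to the right of the current word, which is the
  power of two its value is multiplied by. For this reason words are visited from right to
  left.\<close>

definition gather_step :: "nat \<Rightarrow> com" where
  "gather_step w = (42, 0) ::= AddV (Idx (51, 0) (Var (55, w))) (57, 0) ;;
     move_digits 53 0 (Const 0) 52 0 (Var (42, 0)) m2 ;;
     add_digits 26 27 58 53 0 m2 ;;
     (57, 0) ::= AddV (Idx (49, 0) (Var (55, w))) (57, 0)"

definition gather_prog :: com where
  "gather_prog = (57, 0) ::= Const 0 ;; const_digits 58 0 m2 ;;
     seqs (map (\<lambda>i. gather_step (kw - 1 - i)) [0..<kw])"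

definition oper_prog :: com where
  "oper_prog = seqs (map operand_prog [0..<r]) ;; pad_prog ;;
     seqs (map (\<lambda>g. pass_prog) [0..<c * kw0]) ;; gather_prog"

end

lemma word_value_less: "word_value z f w < 2 ^ length w"
proof (induction w rule: rev_induct)
  case (snoc a w)
  then have "2 * word_value z f w + 1 < 2 ^ length (w @ [a])" by simp
  then show ?case by (simp add: of_bool_def)
qed simp

lemma operands_word_concat:
  "operands_word Xs = concat (map (\<lambda>i. map Bit (binary (Xs ! i)) @
     (if Suc i < length Xs then [Semicolon] else [])) [0..<length Xs])"
proof (induction Xs rule: operands_word.induct)
  case (3 x y xs)
  have "[0..<length (x # y # xs)] = 0 # map Suc [0..<length (y # xs)]"
    using upt_conv_Cons[of 0 "length (x # y # xs)"] by (simp add: map_Suc_upt del: upt_Suc)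
  then show ?case using 3 by (simp add: comp_def del: upt_Suc)
qed simp_all

lemma base_square: "N \<le> base N * base N"
proof -
  have "sqrt (real N) \<le> real (nat \<lceil>sqrt (real N)\<rceil>)" by (simp add: real_nat_ceiling_ge)
  also have "\<dots> \<le> real (base N)" by (simp add: base_def)
  finally have "sqrt (real N) ^ 2 \<le> real (base N) ^ 2" by (intro power_mono) auto
  then have "real N \<le> real (base N * base N)" by (simp add: power2_eq_square)
  then show ?thesis by linarith
qed

section \<open>Correctness of the operation\<close>

context coded_tables
begin

abbreviation word :: "store \<Rightarrow> nat \<Rightarrow> nat list" where
  "word s w \<equiv> dec q (s (55, w) 0)"

definition words :: "store \<Rightarrow> nat \<Rightarrow> nat list \<Rightarrow> bool" where
  "words s k W \<longleftrightarrow> concat (map (word s) [0..<k]) = W \<and> (\<forall>w<k. length (word s w) \<le> l)"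

lemma words_snoc:
  assumes "words s k W" "\<And>w. w < k \<Longrightarrow> s' (55, w) 0 = s (55, w) 0"
    and "word s' k = v" "length v \<le> l"
  shows "words s' (Suc k) (W @ v)"
proof -
  have m: "map (word s') [0..<k] = map (word s) [0..<k]" using assms(2) by simp
  have "concat (map (word s') [0..<k]) = W"
    unfolding m using assms(1)[unfolded words_def] by blast
  then show ?thesis using assms by (simp add: words_def less_Suc_eq)
qed

lemma words_same: "words s k W \<Longrightarrow> same M s s' \<Longrightarrow> 55 \<notin> M \<Longrightarrow> words s' k W"
  by (simp add: words_def sameD)

lemma length_words: "words s k W \<Longrightarrow> length W \<le> k * l"
proof -
  assume W: "words s k W"
  have "length (concat (map (word s) [0..<j])) \<le> j * l" if "j \<le> k" for j
    using that by (induction j) (use W in \<open>auto simp: words_def add.commute Suc_le_eq intro: add_mono\<close>)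
  then show ?thesis using W by (auto simp: words_def)
qed

lemma word_less: "words s k W \<Longrightarrow> w < k \<Longrightarrow> s (55, w) 0 < U"
  using length_word by (simp add: words_def)

text \<open>What has been spelled when the blocks read so far have value \<open>Y\<close> and
  \<open>j\<close> blocks remain: nothing while \<open>Y\<close> is zero, unless no block is left
  and zero itself has to be written.\<close>

definition bits_from :: "nat \<Rightarrow> nat \<Rightarrow> nat list" where
  "bits_from j Y = (if j = 0 \<or> 0 < Y then map zb (binary Y) else [])"

lemma dec_bits: "dec q (enc q (map zb w)) = map zb w"
  using letters by (intro dec_enc) auto

text \<open>A Horner step from \<open>Y\<close> to \<open>Y * B + D\<close>. For positive
  \<open>Y\<close> the padded block is appended by \<open>binary_append\<close>; otherwise the
  number begins with \<open>D\<close>.\<close>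

lemma wp_block_prog:
  assumes bits: "bits_ok s" and B: "s (12, 0) 0 = B" and digit: "s (32, j) 0 = D" "D < B"
    and flag: "s (54, 0) 0 = of_bool (Y \<noteq> 0)" and W: "words s w (W @ bits_from (Suc j) Y)"
  shows "wp N X (block_prog j w) (\<lambda>s'. s' (54, 0) 0 = of_bool (Y * B + D \<noteq> 0) \<and>
    words s' (Suc w) (W @ bits_from j (Y * B + D))) s"
proof (cases "Y = 0")
  case True
  have W': "words s w W" using W True by (simp add: bits_from_def)
  have D: "s (35, 0) D = enc q (map zb (binary D))" using bits digit(2) by (simp add: bits_ok_def)
  have len: "length (binary D) \<le> l" using length_binary[OF digit(2) l(1)] .
  show ?thesis
  proof (cases "D = 0")
    case True
    have "words (upd s (55, w) 0 (if j = 0 then s (35, 0) D else 0)) (Suc w) (W @ bits_from j D)"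
      using D len True by (intro words_snoc[OF W']) (auto simp: dec_bits bits_from_def)
    then show ?thesis
      using \<open>Y = 0\<close> True flag digit by (auto simp: block_prog_def)
  next
    case False
    have "words (upd (upd s (55, w) 0 (s (35, 0) D)) (54, 0) 0 1) (Suc w) (W @ bits_from j D)"
      using D len False by (intro words_snoc[OF W']) (auto simp: dec_bits bits_from_def)
    then show ?thesis
      using \<open>Y = 0\<close> False flag digit X1 by (auto simp: block_prog_def)
  qed
next
  case False
  have D: "s (36, 0) (B + D) = enc q (map zb (tl (binary (B + D))))"
    using bits digit(2) by (simp add: bits_ok_def)
  have e: "bits_from j (Y * B + D) = bits_from (Suc j) Y @ map zb (tl (binary (B + D)))"
    using False binary_append[of Y D l] digit(2) by (simp add: bits_from_def)
  have "words (upd s (55, w) 0 (s (36, 0) (B + D))) (Suc w) ((W @ bits_from (Suc j) Y) @ map zb (tl (binary (B + D))))"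
    using D length_binary_ge[OF digit(2)] by (intro words_snoc[OF W]) (auto simp: dec_bits)
  moreover have "B + D \<le> X" using digit(2) sizes_le(7) by linarith
  ultimately show ?thesis
    using False flag digit B unfolding e by (simp add: block_prog_def add.commute)
qed

lemma tablesD:
  assumes "tables s"
  shows "sizes s" "divmod s 26 27 b" "divmod s 28 29 B" "\<forall>j<2 * dd. conv_ok s j" "bits_ok s"
    "\<forall>x<S. s (43, 0) x = x * U \<and> trans_ok s x U" "value_ok s U"
    "\<forall>u<U. s (51, 0) u = u * E \<and> out_ok s u E"
  using assms unfolding tables_def by blast+

lemma tablesD_vars:
  assumes "tables s"
  shows "s (12, 0) 0 = B" "s (14, 0) 0 = enc q (replicate l z)"
    "s (15, 0) 0 = enc (q * q) (replicate l (z * q + z))"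
  using tablesD(1)[OF assms] unfolding sizes_def has_length_def by blast+

lemma wp_convert_prog:
  assumes T: "tables s" and input: "\<And>j. j < 2 * dd \<Longrightarrow> s (0, i * (2 * dd) + j) 0 = dg b j x"
  shows "wp N X (convert_prog i) (\<lambda>s'. number s' 32 B m1 (x mod b ^ (2 * dd)) \<and>
    same {30, 31, 32, 53} s s') s"
proof -
  let ?f = "\<lambda>j. move_digits 53 0 (Const 0) 34 (j * m1) (Var (0, i * (2 * dd) + j)) m1 ;;
     add_digits 28 29 32 53 0 m1"
  have loop: "wp N X (seqs (map ?f [0..<2 * dd])) (\<lambda>s'. number s' 32 B m1 (x mod b ^ (2 * dd))) s1"
    if s1: "number s1 32 B m1 0" "same {32} s s1" for s1
  \<comment> \<open>The sum of the first \<open>j\<close> digits times their powers of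
    \<open>b\<close> is the remainder of \<open>x\<close> modulo \<open>b ^ j\<close>.\<close>
  proof (rule wp_seqs[where M = "{30, 31, 32, 53}" and I = "\<lambda>j s'. number s' 32 B m1 (x mod b ^ j)"])
    fix j s2
    assume j: "j < 2 * dd" and I: "number s2 32 B m1 (x mod b ^ j)" and s2: "same {30, 31, 32, 53} s1 s2"
    let ?x = "dg b j x"
    have s12: "same ({32} \<union> {30, 31, 32, 53}) s s2" by (rule same_Un[OF s1(2) s2])
    have in2: "s2 (0, i * (2 * dd) + j) 0 = ?x"
      using input[OF j] sameD[OF s12] by simp
    have x: "?x < b" using b2 by (simp add: dg_less)
    have conv: "s2 (34, j * m1 + k) ?x = dg B k (?x * b ^ j)" if "k < m1" for k
      using tablesD(4)[OF T] that x j sameD[OF s12] by (simp add: conv_ok_def)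
    show "wp N X (?f j) (\<lambda>s'. number s' 32 B m1 (x mod b ^ Suc j)) s2"
      unfolding wp.simps(3)
    proof (rule wp_move_digits[where ?v1.0 = 0 and ?v2.0 = ?x])
      fix s3
      assume s3: "\<And>k y. s3 (53, k) y = (if 0 \<le> k \<and> k < 0 + m1 \<and> y = 0
        then s2 (34, j * m1 + (k - 0)) ?x else s2 (53, k) y)" "same {53} s2 s3"
      show "wp N X (add_digits 28 29 32 53 0 m1) (\<lambda>s'. number s' 32 B m1 (x mod b ^ Suc j)) s3"
      proof (rule wp_add_digits[OF _ _ _ B2 sizes_le(7)])
        show "number s3 32 B m1 (x mod b ^ j)" using number_same[OF I s3(2)] by simp
        show "number s3 53 B m1 (?x * b ^ j)" using s3(1) conv by (simp add: number_def)
        show "divmod s3 28 29 B"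
          using tablesD(3)[OF T] divmod_same[OF _ same_Un[OF s12 s3(2)]] by simp
        fix s4
        assume "number s4 32 B m1 (x mod b ^ j + ?x * b ^ j + 0)"
        then show "number s4 32 B m1 (x mod b ^ Suc j)" by (simp only: mod_power_Suc mult.commute add_0_right)
      qed simp_all
    next
      fix s3
      assume "same {53} s2 s3"
      then show "eval N s3 (Var (0, i * (2 * dd) + j)) = ?x \<and> fits N X s3 (Var (0, i * (2 * dd) + j))"
        using in2 by (simp add: sameD)
    qed auto
  qed (use s1 in auto)
  have "wp N X (const_digits 32 0 m1) (\<lambda>s1. number s1 32 B m1 0 \<and> same {32} s s1) s"
    using B2 by (intro wp_const_digits) auto
  then have "wp N X (convert_prog i) (\<lambda>s'. number s' 32 B m1 (x mod b ^ (2 * dd))) s"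
    unfolding convert_prog_def wp.simps by (rule wp_mono) (use loop in auto)
  then show ?thesis by (rule wp_same) (auto simp: convert_prog_def)
qed

text \<open>The set consists of scratch arrays, the operand array 0 and everything from 53 on, none
  of which contains a table.\<close>

lemma tables_same: "tables s \<Longrightarrow> same M s s' \<Longrightarrow> M \<subseteq> {0, 4, 5, 30, 31, 32, 33, 40, 41, 42, 46, 47, 50} \<union> {53..}
  \<Longrightarrow> tables s'"
proof -
  assume T: "tables s" and s': "same M s s'"
    and M: "M \<subseteq> {0, 4, 5, 30, 31, 32, 33, 40, 41, 42, 46, 47, 50} \<union> {53..}"
  let ?M = "{0, 4, 5, 30, 31, 32, 33, 40, 41, 42, 46, 47, 50} \<union> {53..}"
  have s: "same ?M s s'" by (rule same_mono[OF s' M])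
  show ?thesis
    unfolding tables_def
  proof (intro conjI)
    show "sizes s'" by (rule sizes_same[OF tablesD(1)[OF T] s]) auto
    show "divmod s' 26 27 b" by (rule divmod_same[OF tablesD(2)[OF T] s]) auto
    show "divmod s' 28 29 B" by (rule divmod_same[OF tablesD(3)[OF T] s]) auto
    show "\<forall>j<2 * dd. conv_ok s' j" using tablesD(4)[OF T] conv_ok_same[OF _ s] by auto
    show "bits_ok s'" by (rule bits_ok_same[OF tablesD(5)[OF T] s]) auto
    show "\<forall>x<S. s' (43, 0) x = x * U \<and> trans_ok s' x U"
      using tablesD(6)[OF T] sameD[OF s, of 43 0] trans_ok_same[OF _ s] by auto
    show "value_ok s' U" by (rule value_ok_same[OF tablesD(7)[OF T] s]) auto
    have "s' (51, 0) = s (51, 0)" "\<And>j. s' (52, j) = s (52, j)" using sameD[OF s] by auto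
    then show "\<forall>u<U. s' (51, 0) u = u * E \<and> out_ok s' u E"
      using tablesD(8)[OF T] unfolding out_ok_def by simp
  qed
qed

text \<open>Origin of \<open>m1 = 3 * q * dd\<close>: from \<open>q <= 2 ^ q\<close> follows
  \<open>N <= q ^ (3 * l) <= B ^ (3 * q)\<close>. The first bound rests on
  \<open>N <= b * b\<close>.\<close>

lemma operand_less:
  assumes "x < N ^ dd"
  shows "x < b ^ (2 * dd)" and "x < B ^ m1"
proof -
  have "N ^ dd \<le> (b * b) ^ dd" by (rule power_mono[OF base_square]) simp
  also have "\<dots> = b ^ (2 * dd)" by (simp add: power_mult power2_eq_square)
  finally show "x < b ^ (2 * dd)" using assms by linarith
  have "q \<le> 2 ^ q" using less_exp[of q] by linarith
  then have "q ^ (3 * l) \<le> (2 ^ q) ^ (3 * l)" by (rule power_mono) simp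
  also have "\<dots> = B ^ (3 * q)" by (simp add: power_mult[symmetric] mult.commute mult.left_commute)
  finally have "N \<le> B ^ (3 * q)" using l(2) by linarith
  then have "N ^ dd \<le> (B ^ (3 * q)) ^ dd" by (rule power_mono) simp
  also have "\<dots> = B ^ m1" by (simp add: m1_def power_mult)
  finally show "x < B ^ m1" using assms by linarith
qed

lemma div_power_step: "x div \<beta> ^ j = x div \<beta> ^ Suc j * \<beta> + dg \<beta> j x" for x \<beta> :: nat
  unfolding dg_def power_Suc2 div_mult2_eq by (rule div_mult_mod_eq[symmetric])

lemma wp_operand_prog:
  assumes dd: "1 \<le> dd" and T: "tables s"
    and input: "\<And>j. j < 2 * dd \<Longrightarrow> s (0, i * (2 * dd) + j) 0 = dg b j x" and x: "x < N ^ dd"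
    and W: "words s (i * (m1 + 1)) W"
  shows "wp N X (operand_prog i) (\<lambda>s'. words s' (Suc i * (m1 + 1))
    (W @ map zb (binary x) @ (if Suc i < r then [zs] else []))) s"
proof -
  have m1: "0 < m1" using dd q by (simp add: m1_def)
  let ?k = "i * (m1 + 1)"
  let ?M = "{30, 31, 32, 53, 54, 55}"
  let ?f = "\<lambda>k. block_prog (m1 - 1 - k) (?k + k)"
  let ?end = "(55, ?k + m1) ::= Const (if Suc i < r then zs + 1 else 0)"
  let ?Q = "\<lambda>s'. words s' (Suc i * (m1 + 1)) (W @ map zb (binary x) @ (if Suc i < r then [zs] else []))"
  have blocks: "wp N X (seqs (map ?f [0..<m1])) (\<lambda>s'. words s' (?k + m1) (W @ map zb (binary x))) s2"
    if s2: "number s2 32 B m1 x" "s2 (54, 0) 0 = 0" "same ({30, 31, 32, 53} \<union> {54}) s s2" for s2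
  \<comment> \<open>After \<open>k\<close> blocks the number spelled is
    \<open>x div B ^ (m1 - k)\<close>, which is 0 at the start because
    \<open>x < B ^ m1\<close>.\<close>
  proof (rule wp_seqs[where M = "{54, 55}" and I = "\<lambda>k s'. s' (54, 0) 0 = of_bool (x div B ^ (m1 - k) \<noteq> 0) \<and>
       words s' (?k + k) (W @ bits_from (m1 - k) (x div B ^ (m1 - k)))"])
    show "s2 (54, 0) 0 = of_bool (x div B ^ (m1 - 0) \<noteq> 0) \<and>
       words s2 (?k + 0) (W @ bits_from (m1 - 0) (x div B ^ (m1 - 0)))"
      using operand_less(2)[OF x] s2 words_same[OF W s2(3)] m1 by (simp add: bits_from_def)
  next
    fix k s3
    assume k: "k < m1" and I: "s3 (54, 0) 0 = of_bool (x div B ^ (m1 - k) \<noteq> 0) \<and>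
       words s3 (?k + k) (W @ bits_from (m1 - k) (x div B ^ (m1 - k)))" and s3: "same {54, 55} s2 s3"
    define j where "j = m1 - 1 - k"
    have j: "m1 - k = Suc j" "m1 - Suc k = j" "j < m1" using k by (simp_all add: j_def)
    have T3: "tables s3" by (rule tables_same[OF T same_Un[OF s2(3) s3]]) auto
    have "s3 (32, j) 0 = dg B j x" using s2(1) j sameD[OF s3] by (simp add: number_def)
    moreover have "dg B j x < B" by (simp add: dg_less)
    ultimately have "wp N X (block_prog j (?k + k)) (\<lambda>s'. s' (54, 0) 0 = of_bool (x div B ^ Suc j * B + dg B j x \<noteq> 0) \<and>
        words s' (Suc (?k + k)) (W @ bits_from j (x div B ^ Suc j * B + dg B j x))) s3"
      using tablesD(5)[OF T3] tablesD_vars(1)[OF T3] I unfolding j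
      by (intro wp_block_prog) auto
    then show "wp N X (?f k) (\<lambda>s'. s' (54, 0) 0 = of_bool (x div B ^ (m1 - Suc k) \<noteq> 0) \<and>
       words s' (?k + Suc k) (W @ bits_from (m1 - Suc k) (x div B ^ (m1 - Suc k)))) s3"
      unfolding j(2) div_power_step[symmetric] by (simp add: j_def)
  qed (auto simp: block_prog_def bits_from_def)
  have fin: "wp N X ?end ?Q s3" if s3: "words s3 (?k + m1) (W @ map zb (binary x))" for s3
  proof -
    let ?s = "upd s3 (55, ?k + m1) 0 (if Suc i < r then zs + 1 else 0)"
    have "words ?s (Suc (?k + m1)) ((W @ map zb (binary x)) @ (if Suc i < r then [zs] else []))"
      using l(1) letters dec_snoc[of zs q 0] by (intro words_snoc[OF s3]) auto
    moreover have "Suc i * (m1 + 1) = Suc (?k + m1)" by simp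
    ultimately have "?Q ?s" by (simp only: append_assoc)
    moreover have "zs + 1 \<le> X" using letters q_power_le[of 1] X6 by simp
    ultimately show ?thesis by (cases "Suc i < r") simp_all
  qed
  have "wp N X (convert_prog i) (\<lambda>s'. number s' 32 B m1 x \<and> same {30, 31, 32, 53} s s') s"
    using wp_convert_prog[where x = x, OF T input] operand_less(1)[OF x] by simp
  then show ?thesis
    unfolding operand_prog_def wp.simps(3)
  proof (rule wp_mono)
    fix s1
    assume s1: "number s1 32 B m1 x \<and> same {30, 31, 32, 53} s s1"
    have "same {54} s1 (upd s1 (54, 0) 0 0)" by simp
    from same_Un[OF conjunct2[OF s1] this]
    have "wp N X (seqs (map ?f [0..<m1])) (\<lambda>s'. words s' (?k + m1) (W @ map zb (binary x))) (upd s1 (54, 0) 0 0)"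
      using s1 by (intro blocks) (auto simp: number_def)
    then have "wp N X (seqs (map ?f [0..<m1])) (wp N X ?end ?Q) (upd s1 (54, 0) 0 0)"
      by (rule wp_mono) (rule fin)
    then show "wp N X ((54, 0) ::= Const 0) (wp N X (seqs (map ?f [0..<m1])) (wp N X ?end ?Q)) s1"
      by simp
  qed
qed

lemma wp_operands:
  assumes dd: "1 \<le> dd" and T: "tables s" and Xs: "length Xs = r" "\<And>x. x \<in> set Xs \<Longrightarrow> x < N ^ dd"
    and input: "\<And>i j. i < r \<Longrightarrow> j < 2 * dd \<Longrightarrow> s (0, i * (2 * dd) + j) 0 = dg b j (Xs ! i)"
  shows "wp N X (seqs (map operand_prog [0..<r])) (\<lambda>s'.
    words s' kw0 (map (letter z0 z1 zs) (operands_word Xs)) \<and> same {30, 31, 32, 53, 54, 55} s s') s"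
proof -
  define f where "f i = map zb (binary (Xs ! i)) @ (if Suc i < r then [zs] else [])" for i
  have mods: "mods (operand_prog i) \<subseteq> {30, 31, 32, 53, 54, 55}" for i
    by (auto simp: operand_prog_def convert_prog_def block_prog_def)
  have "wp N X (seqs (map operand_prog [0..<r])) (\<lambda>s'. words s' kw0 (map (letter z0 z1 zs) (operands_word Xs))) s"
  proof (rule wp_seqs[where M = "{30, 31, 32, 53, 54, 55}" and
        I = "\<lambda>i s'. words s' (i * (m1 + 1)) (concat (map f [0..<i]))"])
    show "words s (0 * (m1 + 1)) (concat (map f [0..<0]))" by (simp add: words_def)
  next
    fix i s1
    assume i: "i < r" and I: "words s1 (i * (m1 + 1)) (concat (map f [0..<i]))"
      and s1: "same {30, 31, 32, 53, 54, 55} s s1"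
    have "tables s1" by (rule tables_same[OF T s1]) auto
    moreover have "s1 (0, i * (2 * dd) + j) 0 = dg b j (Xs ! i)" if "j < 2 * dd" for j
      using input[OF i that] sameD[OF s1] by simp
    moreover have "Xs ! i < N ^ dd" using Xs i by simp
    ultimately have "wp N X (operand_prog i) (\<lambda>s'. words s' (Suc i * (m1 + 1))
      (concat (map f [0..<i]) @ map zb (binary (Xs ! i)) @ (if Suc i < r then [zs] else []))) s1"
      using I by (rule wp_operand_prog[OF dd])
    then show "wp N X (operand_prog i) (\<lambda>s'. words s' (Suc i * (m1 + 1)) (concat (map f [0..<Suc i]))) s1"
      by (simp add: f_def)
  next
    fix s1
    assume "words s1 (r * (m1 + 1)) (concat (map f [0..<r]))"
    moreover have "concat (map f [0..<r]) = map (letter z0 z1 zs) (operands_word Xs)"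
      unfolding operands_word_concat Xs(1) map_concat map_map
      by (intro arg_cong[where f = concat] map_cong) (auto simp: f_def letter_def)
    ultimately show "words s1 kw0 (map (letter z0 z1 zs) (operands_word Xs))" by (simp add: kw0_def)
  qed (rule mods)
  then show ?thesis by (rule wp_same) (use mods in auto)
qed

lemma wp_pad_prog:
  assumes T: "tables s" and W: "words s kw0 W"
  shows "wp N X pad_prog (\<lambda>s'. words s' kw (W @ replicate (c * kw0 * l) z) \<and> same {55} s s') s"
proof -
  have "wp N X pad_prog (\<lambda>s'. words s' kw (W @ replicate (c * kw0 * l) z)) s"
    unfolding pad_prog_def
  proof (rule wp_seqs[where M = "{55}" and I = "\<lambda>g s'. words s' (kw0 + g) (W @ replicate (g * l) z)"])
    fix g s1
    assume I: "words s1 (kw0 + g) (W @ replicate (g * l) z)" and s1: "same {55} s s1"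
    have "s1 (14, 0) 0 = enc q (replicate l z)"
      using tablesD_vars(2)[OF T] sameD[OF s1] by simp
    moreover have "dec q (enc q (replicate l z)) = replicate l z"
      using letters by (intro dec_enc) auto
    ultimately have "words (upd s1 (55, kw0 + g) 0 (s1 (14, 0) 0)) (Suc (kw0 + g))
        ((W @ replicate (g * l) z) @ replicate l z)"
      by (intro words_snoc[OF I]) auto
    moreover have "(W @ replicate (g * l) z) @ replicate l z = W @ replicate (Suc g * l) z"
      by (simp add: replicate_add[symmetric] add.commute)
    ultimately show "wp N X ((55, kw0 + g) ::= Var (14, 0))
        (\<lambda>s'. words s' (kw0 + Suc g) (W @ replicate (Suc g * l) z)) s1"
      by simp
  qed (use W in \<open>auto simp: kw_def\<close>)
  then show ?thesis by (rule wp_same) (auto simp: pad_prog_def)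
qed

text \<open>By \<open>sts_append\<close> and \<open>outs_append\<close>, treating the slots one
  after the other equals running the cascade over their concatenation; \<open>outs_replicate\<close>
  then turns the \<open>l\<close> machines into \<open>l\<close> steps.\<close>

lemma wp_pass_prog:
  assumes T: "tables s" and W: "words s kw W"
  shows "wp N X pass_prog (\<lambda>s'. words s' kw ((mealy d z z ^^ l) W)) s"
proof -
  define V where "V w = word s w" for w
  define \<sigma> where "\<sigma> = replicate l (z * q + z)"
  let ?f = "\<lambda>w. (42, 0) ::= AddV (Idx (43, 0) (Var (56, 0))) (55, w) ;;
     (55, w) ::= Idx (45, 0) (Var (42, 0)) ;; (56, 0) ::= Idx (44, 0) (Var (42, 0))"
  let ?pre = "\<lambda>w. concat (map V [0..<w])"
  have V: "set (V w) \<subseteq> {..<q}" for w using set_dec[OF q_pos] by (simp add: V_def)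
  then have pre: "set (?pre w) \<subseteq> {..<q}" for w by auto
  have \<sigma>: "set \<sigma> \<subseteq> {..<q * q}" "length \<sigma> = l"
    using letters pair_code_less[of z z] by (auto simp: \<sigma>_def)
  have dec_state: "dec (q * q) (enc (q * q) (sts \<sigma> (?pre w))) = sts \<sigma> (?pre w)" for w
    by (intro dec_enc set_sts \<sigma> pre)
  have state_less: "enc (q * q) (sts \<sigma> (?pre w)) < S" for w
    using \<sigma> by (intro enc_state_less set_sts pre) simp_all
  let ?s1 = "upd s (56, 0) 0 (enc (q * q) \<sigma>)"
  have "wp N X (seqs (map ?f [0..<kw])) (\<lambda>s'. words s' kw ((mealy d z z ^^ l) W)) ?s1"
  proof (rule wp_seqs[where M = "{42, 55, 56}" and I = "\<lambda>w s'. s' (56, 0) 0 = enc (q * q) (sts \<sigma> (?pre w)) \<and>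
      words s' w (outs \<sigma> (?pre w)) \<and> (\<forall>w'. w \<le> w' \<longrightarrow> s' (55, w') 0 = s (55, w') 0)"])
    show "?s1 (56, 0) 0 = enc (q * q) (sts \<sigma> (?pre 0)) \<and> words ?s1 0 (outs \<sigma> (?pre 0)) \<and>
        (\<forall>w'. 0 \<le> w' \<longrightarrow> ?s1 (55, w') 0 = s (55, w') 0)"
      by (simp add: words_def)
  next
    fix w s2
    assume w: "w < kw" and I: "s2 (56, 0) 0 = enc (q * q) (sts \<sigma> (?pre w)) \<and>
      words s2 w (outs \<sigma> (?pre w)) \<and> (\<forall>w'. w \<le> w' \<longrightarrow> s2 (55, w') 0 = s (55, w') 0)"
      and s2: "same {42, 55, 56} ?s1 s2"
    define x where "x = enc (q * q) (sts \<sigma> (?pre w))"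
    define u where "u = s (55, w) 0"
    have "same {42, 55, 56} s ?s1" by simp
    then have T2: "tables s2" using tables_same[OF T same_trans[OF _ s2]] by simp
    have u: "u < U" unfolding u_def by (rule word_less[OF W w])
    have x: "x < S" unfolding x_def by (rule state_less)
    have tab: "s2 (43, 0) x = x * U" "s2 (44, 0) (x * U + u) = trans_state x u"
      "s2 (45, 0) (x * U + u) = trans_out x u"
      using tablesD(6)[OF T2] x u unfolding trans_ok_def by blast+
    have "Suc x * U \<le> S * U" using x by (intro mult_le_mono1) simp
    then have xu: "x * U + u \<le> X" using u sizes_le(8) by (simp del: wcount.simps)
    have x': "dec (q * q) x = sts \<sigma> (?pre w)" unfolding x_def by (rule dec_state)
    have V': "dec q u = V w" by (simp add: u_def V_def)
    have o: "dec q (trans_out x u) = outs (sts \<sigma> (?pre w)) (V w)"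
      unfolding x' V' by (intro dec_enc set_outs set_sts \<sigma> pre V)
    let ?s3 = "upd (upd (upd s2 (42, 0) 0 (x * U + u)) (55, w) 0 (trans_out x u)) (56, 0) 0 (trans_state x u)"
    have "words ?s3 (Suc w) (outs \<sigma> (?pre w) @ outs (sts \<sigma> (?pre w)) (V w))"
    proof (rule words_snoc)
      show "words s2 w (outs \<sigma> (?pre w))" using I by blast
      show "length (outs (sts \<sigma> (?pre w)) (V w)) \<le> l"
        using u length_word[of u] V' by simp
    qed (use o in auto)
    then have "words ?s3 (Suc w) (outs \<sigma> (?pre (Suc w)))" by (simp add: outs_append)
    moreover have "trans_state x u = enc (q * q) (sts \<sigma> (?pre (Suc w)))"
      by (simp add: x' V' sts_append)
    moreover have "s2 (55, w) 0 = u" "s2 (56, 0) 0 = x" using I by (simp_all add: u_def x_def)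
    ultimately show "wp N X (?f w) (\<lambda>s'. s' (56, 0) 0 = enc (q * q) (sts \<sigma> (?pre (Suc w))) \<and>
      words s' (Suc w) (outs \<sigma> (?pre (Suc w))) \<and> (\<forall>w'. Suc w \<le> w' \<longrightarrow> s' (55, w') 0 = s (55, w') 0)) s2"
      using tab xu I by (simp del: wcount.simps)
  next
    fix s2
    assume "s2 (56, 0) 0 = enc (q * q) (sts \<sigma> (?pre kw)) \<and>
      words s2 kw (outs \<sigma> (?pre kw)) \<and> (\<forall>w'. kw \<le> w' \<longrightarrow> s2 (55, w') 0 = s (55, w') 0)"
    moreover have "?pre kw = W" using W by (simp add: words_def V_def[abs_def])
    ultimately show "words s2 kw ((mealy d z z ^^ l) W)"
      using outs_replicate[OF letters(4) pre[of kw], of l] by (simp add: \<sigma>_def)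
  qed auto
  moreover have "s (15, 0) 0 = enc (q * q) \<sigma>"
    using tablesD_vars(3)[OF T] by (simp add: \<sigma>_def)
  ultimately show ?thesis by (simp add: pass_prog_def)
qed

lemma wp_passes:
  assumes T: "tables s" and W: "words s kw W"
  shows "wp N X (seqs (map (\<lambda>g. pass_prog) [0..<n])) (\<lambda>s'. words s' kw ((mealy d z z ^^ (n * l)) W) \<and>
    same {42, 55, 56} s s') s"
proof -
  have m: "mods pass_prog \<subseteq> {42, 55, 56}" by (auto simp: pass_prog_def)
  have "wp N X (seqs (map (\<lambda>g. pass_prog) [0..<n])) (\<lambda>s'. words s' kw ((mealy d z z ^^ (n * l)) W)) s"
  proof (rule wp_seqs[where M = "{42, 55, 56}" and I = "\<lambda>g s'. words s' kw ((mealy d z z ^^ (g * l)) W)"])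
    fix g s1
    assume "words s1 kw ((mealy d z z ^^ (g * l)) W)" and s1: "same {42, 55, 56} s s1"
    moreover have "tables s1" by (rule tables_same[OF T s1]) auto
    ultimately have "wp N X pass_prog (\<lambda>s'. words s' kw ((mealy d z z ^^ l) ((mealy d z z ^^ (g * l)) W))) s1"
      by (intro wp_pass_prog)
    then show "wp N X pass_prog (\<lambda>s'. words s' kw ((mealy d z z ^^ (Suc g * l)) W)) s1"
      by (simp add: funpow_add)
  qed (use W m in auto)
  then show ?thesis by (rule wp_same) (use m in auto)
qed

text \<open>\<open>word_value_append\<close> splits off the leftmost word of a suffix. The exponent,
  the number of letters in the shorter suffix, is at most \<open>kw * l\<close>, so the lookup stays
  inside its row.\<close>

lemma wp_gather_prog:
  assumes T: "tables s" and W: "words s kw W"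
  shows "wp N X gather_prog (\<lambda>s'. number s' 58 b m2 (word_value z isone W)) s"
proof -
  define V where "V w = word s w" for w
  let ?suf = "\<lambda>i. concat (map V [kw - i..<kw])"
  have suf: "?suf (Suc i) = V (kw - 1 - i) @ ?suf i" if "i < kw" for i
  proof -
    have "kw - Suc i < kw" "Suc (kw - Suc i) = kw - i" using that by auto
    then have "[kw - Suc i..<kw] = (kw - Suc i) # [kw - i..<kw]" by (simp add: upt_conv_Cons)
    then show ?thesis by simp
  qed
  have cnt_suf: "count_letters z (?suf i) \<le> i * l" if "i \<le> kw" for i
    using that
  proof (induction i)
    case (Suc i)
    have "count_letters z (V (kw - 1 - i)) \<le> length (V (kw - 1 - i))"
      by (simp add: count_letters_def)
    also have "\<dots> \<le> l" using W Suc.prems by (simp add: words_def V_def)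
    finally show ?case using Suc suf[of i] by simp
  qed (simp add: count_letters_def)
  let ?M = "{30, 31, 42, 53, 57, 58}"
  let ?I = "\<lambda>i s'. s' (57, 0) 0 = count_letters z (?suf i) \<and> number s' 58 b m2 (word_value z isone (?suf i))"
  have step: "wp N X (gather_step (kw - 1 - i)) (?I (Suc i)) s1"
    if i: "i < kw" and I: "?I i s1" and s1: "same ?M s s1" for i s1
  proof -
    define w where "w = kw - 1 - i"
    define u where "u = s (55, w) 0"
    define e where "e = count_letters z (?suf i)"
    have w: "w < kw" using i by (simp add: w_def)
    have T1: "tables s1" by (rule tables_same[OF T s1]) auto
    have u: "u < U" unfolding u_def by (rule word_less[OF W w])
    have "e \<le> i * l" using cnt_suf i by (simp add: e_def)
    also have "\<dots> \<le> kw * l" using i by (intro mult_le_mono1) simp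
    finally have e: "e < E" by simp
    have su: "s1 (55, w) 0 = u" using sameD[OF s1] by (simp add: u_def)
    have tab: "s1 (51, 0) u = u * E" "s1 (49, 0) u = cnt u"
      "\<And>j. j < m2 \<Longrightarrow> s1 (52, j) (u * E + e) = dg b j (val u * 2 ^ e)"
      using tablesD(7,8)[OF T1] u e unfolding out_ok_def value_ok_def by blast+
    have "Suc u * E \<le> U * E" using u by (intro mult_le_mono1) simp
    then have ue: "u * E + e \<le> X" using e sizes_le(9) by (simp del: wcount.simps)
    have Vu: "dec q u = V w" by (simp add: u_def V_def)
    have suf': "?suf (Suc i) = V w @ ?suf i" using suf[OF i] by (simp add: w_def)
    have cnt': "cnt u + e = count_letters z (?suf (Suc i))" by (simp add: Vu suf' e_def)
    have val': "word_value z isone (?suf i) + val u * 2 ^ e = word_value z isone (?suf (Suc i))"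
      by (simp add: Vu suf' word_value_append e_def)
    have "cnt u + e \<le> Suc i * l" unfolding cnt' using i by (intro cnt_suf) simp
    also have "\<dots> \<le> kw * l" using i by (intro mult_le_mono1) simp
    also have "\<dots> \<le> X" using sizes_le(3) by linarith
    finally have cX: "cnt u + e \<le> X" .
    let ?s2 = "upd s1 (42, 0) 0 (u * E + e)"
    let ?end = "(57, 0) ::= AddV (Idx (49, 0) (Var (55, w))) (57, 0)"
    have "wp N X (move_digits 53 0 (Const 0) 52 0 (Var (42, 0)) m2)
      (wp N X (add_digits 26 27 58 53 0 m2) (wp N X ?end (?I (Suc i)))) ?s2"
    proof (rule wp_move_digits[where ?v1.0 = 0 and ?v2.0 = "u * E + e"])
      fix s3
      assume s3: "\<And>k y. s3 (53, k) y = (if 0 \<le> k \<and> k < 0 + m2 \<and> y = 0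
        then ?s2 (52, 0 + (k - 0)) (u * E + e) else ?s2 (53, k) y)" "same {53} ?s2 s3"
      have "same {42} s1 ?s2" by simp
      note s13 = same_Un[OF this s3(2)]
      show "wp N X (add_digits 26 27 58 53 0 m2) (wp N X ?end (?I (Suc i))) s3"
      proof (rule wp_add_digits[OF _ _ _ b2 sizes_le(6)])
        show "number s3 58 b m2 (word_value z isone (?suf i))"
          using I number_same[OF _ s13] by simp
        show "number s3 53 b m2 (val u * 2 ^ e)"
          using s3(1) tab(3) by (simp add: number_def)
        show "divmod s3 26 27 b" using tablesD(2)[OF T1] divmod_same[OF _ s13] by simp
        fix s4
        assume s4: "number s4 58 b m2 (word_value z isone (?suf i) + val u * 2 ^ e + 0)"
          "same {58, 30, 31} s3 s4"
        note s14 = same_Un[OF s13 s4(2)]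
        have "s4 (57, 0) 0 = e" "s4 (55, w) 0 = u" "s4 (49, 0) u = cnt u"
          using sameD[OF s14] I su tab(2) by (simp_all add: e_def)
        then show "wp N X ?end (?I (Suc i)) s4"
          using s4(1) cX cnt' val' by (simp add: number_def)
      qed simp_all
    next
      fix s3
      assume "same {53} ?s2 s3"
      then show "eval N s3 (Var (42, 0)) = u * E + e \<and> fits N X s3 (Var (42, 0))"
        by (simp add: sameD)
    qed auto
    then have "wp N X (gather_step w) (?I (Suc i)) s1"
      unfolding gather_step_def wp.simps(2,3)
      using su tab(1) I ue by (simp add: e_def)
    then show ?thesis by (simp add: w_def)
  qed
  have loop: "wp N X (seqs (map (\<lambda>i. gather_step (kw - 1 - i)) [0..<kw])) (?I kw) s1"
    if "?I 0 s1" and s1: "same {57, 58} s s1" for s1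
  proof (rule wp_seqs[where I = ?I and M = ?M])
    fix i s2
    assume i: "i < kw" and I: "?I i s2" and s2: "same ?M s1 s2"
    have "same ?M s s1" by (rule same_mono[OF s1]) simp
    from same_trans[OF this s2] show "wp N X (gather_step (kw - 1 - i)) (?I (Suc i)) s2"
      by (rule step[OF i I])
  next
    show "mods (gather_step (kw - 1 - i)) \<subseteq> ?M" for i by (auto simp: gather_step_def)
  qed (rule that(1))
  have "wp N X (const_digits 58 0 m2) (wp N X (seqs (map (\<lambda>i. gather_step (kw - 1 - i)) [0..<kw])) (?I kw)) (upd s (57, 0) 0 0)"
  proof (rule wp_const_digits[where \<beta> = b])
    fix s1
    assume n: "number s1 58 b m2 0" and s1: "same {58} (upd s (57, 0) 0 0) s1"
    have "same {57} s (upd s (57, 0) 0 0)" by simp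
    from same_Un[OF this s1] have "same {57, 58} s s1" by (rule same_mono) simp
    moreover have "s1 (57, 0) 0 = 0" using sameD[OF s1] by simp
    ultimately show "wp N X (seqs (map (\<lambda>i. gather_step (kw - 1 - i)) [0..<kw])) (?I kw) s1"
      using n by (intro loop) (simp_all add: count_letters_def)
  qed (use b2 in auto)
  then have "wp N X gather_prog (?I kw) s" by (simp add: gather_prog_def)
  moreover have "?suf kw = W" using W by (simp add: words_def V_def[abs_def])
  ultimately have "wp N X gather_prog (\<lambda>s'. s' (57, 0) 0 = count_letters z W \<and>
      number s' 58 b m2 (word_value z isone W)) s"
    by (simp only:)
  then show ?thesis by (rule wp_mono) blast
qed

text \<open>Origin of \<open>m2 = 3 * kw\<close>: with \<open>l = Suc l'\<close> one has
  \<open>2 ^ l' <= q ^ (3 * l') <= N <= b * b\<close>, and \<open>2 <= b\<close> gives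
  \<open>2 ^ l <= b ^ 3\<close>.\<close>

lemma two_power_le: "2 ^ (kw * l) \<le> b ^ m2"
proof -
  obtain l' where l': "l = Suc l'" using l(1) by (cases l) auto
  have "q ^ 3 * q ^ (3 * l') \<le> q ^ 3 * N" using l(3) by (simp add: l' power_add)
  then have "q ^ (3 * l') \<le> N" using q by simp
  moreover have "2 ^ l' \<le> q ^ l'" using q by (rule power_mono) simp
  moreover have "q ^ l' \<le> q ^ (3 * l')" using q by (intro power_increasing) auto
  ultimately have "2 ^ l' \<le> b * b" using base_square[of N] by linarith
  then have "2 * 2 ^ l' \<le> b * (b * b)" using b2 by (intro mult_le_mono)
  then have "2 ^ l \<le> b ^ 3" by (simp add: l' power3_eq_cube mult.assoc)
  then have "(2 ^ l) ^ kw \<le> (b ^ 3) ^ kw" by (rule power_mono) simp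
  then show ?thesis by (simp add: m2_def power_mult[symmetric] mult.commute)
qed

lemma wp_oper_prog:
  assumes dd: "1 \<le> dd" and T: "tables s" and Xs: "length Xs = r" "\<And>x. x \<in> set Xs \<Longrightarrow> x < N ^ dd"
    and input: "\<And>i j. i < r \<Longrightarrow> j < 2 * dd \<Longrightarrow> s (0, i * (2 * dd) + j) 0 = dg b j (Xs ! i)"
    and ca: "\<And>t. c * length (operands_word Xs) \<le> t \<Longrightarrow> word_value z isone ((mealy d z z ^^ t)
        (map (letter z0 z1 zs) (operands_word Xs) @ replicate t z)) = y"
  shows "wp N X oper_prog (\<lambda>s'. (\<forall>j<m2. s' (58, j) 0 = dg b j y) \<and> y < b ^ m2) s"
proof -
  let ?w = "map (letter z0 z1 zs) (operands_word Xs)"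
  let ?t = "c * kw0 * l"
  have fin: "wp N X gather_prog (\<lambda>s'. (\<forall>j<m2. s' (58, j) 0 = dg b j y) \<and> y < b ^ m2) s3"
    if w: "words s3 kw ((mealy d z z ^^ ?t) (?w @ replicate ?t z))" and len: "length ?w \<le> kw0 * l"
      and T3: "tables s3" for s3
  proof -
    \<comment> \<open>The input fits into \<open>kw0\<close> words of length at most
      \<open>l\<close>, so \<open>c\<close> times its length is at most \<open>?t\<close>. This is
      both the number of blanks appended and the number of steps made by \<open>c * kw0\<close>
      passes.\<close>
    have y: "word_value z isone ((mealy d z z ^^ ?t) (?w @ replicate ?t z)) = y"
      using len by (intro ca) (simp add: mult.assoc)
    have "y < 2 ^ length ((mealy d z z ^^ ?t) (?w @ replicate ?t z))"
      unfolding y[symmetric] by (rule word_value_less)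
    also have "\<dots> \<le> 2 ^ (kw * l)" using length_words[OF w] by (intro power_increasing) auto
    also have "\<dots> \<le> b ^ m2" by (rule two_power_le)
    finally have "y < b ^ m2" .
    from wp_gather_prog[OF T3 w] show ?thesis
      unfolding y by (rule wp_mono) (simp add: number_def \<open>y < b ^ m2\<close>)
  qed
  show ?thesis
    unfolding oper_prog_def wp.simps(3)
  proof (rule wp_mono[OF wp_operands[OF dd T Xs input]])
    fix s1
    assume s1: "words s1 kw0 ?w \<and> same {30, 31, 32, 53, 54, 55} s s1"
    have len: "length ?w \<le> kw0 * l" by (rule length_words) (use s1 in blast)
    have T1: "tables s1" by (rule tables_same[OF T conjunct2[OF s1]]) auto
    show "wp N X pad_prog (wp N X (seqs (map (\<lambda>g. pass_prog) [0..<c * kw0]))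
      (wp N X gather_prog (\<lambda>s'. (\<forall>j<m2. s' (58, j) 0 = dg b j y) \<and> y < b ^ m2))) s1"
    proof (rule wp_mono[OF wp_pad_prog[OF T1 conjunct1[OF s1]]])
      fix s2
      assume s2: "words s2 kw (?w @ replicate ?t z) \<and> same {55} s1 s2"
      have T2: "tables s2" by (rule tables_same[OF T1 conjunct2[OF s2]]) auto
      show "wp N X (seqs (map (\<lambda>g. pass_prog) [0..<c * kw0]))
        (wp N X gather_prog (\<lambda>s'. (\<forall>j<m2. s' (58, j) 0 = dg b j y) \<and> y < b ^ m2)) s2"
      proof (rule wp_mono[OF wp_passes[OF T2 conjunct1[OF s2]]])
        fix s3
        assume s3: "words s3 kw ((mealy d z z ^^ ?t) (?w @ replicate ?t z)) \<and> same {42, 55, 56} s2 s3"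
        have "tables s3" by (rule tables_same[OF T2 conjunct2[OF s3]]) auto
        then show "wp N X gather_prog (\<lambda>s'. (\<forall>j<m2. s' (58, j) 0 = dg b j y) \<and> y < b ^ m2) s3"
          using fin s3 len by blast
      qed
    qed
  qed
qed

end

section \<open>The whole pre-computation\<close>

context coded_operation
begin

definition pre_prog :: com where
  "pre_prog = ge_prog ;; base_prog ;; length_prog ;; tables_prog"

definition pre_factor :: nat where
  "pre_factor = (q ^ 3 * 3 + 4) + 6 + 18 + tables_factor * q ^ 6"

end

context coded_operation_run
begin

text \<open>Hides \<open>l\<close> and the tables, which are available only after the
  pre-computation, behind the one property passed on: the operation succeeds however array 0 is
  filled with operands.\<close>

definition ready :: "(nat list \<Rightarrow> nat) \<Rightarrow> store \<Rightarrow> bool" where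
  "ready opr s \<longleftrightarrow> (\<forall>Xs s'. length Xs = r \<longrightarrow> (\<forall>x\<in>set Xs. x < N ^ dd) \<longrightarrow> same {0} s s' \<longrightarrow>
     (\<forall>i<r. \<forall>j<2 * dd. s' (0, i * (2 * dd) + j) 0 = dg (base N) j (Xs ! i)) \<longrightarrow>
     run N X oper_prog (units oper_prog) s' (\<lambda>s''.
       (\<forall>j<m2. s'' (58, j) 0 = dg (base N) j (opr Xs)) \<and> opr Xs < base N ^ m2))"

lemma run_pre_prog:
  assumes dd: "1 \<le> dd"
    and ca: "\<And>Xs t. length Xs = r \<Longrightarrow> c * length (operands_word Xs) \<le> t \<Longrightarrow>
      word_value z isone ((mealy d z z ^^ t)
        (map (letter z0 z1 zs) (operands_word Xs) @ replicate t z)) = opr Xs"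
  obtains t s where "t \<le> pre_factor * N" "big N X pre_prog (\<lambda>_ _. 0) t s"
    "ready opr s"
    "base N \<le> X"
proof -
  let ?s0 = "\<lambda>_ _. 0 :: nat"
  obtain t1 s1 where 1: "t1 \<le> q ^ 3 * N * 3 + 4" "big N X ge_prog ?s0 t1 s1"
    "\<And>y. y < N + q ^ 3 * N \<Longrightarrow> s1 (6, 0) y = of_bool (N \<le> y)" "same {2, 3, 4, 6} ?s0 s1"
    using run_ge_prog[of ?s0] unfolding run_def by blast
  obtain t2 s2 where 2: "t2 \<le> N * 3 + 3" "big N X base_prog s1 t2 s2" "s2 (7, 0) 0 = base N"
    "same {7, 8} s1 s2" "base N * base N \<le> 4 * N"
    using run_base_prog[of s1, OF 1(3)] unfolding run_def by blast
  note c2 = same_Un[OF 1(4) 2(4)]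
  have "s2 (6, 0) y = of_bool (N \<le> y)" if "y < N + q ^ 3 * N" for y
    using 1(3)[OF that] sameD[OF 2(4), of 6 0] by simp
  moreover have "s2 (h, 0) 0 = 0" if "h \<in> {10, 11, 13, 14, 15}" for h
    using that sameD[OF c2, of h 0] by auto
  ultimately obtain t3 s3 l where 3: "t3 \<le> N * 8 + 10" "big N X length_prog s2 t3 s3"
    "same {9..15} s2 s3" "0 < l" "has_length s3 l" "N \<le> q ^ (3 * l)" "q ^ (3 * l) \<le> q ^ 3 * N"
    using run_length_prog[of s2] unfolding run_def by blast
  note c3 = same_Un[OF c2 3(3)]
  interpret coded_tables q d z0 z1 zs z isone r dd c N X l
    by standard (fact 3 2)+
  have "s3 (7, 0) 0 = base N" using 2(3) sameD[OF 3(3), of 7 0] by simp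
  moreover have "s3 (h, 0) = (\<lambda>_. 0)" if "h \<in> {19..25} \<union> {27, 29, 35, 36}" for h
    using that sameD[OF c3, of h 0] by auto
  ultimately obtain t4 s4 where 4: "t4 \<le> tables_factor * (q ^ 6 * N)" "big N X tables_prog s3 t4 s4"
    "tables s4"
    using run_tables_prog[OF 3(5)] unfolding run_def by blast
  show thesis
  proof
    show "big N X pre_prog ?s0 (t1 + (t2 + (t3 + t4))) s4"
      unfolding pre_prog_def by (rule big.Seq[OF 1(2) big.Seq[OF 2(2) big.Seq[OF 3(2) 4(2)]]])
    have "t1 \<le> (q ^ 3 * 3 + 4) * N" using 1(1) N by (simp add: algebra_simps)
    moreover have "t2 \<le> 6 * N" "t3 \<le> 18 * N" using 2(1) 3(1) N by linarith+
    moreover have "t4 \<le> tables_factor * q ^ 6 * N" using 4(1) by (simp add: mult.assoc)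
    ultimately show "t1 + (t2 + (t3 + t4)) \<le> pre_factor * N"
      unfolding pre_factor_def add_mult_distrib by linarith
    show "base N \<le> X" by (rule sizes_le)
    show "ready opr s4"
      unfolding ready_def
    proof (intro allI impI)
      fix Xs s'
      assume Xs: "length Xs = r" "\<forall>x\<in>set Xs. x < N ^ dd" and s': "same {0} s4 s'"
        and input: "\<forall>i<r. \<forall>j<2 * dd. s' (0, i * (2 * dd) + j) 0 = dg (base N) j (Xs ! i)"
      have "tables s'" by (rule tables_same[OF 4(3) s']) auto
      from dd this Xs(1) have "wp N X oper_prog (\<lambda>s''.
          (\<forall>j<m2. s'' (58, j) 0 = dg (base N) j (opr Xs)) \<and> opr Xs < base N ^ m2) s'"
        by (rule wp_oper_prog) (use Xs input ca in auto)
      then show "run N X oper_prog (units oper_prog) s' (\<lambda>s''.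
          (\<forall>j<m2. s'' (58, j) 0 = dg (base N) j (opr Xs)) \<and> opr Xs < base N ^ m2)"
        by (rule wp_run)
    qed
  qed
qed

end

section \<open>Choice of the layout, output, and the final bounds\<close>

lemma exp_wf_large: "\<exists>n. \<forall>H\<ge>n. \<forall>D\<ge>n. layout.exp_wf H D e"
proof (induction e)
  case (Idx k e)
  then obtain n where "\<forall>H\<ge>n. \<forall>D\<ge>n. layout.exp_wf H D e" by blast
  then show ?case
    by (intro exI[of _ "n + Suc (fst k + snd k)"]) (auto simp: layout.exp_wf.simps layout.valid_def)
next
  case (AddV e k)
  then obtain n where "\<forall>H\<ge>n. \<forall>D\<ge>n. layout.exp_wf H D e" by blast
  then show ?case
    by (intro exI[of _ "n + Suc (fst k + snd k)"]) (auto simp: layout.exp_wf.simps layout.valid_def)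
qed (auto simp: layout.exp_wf.simps)

text \<open>A program mentions finitely many names, so every sufficiently large layout contains
  them; this spares explicit dimensions.\<close>

lemma com_wf_large: "\<exists>n. \<forall>H\<ge>n. \<forall>D\<ge>n. layout.com_wf H D p"
proof (induction p)
  case (Put k e e')
  obtain n n' where "\<forall>H\<ge>n. \<forall>D\<ge>n. layout.exp_wf H D e" "\<forall>H\<ge>n'. \<forall>D\<ge>n'. layout.exp_wf H D e'"
    using exp_wf_large by meson
  then show ?case
    by (intro exI[of _ "n + n' + Suc (fst k + snd k)"])
       (auto simp: layout.com_wf.simps layout.valid_def)
next
  case (Seq p p')
  then obtain n n' where "\<forall>H\<ge>n. \<forall>D\<ge>n. layout.com_wf H D p" "\<forall>H\<ge>n'. \<forall>D\<ge>n'. layout.com_wf H D p'"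
    by blast
  then show ?case by (intro exI[of _ "n + n'"]) (auto simp: layout.com_wf.simps)
next
  case (If0 e p p')
  then obtain n n' where "\<forall>H\<ge>n. \<forall>D\<ge>n. layout.com_wf H D p" "\<forall>H\<ge>n'. \<forall>D\<ge>n'. layout.com_wf H D p'"
    by blast
  moreover obtain n'' where "\<forall>H\<ge>n''. \<forall>D\<ge>n''. layout.exp_wf H D e" using exp_wf_large by blast
  ultimately show ?case by (intro exI[of _ "n + n' + n''"]) (auto simp: layout.com_wf.simps)
next
  case (Until e p)
  then obtain n where "\<forall>H\<ge>n. \<forall>D\<ge>n. layout.com_wf H D p" by blast
  moreover obtain n' where "\<forall>H\<ge>n'. \<forall>D\<ge>n'. layout.exp_wf H D e" using exp_wf_large by blast
  ultimately show ?case by (intro exI[of _ "n + n'"]) (auto simp: layout.com_wf.simps)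
qed (auto simp: layout.com_wf.simps)

definition output_regs :: "(nat \<Rightarrow> nat) \<Rightarrow> nat \<Rightarrow> program" where
  "output_regs f n = concat (map (\<lambda>j. [Cst (f j), Load, Output]) [0..<n])"

lemma length_output_regs [simp]: "length (output_regs f n) = 3 * n"
  by (induction n) (auto simp: output_regs_def)

lemma reach_output_regs:
  assumes "code_at P (pc s) (output_regs f n)" "contents_bounded L s" "\<And>j. j < n \<Longrightarrow> f j \<le> L"
  shows "\<exists>s'. reach P N L (3 * n) s s' \<and> pc s' = pc s + 3 * n \<and> reg s' = reg s \<and>
    outputs s' = outputs s @ map (\<lambda>j. reg s (f j)) [0..<n]"
  using assms
proof (induction n)
  case 0
  then show ?case by (auto intro: reach_refl)
next
  case (Suc n)
  let ?is = "[Cst (f n), Load, Output]"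
  have o: "output_regs f (Suc n) = output_regs f n @ ?is" by (simp add: output_regs_def)
  then have "code_at P (pc s) (output_regs f n)" "code_at P (pc s + 3 * n) ?is"
    using Suc.prems(1) by (simp_all add: code_at_append)
  then obtain s1 where s1: "reach P N L (3 * n) s s1" "pc s1 = pc s + 3 * n" "reg s1 = reg s"
    "outputs s1 = outputs s @ map (\<lambda>j. reg s (f j)) [0..<n]"
    using Suc by auto
  have "reach P N L (length ?is) s1 (fold (exec N) ?is s1)"
  proof (rule straight_reach)
    show "code_at P (pc s1) ?is" using \<open>code_at P (pc s + 3 * n) ?is\<close> s1 by simp
    show "straight N L ?is s1"
      using reach_bounded[OF s1(1)] Suc.prems(3)[of n] by (auto simp: contents_bounded_def)
  qed
  moreover have "3 * Suc n = 3 * n + length ?is" by simp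
  ultimately have "reach P N L (3 * Suc n) s (fold (exec N) ?is s1)"
    using reach_trans[OF s1(1)] by (simp only:)
  then show ?case
    using s1 by (intro exI[of _ "fold (exec N) ?is s1"]) (auto simp: add.commute)
qed

lemma contents_bounded_mono: "contents_bounded L s \<Longrightarrow> L \<le> L' \<Longrightarrow> contents_bounded L' s"
  by (auto simp: contents_bounded_def intro: le_trans)

lemma reach_computes:
  assumes "reach P N L t s s'" "L \<le> L'" "t \<le> T" "pc s' = length P"
  shows "ram_computes P N L' T s s'"
  using assms contents_bounded_mono[OF _ assms(2)]
  unfolding ram_computes_def reach_def halted_def by auto

lemma length_concat_digits: "length (concat (map (digits \<beta> k) Xs)) = length Xs * k"
  by (induction Xs) (auto simp: digits_def)

lemma nth_concat_digits:
  "i < length Xs \<Longrightarrow> j < k \<Longrightarrow> concat (map (digits \<beta> k) Xs) ! (i * k + j) = dg \<beta> j (Xs ! i)"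
proof (induction Xs arbitrary: i)
  case (Cons x Xs)
  show ?case
  proof (cases i)
    case 0
    then show ?thesis using Cons.prems by (simp add: nth_append digits_def dg_def)
  next
    case (Suc i')
    then show ?thesis using Cons by (simp add: nth_append digits_def)
  qed
qed simp

theorem theorem8p15:
  fixes d r :: nat and opr :: "nat list \<Rightarrow> nat"
  assumes "1 \<le> d" and "1 \<le> r"
    and "ca_linear_time_operation r opr"
  shows "\<exists>(pre :: program) (oper :: program) K m. \<forall>N>0. \<exists>s.
           ram_computes pre N (K * N) (K * N) ram_init s \<and>
           (\<forall>Xs. length Xs = r \<and> (\<forall>X\<in>set Xs. X < N ^ d) \<longrightarrow>
              (\<exists>s'. ram_computes oper N (K * N) K (read_operands N d Xs s) s' \<and>
                    opr Xs < base N ^ m \<and>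
                    outputs s' = digits (base N) m (opr Xs)))"
proof -
  obtain q \<delta> z0 z1 zs z c isone where ca: "2 \<le> q" "cascade q \<delta>" "z0 < q" "z1 < q" "zs < q" "z < q"
    "\<And>Xs t. length Xs = r \<Longrightarrow> c * length (operands_word Xs) \<le> t \<Longrightarrow>
      word_value z isone ((mealy \<delta> z z ^^ t)
        (map (letter z0 z1 zs) (operands_word Xs) @ replicate t z)) = opr Xs"
    by (rule operation_as_cascade[OF assms(3)]) (rule that)
  interpret cascade q \<delta> by (fact ca(2))
  interpret coded_operation q \<delta> z0 z1 zs z isone r d c
    by standard (fact ca)+
  obtain n n' where n: "\<forall>H\<ge>n. \<forall>D\<ge>n. layout.com_wf H D pre_prog"
    "\<forall>H\<ge>n'. \<forall>D\<ge>n'. layout.com_wf H D oper_prog"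
    using com_wf_large[of pre_prog] com_wf_large[of oper_prog] by blast
  \<comment> \<open>Array 58 holds the result, so \<open>58 < H\<close> and \<open>m2 < D\<close>
    make its names valid. \<open>D\<close> also exceeds the number \<open>r * (2 * d)\<close> of
    operand digits, so the registers overwritten by reading are the cells 0 of the names
    \<open>(0, i)\<close>.\<close>
  define H where "H = n + n' + 59"
  define D where "D = n + n' + r * (2 * d) + m2 + 1"
  have HD: "58 < H" "m2 < D" by (simp_all add: H_def D_def)
  interpret layout H D .
  define pre where "pre = comp pre_prog 0"
  define outs where "outs = output_regs (\<lambda>j. code (58, j)) m2"
  define oper where "oper = comp oper_prog 0 @ outs"
  define W where "W = comp_len pre_prog + comp_len oper_prog"
  \<comment> \<open>The summands cover, in turn, the size of contents and addresses per unit of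
    \<open>N\<close>, the time of the pre-computation per unit of \<open>N\<close>, the time of the
    operation, and three instructions for each digit of the result.\<close>
  define K where "K = ((kw + 3) * q ^ 6 + 1) * stride + W * pre_factor + W * units oper_prog + 3 * m2"
  have wf: "com_wf pre_prog" "com_wf oper_prog" using n by (simp_all add: H_def D_def)
  have "\<exists>s. ram_computes pre N (K * N) (K * N) ram_init s \<and>
           (\<forall>Xs. length Xs = r \<and> (\<forall>X\<in>set Xs. X < N ^ d) \<longrightarrow>
              (\<exists>s'. ram_computes oper N (K * N) K (read_operands N d Xs s) s' \<and>
                    opr Xs < base N ^ m2 \<and>
                    outputs s' = digits (base N) m2 (opr Xs)))" if N: "0 < N" for N
  proof -
    define X where "X = (kw + 3) * q ^ 6 * N"
    define L where "L = (X + 1) * stride"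
    interpret coded_operation_run q \<delta> z0 z1 zs z isone r d c N X
      by standard (use N in \<open>auto simp: X_def\<close>)
    have "X + 1 \<le> ((kw + 3) * q ^ 6 + 1) * N" using N by (simp add: X_def add_mult_distrib)
    then have "L \<le> ((kw + 3) * q ^ 6 + 1) * N * stride" unfolding L_def by (rule mult_le_mono1)
    also have "\<dots> = ((kw + 3) * q ^ 6 + 1) * stride * N" by (simp only: mult_ac)
    also have "\<dots> \<le> K * N" unfolding K_def by (intro mult_le_mono1) linarith
    finally have LK: "L \<le> K * N" .
    obtain t \<sigma> where pre_run: "t \<le> pre_factor * N" "big N X pre_prog (\<lambda>_ _. 0) t \<sigma>"
      and ready: "ready opr \<sigma>" and bX: "base N \<le> X"
    proof (rule run_pre_prog[where opr = opr, OF assms(1)])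
      show "word_value z isone ((mealy \<delta> z z ^^ t)
          (map (letter z0 z1 zs) (operands_word Xs) @ replicate t z)) = opr Xs"
        if "length Xs = r" "c * length (operands_word Xs) \<le> t" for Xs t
        using that by (rule ca(7))
    qed (rule that)
    have "bounded_store X (\<lambda>_ _. 0)" by (simp add: bounded_store_def)
    moreover have "code_at pre (pc ram_init) (comp pre_prog (pc ram_init))"
      by (auto simp: pre_def ram_init_def code_at_def)
    moreover have "contents_bounded L ram_init" by (simp add: contents_bounded_def ram_init_def)
    moreover have "represents (\<lambda>_ _. 0) (reg ram_init)" by (simp add: represents_def ram_init_def)
    moreover have "(X + 1) * stride \<le> L" by (simp add: L_def)
    ultimately obtain t' s where s: "t' \<le> W * t" "reach pre N L t' ram_init s"
      "pc s = comp_len pre_prog" "represents \<sigma> (reg s)"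
      using reach_com[OF pre_run(2) wf(1), of pre ram_init L W] by (auto simp: W_def ram_init_def)
    have "t' \<le> W * (pre_factor * N)" using s(1) pre_run(1) by (meson le_trans mult_le_mono2)
    also have "\<dots> = W * pre_factor * N" by simp
    also have "\<dots> \<le> K * N" unfolding K_def by (intro mult_le_mono1) linarith
    finally have "ram_computes pre N (K * N) (K * N) ram_init s"
      using s LK by (intro reach_computes[OF s(2)]) (simp_all add: pre_def)
    moreover have "\<exists>s'. ram_computes oper N (K * N) K (read_operands N d Xs s) s' \<and>
                    opr Xs < base N ^ m2 \<and> outputs s' = digits (base N) m2 (opr Xs)"
      if Xs: "length Xs = r" "\<forall>X\<in>set Xs. X < N ^ d" for Xs
    proof -
      let ?ds = "concat (map (digits (base N) (2 * d)) Xs)"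
      define s0 where "s0 = read_operands N d Xs s"
      \<comment> \<open>The imperative store matching the registers once the operands have been
        read; it differs from \<open>\<sigma>\<close> only in array 0.\<close>
      define \<sigma>0 where "\<sigma>0 = (\<lambda>k x. if fst k = 0 \<and> x = 0 \<and> snd k < length ?ds then ?ds ! snd k else \<sigma> k x)"
      have len: "length ?ds = r * (2 * d)" by (simp add: length_concat_digits Xs(1))
      have ds: "?ds ! i < base N" if "i < length ?ds" for i
      proof -
        have "0 < base N" by (simp add: base_def)
        then have "set ?ds \<subseteq> {..<base N}" by (auto simp: digits_def)
        then show ?thesis using nth_mem[OF that] by blast
      qed
      then have ds': "?ds ! i \<le> X" if "i < length ?ds" for i
        using that bX by (meson le_trans less_imp_le)
      have s0: "pc s0 = 0" "outputs s0 = []" "acc s0 = acc s" "buf s0 = buf s"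
        "reg s0 = (\<lambda>a. if a < length ?ds then ?ds ! a else reg s a)"
        by (simp_all add: s0_def read_operands_def Let_def)
      have XL: "X \<le> L" by (simp add: L_def stride_def)
      have bounded0: "contents_bounded L s0"
        using reach_bounded[OF s(2)] s0 le_trans[OF ds' XL] unfolding contents_bounded_def by auto
      have "bounded_store X \<sigma>"
        by (rule big_bounded[OF pre_run(2)]) (simp add: bounded_store_def)
      then have bounded\<sigma>: "bounded_store X \<sigma>0"
        using ds' by (auto simp: bounded_store_def \<sigma>0_def)
      have rep: "represents \<sigma>0 (reg s0)"
        unfolding represents_def
      proof (intro allI impI)
        fix k x
        assume k: "valid k"
        obtain h i where hi: "k = (h, i)" by (cases k)
        have DS: "length ?ds < D" by (simp add: len D_def)
        \<comment> \<open>\<open>stride\<close> and \<open>D\<close> both exceed the number of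
          operand digits, so no other cell lies among the overwritten registers.\<close>
        have small: "x * stride + code k < length ?ds \<longleftrightarrow> h = 0 \<and> x = 0 \<and> i < length ?ds"
        proof
          assume a: "x * stride + code k < length ?ds"
          have "1 \<le> H" by (simp add: H_def)
          then have "1 * D \<le> H * D" by (rule mult_le_mono1)
          then have "D \<le> stride" unfolding stride_def by linarith
          then have "x = 0" using a DS by (cases x) auto
          moreover have "h = 0" using a DS by (cases h) (auto simp: code_def hi)
          ultimately show "h = 0 \<and> x = 0 \<and> i < length ?ds" using a by (simp add: code_def hi)
        qed (simp add: code_def hi)
        have old: "reg s (x * stride + code k) = \<sigma> k x"
          using s(4) k unfolding represents_def by blast
        show "reg s0 (x * stride + code k) = \<sigma>0 k x"
          unfolding s0(5) small \<sigma>0_def old using hi by (auto simp: code_def)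
      qed
      have "run N X oper_prog (units oper_prog) \<sigma>0
        (\<lambda>s''. (\<forall>j<m2. s'' (58, j) 0 = dg (base N) j (opr Xs)) \<and> opr Xs < base N ^ m2)"
      proof (rule ready[unfolded ready_def, rule_format, OF Xs(1)])
        show "same {0} \<sigma> \<sigma>0" by (auto simp: same_def \<sigma>0_def fun_eq_iff)
        fix i j
        assume i: "i < r" and j: "j < 2 * d"
        have "Suc i * (2 * d) \<le> r * (2 * d)" using i by (intro mult_le_mono1) simp
        then have "i * (2 * d) + j < length ?ds" using j by (simp add: len)
        then show "\<sigma>0 (0, i * (2 * d) + j) 0 = dg (base N) j (Xs ! i)"
          using nth_concat_digits[of i Xs j "2 * d"] i j Xs(1) by (simp add: \<sigma>0_def)
      qed (use Xs(2) in blast)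
      then obtain t1 \<sigma>1 where \<sigma>1: "t1 \<le> units oper_prog" "big N X oper_prog \<sigma>0 t1 \<sigma>1"
        "\<forall>j<m2. \<sigma>1 (58, j) 0 = dg (base N) j (opr Xs)" "opr Xs < base N ^ m2"
        by (auto simp: run_def)
      have "code_at oper 0 (comp oper_prog 0 @ outs)" by (auto simp: oper_def code_at_def)
      then have at: "code_at oper (pc s0) (comp oper_prog (pc s0))" "code_at oper (comp_len oper_prog) outs"
        by (simp_all add: code_at_append s0)
      obtain t2 s1 where s1: "t2 \<le> W * t1" "reach oper N L t2 s0 s1" "pc s1 = comp_len oper_prog"
        "represents \<sigma>1 (reg s1)" "outputs s1 = []"
        using reach_com[OF \<sigma>1(2) wf(2) at(1) bounded0 rep bounded\<sigma>, of W] s0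
        by (auto simp: W_def L_def)
      have valid: "valid (58, j)" if "j < m2" for j
        using that HD by (simp add: valid_def)
      have regs: "reg s1 (code (58, j)) = dg (base N) j (opr Xs)" if "j < m2" for j
      proof -
        have "reg s1 (0 * stride + code (58, j)) = \<sigma>1 (58, j) 0"
          using s1(4) valid[OF that] unfolding represents_def by blast
        then show ?thesis using \<sigma>1(3) that by simp
      qed
      have "code (58, j) \<le> L" if "j < m2" for j
        using code_less[OF valid[OF that]] by (auto simp: L_def stride_def)
      then obtain s2 where s2: "reach oper N L (3 * m2) s1 s2" "pc s2 = pc s1 + 3 * m2"
        "outputs s2 = outputs s1 @ map (\<lambda>j. reg s1 (code (58, j))) [0..<m2]"
        using reach_output_regs[of oper s1 "\<lambda>j. code (58, j)" m2 L N] at(2) s1(3) reach_bounded[OF s1(2)]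
        by (auto simp: outs_def)
      have "outputs s2 = digits (base N) m2 (opr Xs)"
        unfolding s2(3) s1(5) digits_def using regs by (simp add: dg_def)
      moreover have "ram_computes oper N (K * N) K s0 s2"
      proof (rule reach_computes[OF reach_trans[OF s1(2) s2(1)] LK])
        have "t2 \<le> W * units oper_prog" using s1(1) \<sigma>1(1) by (meson le_trans mult_le_mono2)
        then show "t2 + 3 * m2 \<le> K" by (simp add: K_def)
        show "pc s2 = length oper" by (simp add: s2(2) s1(3) oper_def outs_def)
      qed
      ultimately show ?thesis using \<sigma>1(4) unfolding s0_def by blast
    qed
    ultimately show ?thesis by blast
  qed
  then show ?thesis by blast
qed

end
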